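(* Let $F:\mathbb{R}^n\rightrightarrows\mathbb{R}^n$ be a multifunction such that: (i) $F(x)$ is nonempty, convex and compact for each $x\in\mathbb{R}^n$; (ii) $F$ is locally Lipschitz with respect to the Hausdorff metric; (iii) there exists $\rho>0$ with $\max\{|v|: v\in F(x)\}\le \rho(1+|x|)$ for all $x\in\mathbb{R}^n$. Let $H(x,p)=\sup_{v\in F(x)}\langle v,p\rangle$ and assume that for every nonempty, convex, compact $K\subset\mathbb{R}^n$: (iv) there exists $c\ge 0$ such that, for every $p\in\mathbb{R}^n$, the map $x\mapsto H(x,p)$ is semiconvex on $K$ with constant $c|p|$; (v) the gradient $\nabla_pH(x,p)$ exists for all $x\in K$, $p\neq 0$, and is locally Lipschitz in $x$ on $K$, uniformly over $p$ in any compact subset of $\mathbb{R}^n\smallsetminus\{0\}$. Assume moreover that $F$ is locally strongly convex and that $\phi:\mathbb{R}^n\to\mathbb{R}$ is locally Lipschitz. Let $\overline{x}:[t_0,T]\to\mathbb{R}^n$ be an optimal solution of the Mayer problem $\mathcal{P}(t_0,x_0)$. Then, for any $q\in\partial^{+,pr}\phi(\overline{x}(T))$, there exists an absolutely continuous solution $\overline{p}:[t_0,T]\to\mathbb{R}^n$ of $$-\dot{p}(s)\in\partial_x^-H(\overline{x}(s),p(s))\ \text{ for a.e. } s\in[t_0,T],\qquad -p(T)=q.$$ Furthermore, every such solution $\overline{p}(\cdot)$ satisfies the maximum principle $$H(\overline{x}(t),\overline{p}(t))=\langle\dot{\overline{x}}(t),\overline{p}(t)\rangle\qquad\text{for a.e.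 } t\in[t_0,T].$$ If $q\neq 0$, then this last equality holds for every $t\in[t_0,T]$.
   Context: $T>0$ is fixed, $|\cdot|$ is the Euclidean norm, $\langle\cdot,\cdot\rangle$ the inner product, $B(x,\epsilon)$ the closed ball of center $x$ and radius $\epsilon$. Derivatives at endpoints of an interval are one-sided. Mayer problem. For $(t_0,x_0)\in[0,T]\times\mathbb{R}^n$, a trajectory is an absolutely continuous $x:[t_0,T]\to\mathbb{R}^n$ with $\dot x(s)\in F(x(s))$ for a.e. $s\in[t_0,T]$ and $x(t_0)=x_0$. The problem $\mathcal{P}(t_0,x_0)$ is to minimize $\phi(x(T))$ over all such trajectories; an optimal solution is a trajectory attaining the infimum. Semiconvexity. $u$ is semiconvex on $K$ with constant $C$ if it is continuous there and $u(x+h)+u(x-h)-2u(x)\ge -C|h|^2$ for all $x,h$ with the segment $[x-h,x+h]\subset K$. Strong convexity. For a convex set $A\subset\mathbb{R}^n$ and $z\in A$, the normal cone is $N_A(z)=\{p\in\mathbb{R}^n:\langle p,v-z\rangle\le 0\ \forall v\in A\}$. A compact convex set $A$ is $R$-convex ($R>0$) if for all $z,y\in\partial A$ (the boundary of $A$) and all $n\in N_A(z)$, $m\in N_A(y)$ with $|n|=|m|=1$ one has $|z-y|\le R|n-m|$. $F$ is locally strongly convex if for each compact $K\subset\mathbb{R}^n$ there exists $R>0$ such that $F(x)$ is $R$-convex for every $x\in K$. Generalized differentials. The Fréchet subdifferential $\partial^-f(x)$ is the set of $p$ with $\liminf_{y\to x}\frac{f(y)-f(x)-\langle p,y-x\rangle}{|y-x|}\ge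 0$; the proximal superdifferential $\partial^{+,pr}f(x)$ is the set of $p$ for which there are constants $c,\rho$ (with $\rho>0$) such that $f(y)-f(x)-\langle p,y-x\rangle\le c|y-x|^2$ for all $y\in B(x,\rho)$. $\partial_x^-H(x,p)$ is the Fréchet subdifferential of $H(\cdot,p)$ at $x$. *)

theory Defs
  imports "HOL-Analysis.Analysis"
begin

text \<open>
  A finite family of subintervals is a finite set of pairs of endpoints, with the corresponding
  open intervals pairwise disjoint.
\<close>
definition absolutely_continuous_on :: "real set \<Rightarrow> (real \<Rightarrow> 'a::real_normed_vector) \<Rightarrow> bool" where
  "absolutely_continuous_on S f \<longleftrightarrow>
     (\<forall>\<epsilon>>0. \<exists>\<delta>>0. \<forall>I. finite I \<longrightarrow>
        (\<forall>(a, b)\<in>I. a \<le> b \<and> {a..b} \<subseteq> S) \<longrightarrow>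
        pairwise (\<lambda>(a, b) (c, d). {a<..<b} \<inter> {c<..<d} = {}) I \<longrightarrow>
        (\<Sum>(a, b)\<in>I. b - a) < \<delta> \<longrightarrow>
        (\<Sum>(a, b)\<in>I. norm (f b - f a)) < \<epsilon>)"

definition locally_lipschitz :: "('a::metric_space \<Rightarrow> 'b::metric_space) \<Rightarrow> bool" where
  "locally_lipschitz f \<longleftrightarrow> (\<forall>x. \<exists>u>0. \<exists>L. L-lipschitz_on (cball x u) f)"

text \<open>The real-valued suprema are meaningful for nonempty bounded sets, the only case used here.\<close>
definition hausdorff_dist :: "'a::metric_space set \<Rightarrow> 'a set \<Rightarrow> real" where
  "hausdorff_dist A B = max (SUP a\<in>A. infdist a B) (SUP b\<in>B. infdist b A)"

definition hausdorff_locally_lipschitz :: "('a::metric_space \<Rightarrow> 'b::metric_space set) \<Rightarrow> bool" where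
  "hausdorff_locally_lipschitz F \<longleftrightarrow>
     (\<forall>x. \<exists>u>0. \<exists>L\<ge>0. \<forall>y\<in>cball x u. \<forall>z\<in>cball x u.
        hausdorff_dist (F y) (F z) \<le> L * dist y z)"

definition hamiltonian :: "('a \<Rightarrow> 'b::real_inner set) \<Rightarrow> 'a \<Rightarrow> 'b \<Rightarrow> real" where
  "hamiltonian F x p = (SUP v\<in>F x. v \<bullet> p)"

definition semiconvex_on :: "'a::real_normed_vector set \<Rightarrow> real \<Rightarrow> ('a \<Rightarrow> real) \<Rightarrow> bool" where
  "semiconvex_on K C u \<longleftrightarrow>
     continuous_on K u \<and>
     (\<forall>x h. closed_segment (x - h) (x + h) \<subseteq> K \<longrightarrow>
        u (x + h) + u (x - h) - 2 * u x \<ge> - C * (norm h)\<^sup>2)"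

definition normal_cone :: "'a::real_inner set \<Rightarrow> 'a \<Rightarrow> 'a set" where
  "normal_cone A z = {p. \<forall>v\<in>A. p \<bullet> (v - z) \<le> 0}"

definition R_convex :: "real \<Rightarrow> 'a::real_inner set \<Rightarrow> bool" where
  "R_convex R A \<longleftrightarrow>
     compact A \<and> convex A \<and>
     (\<forall>z\<in>frontier A. \<forall>y\<in>frontier A. \<forall>n\<in>normal_cone A z. \<forall>m\<in>normal_cone A y.
        norm n = 1 \<longrightarrow> norm m = 1 \<longrightarrow> norm (z - y) \<le> R * norm (n - m))"

definition locally_strongly_convex :: "('a::topological_space \<Rightarrow> 'b::real_inner set) \<Rightarrow> bool" where
  "locally_strongly_convex F \<longleftrightarrow>
     (\<forall>K. compact K \<longrightarrow> (\<exists>R>0. \<forall>x\<in>K. R_convex R (F x)))"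

definition frechet_subdifferential :: "('a::real_inner \<Rightarrow> real) \<Rightarrow> 'a \<Rightarrow> 'a set" where
  "frechet_subdifferential f x =
     {p. Liminf (at x) (\<lambda>y. ereal ((f y - f x - p \<bullet> (y - x)) / norm (y - x))) \<ge> 0}"

definition proximal_superdifferential :: "('a::real_inner \<Rightarrow> real) \<Rightarrow> 'a \<Rightarrow> 'a set" where
  "proximal_superdifferential f x =
     {p. \<exists>c. \<exists>\<rho>>0. \<forall>y\<in>cball x \<rho>. f y - f x - p \<bullet> (y - x) \<le> c * (norm (y - x))\<^sup>2}"

text \<open>
  Curves on \<open>[t0, T]\<close> are total functions whose values outside the interval are irrelevant.
  Derivatives are taken within \<open>{t0..T}\<close>, hence are one-sided at the endpoints, and statements about
  them assert that the derivative exists. For \<open>t0 < T\<close> it is unique; in the degenerate case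
  \<open>t0 = T\<close> every vector is a derivative within \<open>{T}\<close>.
\<close>
definition trajectory ::
    "('a::euclidean_space \<Rightarrow> 'a set) \<Rightarrow> real \<Rightarrow> real \<Rightarrow> 'a \<Rightarrow> (real \<Rightarrow> 'a) \<Rightarrow> bool" where
  "trajectory F T t0 x0 x \<longleftrightarrow>
     absolutely_continuous_on {t0..T} x \<and>
     (AE s in lebesgue_on {t0..T}.
        \<exists>v. (x has_vector_derivative v) (at s within {t0..T}) \<and> v \<in> F (x s)) \<and>
     x t0 = x0"

definition mayer_optimal ::
    "('a::euclidean_space \<Rightarrow> 'a set) \<Rightarrow> ('a \<Rightarrow> real) \<Rightarrow> real \<Rightarrow> real \<Rightarrow> 'a \<Rightarrow> (real \<Rightarrow> 'a) \<Rightarrow> bool" where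
  "mayer_optimal F \<phi> T t0 x0 x \<longleftrightarrow>
     trajectory F T t0 x0 x \<and> (\<forall>y. trajectory F T t0 x0 y \<longrightarrow> \<phi> (x T) \<le> \<phi> (y T))"

definition adjoint_solution ::
    "('a::euclidean_space \<Rightarrow> 'a set) \<Rightarrow> real \<Rightarrow> real \<Rightarrow> (real \<Rightarrow> 'a) \<Rightarrow> 'a \<Rightarrow> (real \<Rightarrow> 'a) \<Rightarrow> bool" where
  "adjoint_solution F T t0 x q p \<longleftrightarrow>
     absolutely_continuous_on {t0..T} p \<and>
     (AE s in lebesgue_on {t0..T}.
        \<exists>w. (p has_vector_derivative w) (at s within {t0..T}) \<and>
            - w \<in> frechet_subdifferential (\<lambda>y. hamiltonian F y (p s)) (x s)) \<and>
     - p T = q"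

end

theory Submission
  imports Defs
begin

text \<open>
  Let \<open>Z x p\<close> be the unique maximizer of \<open>v \<bullet> p\<close> over \<open>F x\<close>, which is the gradient of \<open>H x\<close> at \<open>p\<close>. Strong
  convexity of the values of \<open>F\<close> gives \<open>H x p - v \<bullet> p \<ge> \<kappa> |v - Z x p|\<^sup>2\<close> for \<open>v \<in> F x\<close>. Given an adjoint
  arc \<open>p\<close> with \<open>q \<noteq> 0\<close>, compare the optimal \<open>x\<close> with the solution \<open>y\<close> of \<open>y' = Z y p\<close>, \<open>y b = x b\<close>: by
  semiconvexity of \<open>H\<close> the derivative of \<open>p \<bullet> (y - x)\<close> is at least \<open>\<kappa> |x' - Z x p|\<^sup>2 - c |y - x|\<^sup>2\<close>,
  whereas \<open>|y - x|\<^sup>2\<close> is at most a small multiple of the integral of \<open>|x' - Z x p|\<^sup>2\<close> when \<open>x' = Z x p\<close>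
  holds outside a short window starting at \<open>b\<close>. Optimality and the proximal inequality at \<open>q\<close> bound
  \<open>p \<bullet> (y - x)\<close> at the final time by a multiple of \<open>|y - x|\<^sup>2\<close>, which forces \<open>y = x\<close>. Moving the window
  backwards from \<open>T\<close> shows that \<open>x' = Z x p\<close> everywhere.
\<close>

text \<open>In the comparison both the gain and the loss are quadratic in the defect
  \<open>x' - Z x p\<close>, so only the shortness of the window can decide between them. Young's
  inequality with weight equal to the window length makes the loss a multiple of that length. Once
  the window is over, \<open>x\<close> and \<open>y\<close> follow the same Lipschitz field and no
  new loss arises; this is why the argument must run backwards from \<open>T\<close>, with a window
  length that does not depend on the position reached. The integral of the squared defect is never
  formed. The function \<open>p \<bullet> (y - x)\<close>, whose derivative dominates it, takes its
  place, and the estimates follow from one monotonicity principle for absolutely continuous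
  functions. The hypotheses give constants only on compact convex sets. Hence all is done on a ball
  \<open>K\<close> containing a tube around \<open>x\<close>, and \<open>y\<close> has to be kept in
  that tube. The equation \<open>x' = Z x p\<close> has a continuous right-hand side, which is how a
  relation known almost everywhere becomes one at every time.\<close>

section \<open>Almost everywhere differentiability\<close>

text \<open>
  Inside an open set little larger than the exceptional set \<open>E\<close>, Vitali's theorem covers \<open>E\<close> by intervals
  of slope below \<open>a\<close>, and then again, within those, by intervals of slope above \<open>b\<close>. Comparing the
  increments of \<open>f\<close> gives \<open>b |E| \<le> a |E|\<close>.
\<close>
lemma negligible_Dini_gap:
  fixes f :: "real \<Rightarrow> real"
  assumes mono: "\<And>x y. x \<le> y \<Longrightarrow> f x \<le> f y" and cont: "continuous_on UNIV f"
    and "0 < a" "a < b"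
  defines "low \<equiv> \<lambda>d. {x. \<exists>c r. 0 < r \<and> r < d \<and> \<bar>x - c\<bar> < r \<and> f (c + r) - f (c - r) < a * (2 * r)}"
  defines "high \<equiv> \<lambda>d. {x. \<exists>c r. 0 < r \<and> r < d \<and> \<bar>x - c\<bar> < r \<and> f (c + r) - f (c - r) > b * (2 * r)}"
  shows "negligible {x. \<forall>d>0. x \<in> low d \<and> x \<in> high d}"
proof -
  define E where "E = {x. \<forall>d>0. x \<in> low d \<and> x \<in> high d}"
  \<comment> \<open>The intervals only have to contain \<open>x\<close> and need not be centred
    there, so both sets are unions of balls; \<open>E\<close> is then a countable intersection of
    open sets and measurable.\<close>
  have openE: "open (low d)" "open (high d)" for d
  proof -
    have "low d = (\<Union>c. \<Union>r\<in>{r. 0 < r \<and> r < d \<and> f (c + r) - f (c - r) < a * (2 * r)}. ball c r)"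
      by (auto simp: low_def dist_real_def abs_minus_commute; blast)
    then show "open (low d)" by auto
    have "high d = (\<Union>c. \<Union>r\<in>{r. 0 < r \<and> r < d \<and> f (c + r) - f (c - r) > b * (2 * r)}. ball c r)"
      by (auto simp: high_def dist_real_def abs_minus_commute; blast)
    then show "open (high d)" by auto
  qed
  have anti: "low d \<subseteq> low d'" "high d \<subseteq> high d'" if "d \<le> d'" for d d'
    using that order_less_le_trans[of _ d d'] unfolding low_def high_def by blast+
  have E_eq: "E = (\<Inter>n::nat. low (1 / (n + 1)) \<inter> high (1 / (n + 1)))"
  proof safe
    fix x assume "x \<in> (\<Inter>n::nat. low (1 / (n + 1)) \<inter> high (1 / (n + 1)))"
    then have *: "x \<in> low (1 / (real n + 1))" "x \<in> high (1 / (real n + 1))" for n by auto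
    show "x \<in> E" unfolding E_def
    proof safe
      fix d :: real assume "d > 0"
      then obtain n :: nat where "1 / (real n + 1) < d"
        using reals_Archimedean[of d] by (auto simp: inverse_eq_divide add.commute)
      then show "x \<in> low d" "x \<in> high d" using * anti[of "1 / (real n + 1)" d] by auto
    qed
  qed (auto simp: E_def)
  have "E \<in> sets borel" unfolding E_eq using openE by auto
  then have Esets: "E \<in> sets lebesgue" by simp
  \<comment> \<open>The Stieltjes measure turns the total increment of \<open>f\<close> over
    disjoint intervals into the measure of their union. The second cover lies inside the first, so
    monotonicity of the measure compares the two totals.\<close>
  define \<nu> where "\<nu> = interval_measure f"
  have nu: "emeasure \<nu> (cball c r) = ennreal (f (c + r) - f (c - r))" if "r > 0" for c r
    unfolding \<nu>_def cball_eq_atLeastAtMost using that cont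
    by (intro emeasure_interval_measure_Icc mono) (auto simp: continuous_on_eq_continuous_at)
  have "negligible (E \<inter> cball 0 n)" for n :: nat
  proof -
    define A where "A = E \<inter> cball 0 (real n)"
    have A: "A \<in> lmeasurable" unfolding A_def
      using fmeasurable_Int_fmeasurable[OF lmeasurable_cball Esets] by (simp add: Int_commute)
    have bound: "measure lebesgue A \<le> a / b * (measure lebesgue A + e)" if "e > 0" for e
    proof -
      obtain W where "open W" "A \<subseteq> W" "W - A \<in> lmeasurable" and small: "emeasure lebesgue (W - A) < ennreal e"
        using sets_lebesgue_outer_open[of A e] A \<open>e > 0\<close> by (metis fmeasurableD)
      moreover have "W \<in> lmeasurable"
        using fmeasurable.Un[OF A \<open>W - A \<in> lmeasurable\<close>] \<open>A \<subseteq> W\<close> by (simp add: Un_absorb1)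
      moreover have "measure lebesgue (W - A) < e"
        using small \<open>W - A \<in> lmeasurable\<close> \<open>e > 0\<close> by (simp add: emeasure_eq_measure2 ennreal_less_iff)
      ultimately have W: "open W" "A \<subseteq> W" "W \<in> lmeasurable" "measure lebesgue W < measure lebesgue A + e"
        using measurable_measure_Diff[of W lebesgue A] A by auto
      define K where "K = {(c, r). 0 < r \<and> cball c r \<subseteq> W \<and> f (c + r) - f (c - r) < a * (2 * r)}"
      have K_pos: "0 < snd i" if "i \<in> K" for i using that unfolding K_def by auto
      have 1: "\<exists>i. i \<in> K \<and> x \<in> cball (fst i) (snd i) \<and> snd i < d" if "x \<in> A" "0 < d" for x d
      proof -
        from that W obtain s where s: "s > 0" "cball x s \<subseteq> W" by (meson open_contains_cball subsetD)
        have "x \<in> low (min d (s/2))" using that s by (auto simp: A_def E_def)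
        then obtain c r where cr: "0 < r" "r < d" "r < s/2" "\<bar>x - c\<bar> < r" "f (c + r) - f (c - r) < a * (2 * r)"
          unfolding low_def by auto
        have "cball c r \<subseteq> cball x s" using cr by (auto simp: dist_real_def)
        then show ?thesis using cr s by (intro exI[of _ "(c, r)"]) (auto simp: K_def dist_real_def)
      qed
      obtain C where C: "countable C" "C \<subseteq> K" "pairwise (\<lambda>i j. disjnt (cball (fst i) (snd i)) (cball (fst j) (snd j))) C"
         "negligible (A - (\<Union>i \<in> C. cball (fst i) (snd i)))"
        by (rule Vitali_covering_theorem_cballs[of K snd A fst, OF K_pos 1])
      let ?I = "\<lambda>i::real \<times> real. cball (fst i) (snd i)"
      \<comment> \<open>The second cover needs room inside a single interval of the first, so
        endpoints are discarded; they are countably many.\<close>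
      define A' where "A' = A \<inter> (\<Union>i\<in>C. ball (fst i) (snd i))"
      have "negligible (\<Union>i\<in>C. sphere (fst i) (snd i))"
        using C(1) by (intro negligible_countable_Union) (auto intro!: negligible_sphere)
      then have negA: "negligible (A - A')"
        proof (rule negligible_subset[OF negligible_Un[OF C(4)]])
        show "A - A' \<subseteq> A - (\<Union>i\<in>C. ?I i) \<union> (\<Union>i\<in>C. sphere (fst i) (snd i))"
        proof
          fix x assume x: "x \<in> A - A'"
          show "x \<in> A - (\<Union>i\<in>C. ?I i) \<union> (\<Union>i\<in>C. sphere (fst i) (snd i))"
          proof (cases "x \<in> (\<Union>i\<in>C. ?I i)")
            case True
            then obtain i where "i \<in> C" "dist (fst i) x \<le> snd i" by (auto simp del: mem_cball simp: mem_cball)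
            moreover from this x have "\<not> dist (fst i) x < snd i" by (auto simp: A'_def)
            ultimately have "x \<in> sphere (fst i) (snd i)" by simp
            then show ?thesis using \<open>i \<in> C\<close> by blast
          qed (use x in blast)
        qed
      qed
      define K' where "K' = {(c, r). 0 < r \<and> cball c r \<subseteq> (\<Union>i\<in>C. ?I i) \<and> b * (2 * r) < f (c + r) - f (c - r)}"
      have K'_pos: "0 < snd i" if "i \<in> K'" for i using that unfolding K'_def by auto
      have 2: "\<exists>i. i \<in> K' \<and> x \<in> cball (fst i) (snd i) \<and> snd i < d" if "x \<in> A'" "0 < d" for x d
      proof -
        from that obtain i where i: "i \<in> C" "x \<in> ball (fst i) (snd i)" by (auto simp: A'_def)
        obtain s where s: "s > 0" "cball x s \<subseteq> ball (fst i) (snd i)"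
          using i by (meson open_ball open_contains_cball subsetD)
        have "x \<in> high (min d (s/2))" using that s by (auto simp: A'_def A_def E_def)
        then obtain c r where cr: "0 < r" "r < d" "r < s/2" "\<bar>x - c\<bar> < r" "b * (2 * r) < f (c + r) - f (c - r)"
          unfolding high_def by auto
        have "cball c r \<subseteq> cball x s" using cr by (auto simp: dist_real_def)
        then have "cball c r \<subseteq> ?I i" using s(2) ball_subset_cball by blast
        then show ?thesis using cr i by (intro exI[of _ "(c, r)"]) (auto simp: K'_def dist_real_def)
      qed
      obtain C' where C': "countable C'" "C' \<subseteq> K'" "pairwise (\<lambda>i j. disjnt (?I i) (?I j)) C'"
         "negligible (A' - (\<Union>i \<in> C'. ?I i))"
        by (rule Vitali_covering_theorem_cballs[of K' snd A' fst, OF K'_pos 2])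
      have "?I i \<subseteq> W" if "i \<in> C" for i using C(2) that by (force simp: K_def simp del: mem_cball)
      then have "(\<Union>i\<in>C. ?I i) \<subseteq> W" by blast
      have C'_sub: "?I i \<subseteq> (\<Union>i\<in>C. ?I i)" if "i \<in> C'" for i
      proof -
        obtain c r where "i = (c, r)" by (cases i)
        then show ?thesis using C'(2) that by (auto simp: K'_def simp del: mem_cball)
      qed
      have disj: "disjoint_family_on ?I C" "disjoint_family_on ?I C'"
        using C(3) C'(3) by (auto simp: disjoint_family_on_def pairwise_def disjnt_def)
      let ?U = "\<Union>i\<in>C. ?I i" and ?U' = "\<Union>i\<in>C'. ?I i"
      have snd_pos: "snd i > 0" if "i \<in> C \<or> i \<in> C'" for i
        using that C(2) C'(2) by (auto simp: K_def K'_def)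
      have len: "emeasure lborel (?I i) = ennreal (2 * snd i)" if "snd i > 0" for i
        using that by (simp add: cball_eq_atLeastAtMost)
      have "ennreal b * emeasure lborel ?U' = ennreal b * (\<integral>\<^sup>+i. emeasure lborel (?I i) \<partial>count_space C')"
        using C' disj by (subst emeasure_UN_countable) auto
      also have "\<dots> = (\<integral>\<^sup>+i. ennreal b * emeasure lborel (?I i) \<partial>count_space C')"
        by (simp add: nn_integral_cmult)
      also have "\<dots> \<le> (\<integral>\<^sup>+i. emeasure \<nu> (?I i) \<partial>count_space C')"
      proof (rule nn_integral_mono)
        fix i assume "i \<in> space (count_space C')"
        then have i: "i \<in> C'" by simp
        then have "b * (2 * snd i) \<le> f (fst i + snd i) - f (fst i - snd i)" using C'(2) by (auto simp: K'_def)
        then show "ennreal b * emeasure lborel (?I i) \<le> emeasure \<nu> (?I i)"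
          using snd_pos[of i] i assms by (simp add: len nu ennreal_mult[symmetric] ennreal_leI)
      qed
      also have "\<dots> = emeasure \<nu> ?U'"
        using C' disj by (subst emeasure_UN_countable) (auto simp: \<nu>_def)
      also have "\<dots> \<le> emeasure \<nu> ?U"
      proof (rule emeasure_mono)
        show "?U' \<subseteq> ?U" using C'_sub by blast
        have "?U \<in> sets borel" using C(1) by (intro sets.countable_UN') auto
        then show "?U \<in> sets \<nu>" by (simp add: \<nu>_def)
      qed
      also have "\<dots> = (\<integral>\<^sup>+i. emeasure \<nu> (?I i) \<partial>count_space C)"
        using C disj by (subst emeasure_UN_countable) (auto simp: \<nu>_def)
      also have "\<dots> \<le> (\<integral>\<^sup>+i. ennreal a * emeasure lborel (?I i) \<partial>count_space C)"
      proof (rule nn_integral_mono)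
        fix i assume "i \<in> space (count_space C)"
        then have i: "i \<in> C" by simp
        then have "a * (2 * snd i) \<ge> f (fst i + snd i) - f (fst i - snd i)" using C(2) by (auto simp: K_def)
        then show "emeasure \<nu> (?I i) \<le> ennreal a * emeasure lborel (?I i)"
          using snd_pos[of i] i assms by (simp add: len nu ennreal_mult[symmetric] ennreal_leI)
      qed
      also have "\<dots> = ennreal a * emeasure lborel ?U"
        using C disj by (subst emeasure_UN_countable) (auto simp: nn_integral_cmult)
      also have "emeasure lborel ?U \<le> emeasure lborel W"
        using W(1) \<open>?U \<subseteq> W\<close> by (intro emeasure_mono) auto
      also have "emeasure lborel W = ennreal (measure lebesgue W)"
        using W(1,3) emeasure_eq_measure2[of W lebesgue] by simp
      finally have *: "ennreal b * emeasure lborel ?U' \<le> ennreal a * ennreal (measure lebesgue W)"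
        by (simp add: mult_left_mono)
      have U'sets: "?U' \<in> sets borel" using C'(1) by (intro sets.countable_UN') auto
      have "emeasure lebesgue A \<le> emeasure lebesgue (?U' \<union> ((A' - ?U') \<union> (A - A')))"
        using A U'sets C'(4) negA
        by (intro emeasure_mono sets.Un) (auto simp: negligible_iff_null_sets null_sets_def)
      also have "\<dots> = emeasure lebesgue ?U'"
        using U'sets C'(4) negA
        by (intro emeasure_Un_null_set) (auto simp: negligible_iff_null_sets)
      finally have "ennreal (measure lebesgue A) \<le> emeasure lborel ?U'"
        using A U'sets by (simp add: emeasure_eq_measure2)
      then have "ennreal b * ennreal (measure lebesgue A) \<le> ennreal a * ennreal (measure lebesgue W)"
        using * by (meson mult_left_mono order_trans zero_le)
      then have "b * measure lebesgue A \<le> a * measure lebesgue W"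
        using assms by (simp add: ennreal_mult[symmetric])
      also have "\<dots> \<le> a * (measure lebesgue A + e)" using W(4) assms by simp
      finally show ?thesis using assms by (simp add: field_simps)
    qed
    have "measure lebesgue A \<le> a / b * measure lebesgue A"
    proof (rule field_le_epsilon)
      fix e :: real assume "e > 0"
      then show "measure lebesgue A \<le> a / b * measure lebesgue A + e"
        using bound[of "e * b / a"] \<open>0 < a\<close> \<open>a < b\<close> by (simp add: distrib_left)
    qed
    then have "b * measure lebesgue A \<le> a * measure lebesgue A"
      using \<open>0 < a\<close> \<open>a < b\<close> by (simp add: field_simps)
    then have "measure lebesgue A = 0"
      using \<open>a < b\<close> by (metis linorder_not_less measure_nonneg mult_less_cancel_right_disj order_le_less)
    then show ?thesis using A by (auto simp: negligible_iff_measure A_def)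
  qed
  then have "negligible (\<Union>n::nat. E \<inter> cball 0 (real n))"
    by (rule negligible_Union_nat)
  moreover have "E \<subseteq> (\<Union>n::nat. E \<inter> cball 0 (real n))"
  proof
    fix x assume "x \<in> E"
    moreover obtain n :: nat where "\<bar>x\<bar> \<le> real n" using real_arch_simple[of "\<bar>x\<bar>"] by auto
    ultimately show "x \<in> (\<Union>n::nat. E \<inter> cball 0 (real n))"
      by (intro UN_I[of n]) (simp_all add: dist_real_def)
  qed
  ultimately have "negligible E" by (rule negligible_subset)
  then show ?thesis by (simp add: E_def)
qed

lemma le_if_le_add_small:
  fixes A B C :: real
  assumes "0 < d" "\<And>\<eta>. 0 < \<eta> \<Longrightarrow> \<eta> < d \<Longrightarrow> A \<le> B + C * \<eta>"
  shows "A \<le> B"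
proof (rule tendsto_lowerbound)
  show "((\<lambda>\<eta>. B + C * \<eta>) \<longlongrightarrow> B) (at_right 0)"
    by (auto intro!: tendsto_eq_intros)
  show "\<forall>\<^sub>F \<eta> in at_right 0. A \<le> B + C * \<eta>"
    using assms by (auto simp: eventually_at_right_field)
qed simp

text \<open>If the slopes over small intervals around \<open>x\<close> had different lower and upper
  limits, two positive rationals would separate them and \<open>x\<close> would lie in one of
  countably many null gap sets.\<close>

lemma negligible_nondifferentiable_mono_lipschitz:
  fixes f :: "real \<Rightarrow> real"
  assumes mono: "\<And>x y. x \<le> y \<Longrightarrow> f x \<le> f y" and lip: "L-lipschitz_on UNIV f"
  shows "negligible {x. \<not> f differentiable at x}"
proof -
  define low where "low = (\<lambda>a d. {x. \<exists>c r. 0 < r \<and> r < d \<and> \<bar>x - c\<bar> < r \<and> f (c + r) - f (c - r) < a * (2 * r)})"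
  define high where "high = (\<lambda>b d. {x. \<exists>c r. 0 < r \<and> r < d \<and> \<bar>x - c\<bar> < r \<and> f (c + r) - f (c - r) > b * (2 * r)})"
  define E where "E = (\<lambda>(a, b). {x. \<forall>d>0. x \<in> low a d \<and> x \<in> high b d})"
  define P where "P = {(a, b). 0 < a \<and> a < b} \<inter> \<rat> \<times> (\<rat> :: real set)"
  have lipD: "\<bar>f x - f y\<bar> \<le> L * \<bar>x - y\<bar>" for x y
    using lipschitz_onD[OF lip, of x y] by (simp add: dist_real_def)
  have "L \<ge> 0" using lip lipschitz_on_nonneg by blast
  have "countable P" unfolding P_def by (intro countable_Int2 countable_SIGMA countable_rat)
  moreover have "negligible (E ab)" if "ab \<in> P" for ab
    using that lip negligible_Dini_gap[OF mono lipschitz_on_continuous_on[OF lip], of "fst ab" "snd ab"]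
    unfolding P_def E_def low_def high_def by (auto simp: case_prod_unfold)
  ultimately have neg: "negligible (\<Union>ab\<in>P. E ab)"
    by (intro negligible_countable_Union) auto
  have "f differentiable at x" if x: "x \<notin> (\<Union>ab\<in>P. E ab)" for x
  proof -
    \<comment> \<open>\<open>S\<close> consists of the eventual upper bounds for the slopes over
      shrinking intervals around \<open>x\<close>. Its infimum \<open>l\<close> is the upper limit
      of these slopes and the candidate for the derivative.\<close>
    define S where "S = {b. b \<ge> 0 \<and> (\<exists>d>0. x \<notin> high b d)}"
    have anti: "low a d \<subseteq> low a d'" "high b d \<subseteq> high b d'" if "d \<le> d'" for d d' a b
      using that order_less_le_trans[of _ d d'] unfolding low_def high_def by blast+
    have "x \<notin> high L 1" unfolding high_def
    proof clarify
      fix c r :: real assume "0 < r" "L * (2 * r) < f (c + r) - f (c - r)"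
      then show False using lipD[of "c + r" "c - r"] by simp
    qed
    then have "L \<in> S" using \<open>L \<ge> 0\<close> by (auto simp: S_def intro: exI[of _ 1])
    define l where "l = Inf S"
    have "l \<ge> 0" unfolding l_def using \<open>L \<in> S\<close> by (intro cInf_greatest) (auto simp: S_def)
    have "bdd_below S" by (auto simp: S_def intro: bdd_belowI[of _ 0])
    have bounds: "\<exists>d>0. \<forall>c r. 0 < r \<longrightarrow> r < d \<longrightarrow> \<bar>x - c\<bar> < r \<longrightarrow>
        (l - e) * (2 * r) \<le> f (c + r) - f (c - r) \<and> f (c + r) - f (c - r) \<le> (l + e) * (2 * r)" if "e > 0" for e
    proof -
      obtain b where b: "b \<in> S" "b < l + e"
        using cInf_lessD[of S "l + e"] \<open>L \<in> S\<close> \<open>e > 0\<close> by (auto simp: l_def)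
      then obtain d1 where d1: "d1 > 0" "x \<notin> high b d1" by (auto simp: S_def)
      have "\<exists>d>0. \<forall>c r. 0 < r \<longrightarrow> r < d \<longrightarrow> \<bar>x - c\<bar> < r \<longrightarrow> (l - e) * (2 * r) \<le> f (c + r) - f (c - r)"
      \<comment> \<open>The gap sets use positive slopes only; when \<open>l - e\<close> is not
        positive, monotonicity of \<open>f\<close> gives the lower bound at once.\<close>
      proof (cases "l - e \<le> 0")
        case True
        have "(l - e) * (2 * r) \<le> f (c + r) - f (c - r)" if "r > 0" for c r
        proof -
          have "(l - e) * (2 * r) \<le> 0" using True that by (simp add: mult_nonpos_nonneg)
          also have "0 \<le> f (c + r) - f (c - r)" using mono[of "c - r" "c + r"] that by simp
          finally show ?thesis .
        qed
        then show ?thesis by (intro exI[of _ 1]) auto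
      next
        case False
        obtain a' where a': "a' \<in> \<rat>" "l - e < a'" "a' < l" using Rats_dense_in_real[of "l - e" l] \<open>e > 0\<close> by auto
        obtain b' where b': "b' \<in> \<rat>" "a' < b'" "b' < l" using Rats_dense_in_real[of a' l] a' by auto
        have "(a', b') \<in> P" using a' b' False by (auto simp: P_def)
        with x have "x \<notin> E (a', b')" by blast
        then obtain d where d: "d > 0" "x \<notin> low a' d \<or> x \<notin> high b' d" by (auto simp: E_def)
        have "b' \<notin> S" using b' cInf_lower[OF _ \<open>bdd_below S\<close>, of b'] by (auto simp: l_def)
        then have "x \<in> high b' d" using a' b' d False by (auto simp: S_def)
        then have "x \<notin> low a' d" using d by auto
        have "(l - e) * (2 * r) \<le> f (c + r) - f (c - r)" if "0 < r" "r < d" "\<bar>x - c\<bar> < r" for c r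
        proof -
          have "(l - e) * (2 * r) \<le> a' * (2 * r)" using a' that by (intro mult_right_mono) auto
          also have "\<dots> \<le> f (c + r) - f (c - r)"
          proof (rule ccontr)
            assume "\<not> ?thesis"
            then have "f (c + r) - f (c - r) < a' * (2 * r)" by simp
            then have "x \<in> low a' d" unfolding low_def using that by blast
            then show False using \<open>x \<notin> low a' d\<close> by simp
          qed
          finally show ?thesis .
        qed
        then show ?thesis using d(1) by blast
      qed
      then obtain d2 where d2: "d2 > 0" "\<And>c r. 0 < r \<Longrightarrow> r < d2 \<Longrightarrow> \<bar>x - c\<bar> < r \<Longrightarrow> (l - e) * (2 * r) \<le> f (c + r) - f (c - r)"
        by blast
      have "f (c + r) - f (c - r) \<le> (l + e) * (2 * r)" if "0 < r" "r < d1" "\<bar>x - c\<bar> < r" for c r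
      proof -
        have "f (c + r) - f (c - r) \<le> b * (2 * r)"
        proof (rule ccontr)
          assume "\<not> ?thesis"
          then have "b * (2 * r) < f (c + r) - f (c - r)" by simp
          then have "x \<in> high b d1" unfolding high_def using that by blast
          then show False using d1 by simp
        qed
        also have "\<dots> \<le> (l + e) * (2 * r)" using b that by (intro mult_right_mono) auto
        finally show ?thesis .
      qed
      then show ?thesis using d1(1) d2 by (intro exI[of _ "min d1 d2"]) auto
    qed
    have "(f has_derivative (\<lambda>h. l * h)) (at x)"
      unfolding has_derivative_at_alt
    proof (intro conjI allI impI)
      show "bounded_linear ((*) l)" by (rule bounded_linear_mult_right)
      fix e :: real assume "e > 0"
      then obtain d where d: "d > 0" "\<And>c r. 0 < r \<Longrightarrow> r < d \<Longrightarrow> \<bar>x - c\<bar> < r \<Longrightarrow>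
          (l - e) * (2 * r) \<le> f (c + r) - f (c - r) \<and> f (c + r) - f (c - r) \<le> (l + e) * (2 * r)"
        using bounds by blast
      have quot: "(l - e) * (v - u) \<le> f v - f u" "f v - f u \<le> (l + e) * (v - u)" if "u \<le> x" "x \<le> v" "v - u < d" for u v
      proof -
        \<comment> \<open>In a difference quotient \<open>x\<close> is an endpoint of the interval,
          whereas the bounds need it strictly inside. Widening by \<open>\<eta>\<close> on both
          sides costs an error linear in \<open>\<eta>\<close>: monotonicity absorbs it in the upper
          bound, the Lipschitz constant in the lower one.\<close>
        have Q: "(l - e) * (v - u + 2 * \<eta>) \<le> f (v + \<eta>) - f (u - \<eta>) \<and> f (v + \<eta>) - f (u - \<eta>) \<le> (l + e) * (v - u + 2 * \<eta>)"
          if "0 < \<eta>" and small: "\<eta> < d / 2" for \<eta>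
        proof -
          define c r where "c = (u + v) / 2" and "r = (v - u) / 2 + \<eta>"
          have "c + r = v + \<eta>" "c - r = u - \<eta>" "2 * r = v - u + 2 * \<eta>" by (auto simp: c_def r_def field_simps)
          moreover have "0 < r" "\<bar>x - c\<bar> < r" using \<open>u \<le> x\<close> \<open>x \<le> v\<close> that by (auto simp: c_def r_def field_simps abs_if)
          moreover have "r < d" using \<open>v - u < d\<close> small unfolding r_def by (simp add: field_simps)
          ultimately show ?thesis using d(2)[of r c] by metis
        qed
        show "f v - f u \<le> (l + e) * (v - u)"
        proof (rule le_if_le_add_small[of "d / 2" _ _ "2 * (l + e)"])
          fix \<eta> assume \<eta>: "0 < \<eta>" "\<eta> < d / 2"
          then show "f v - f u \<le> (l + e) * (v - u) + 2 * (l + e) * \<eta>"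
            using Q[OF \<eta>] mono[of v "v + \<eta>"] mono[of "u - \<eta>" u] by (simp add: algebra_simps)
        qed (use d in auto)
        show "(l - e) * (v - u) \<le> f v - f u"
        proof (rule le_if_le_add_small[of "d / 2" _ _ "2 * L - 2 * (l - e)"])
          fix \<eta> assume \<eta>: "0 < \<eta>" "\<eta> < d / 2"
          then show "(l - e) * (v - u) \<le> f v - f u + (2 * L - 2 * (l - e)) * \<eta>"
            using conjunct1[OF Q[OF \<eta>]] lipD[of v "v + \<eta>"] lipD[of "u - \<eta>" u]
            by (simp add: algebra_simps abs_le_iff)
        qed (use d in auto)
      qed
      show "\<exists>d>0. \<forall>y. norm (y - x) < d \<longrightarrow> norm (f y - f x - l * (y - x)) \<le> e * norm (y - x)"
      proof (intro exI[of _ d] conjI allI impI)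
        fix y assume y: "norm (y - x) < d"
        show "norm (f y - f x - l * (y - x)) \<le> e * norm (y - x)"
        proof (cases "x \<le> y")
          case True
          then show ?thesis using quot[of x y] y by (simp add: algebra_simps abs_le_iff)
        next
          case False
          then show ?thesis using quot[of y x] y by (simp add: algebra_simps abs_le_iff)
        qed
      qed (use d in auto)
    qed
    then show ?thesis by (auto simp: differentiable_def)
  qed
  then have "{x. \<not> f differentiable at x} \<subseteq> (\<Union>ab\<in>P. E ab)" by blast
  then show ?thesis using neg negligible_subset by blast
qed

text \<open>Adding \<open>L * t\<close> makes every coordinate nondecreasing, and clamping the
  argument to the interval extends the curve to the whole line with the same constant.\<close>

lemma lipschitz_ae_differentiable:
  fixes f :: "real \<Rightarrow> 'a::euclidean_space"
  assumes "L-lipschitz_on {a..b} f"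
  obtains N where "negligible N" "\<And>t. t \<in> {a<..<b} - N \<Longrightarrow> \<exists>v. (f has_vector_derivative v) (at t)"
proof (cases "a \<le> b")
  case False
  then show ?thesis using that[of "{}"] by simp
next
  case True
  have "L \<ge> 0" using assms lipschitz_on_nonneg by blast
  define g where "g = (\<lambda>t. f (max a (min b t)))"
  have lipg: "norm (g s - g t) \<le> L * \<bar>s - t\<bar>" for s t
  proof -
    have "norm (g s - g t) \<le> L * \<bar>max a (min b s) - max a (min b t)\<bar>"
      using lipschitz_on_normD[OF assms, of "max a (min b s)" "max a (min b t)"] True by (simp add: g_def)
    also have "\<dots> \<le> L * \<bar>s - t\<bar>" using \<open>L \<ge> 0\<close> by (intro mult_left_mono) auto
    finally show ?thesis .
  qed
  define h where "h = (\<lambda>i t. g t \<bullet> i + L * t)"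
  have comp: "\<bar>g s \<bullet> i - g t \<bullet> i\<bar> \<le> L * \<bar>s - t\<bar>" if "i \<in> Basis" for i s t
    using Basis_le_norm[OF that, of "g s - g t"] lipg[of s t] by (simp add: inner_diff_left)
  have "negligible {x. \<not> h i differentiable at x}" if i: "i \<in> Basis" for i
  proof (rule negligible_nondifferentiable_mono_lipschitz)
    show "h i s \<le> h i t" if "s \<le> t" for s t
      using comp[OF i, of s t] that by (simp add: h_def algebra_simps)
    show "(2 * L)-lipschitz_on UNIV (h i)"
    proof (rule lipschitz_onI)
      fix s t :: real
      have "dist (h i s) (h i t) \<le> \<bar>g s \<bullet> i - g t \<bullet> i\<bar> + \<bar>L * s - L * t\<bar>"
        unfolding dist_real_def h_def by linarith
      also have "\<bar>L * s - L * t\<bar> = L * \<bar>s - t\<bar>"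
        using \<open>L \<ge> 0\<close> by (simp add: right_diff_distrib[symmetric] abs_mult)
      finally show "dist (h i s) (h i t) \<le> 2 * L * dist s t" using comp[OF i, of s t] by (simp add: dist_real_def)
    qed (use \<open>L \<ge> 0\<close> in simp)
  qed
  then have neg: "negligible (\<Union>i\<in>Basis. {x. \<not> h i differentiable at x})" by auto
  show ?thesis
  proof (rule that[OF neg])
    fix t assume t: "t \<in> {a<..<b} - (\<Union>i\<in>Basis. {x. \<not> h i differentiable at x})"
    have "(\<lambda>s. g s \<bullet> i) differentiable at t" if "i \<in> Basis" for i
    proof -
      have "(\<lambda>s. h i s - L * s) differentiable at t"
        using t that by (intro differentiable_diff differentiable_mult) auto
      then show ?thesis by (simp add: h_def)
    qed
    then have "g differentiable at t" by (subst differentiable_componentwise_within) auto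
    then obtain v where v: "(g has_vector_derivative v) (at t)"
      by (auto simp: vector_derivative_works)
    have "(f has_vector_derivative v) (at t)"
      using v by (rule has_vector_derivative_transform_within_open[where S = "{a<..<b}"]) (use t in \<open>auto simp: g_def\<close>)
    then show "\<exists>v. (f has_vector_derivative v) (at t)" ..
  qed
qed

section \<open>Absolutely continuous curves\<close>

lemma AE_lebesgue_on_iff_negligible:
  fixes S :: "'a::euclidean_space set"
  assumes "S \<in> sets lebesgue"
  shows "(AE s in lebesgue_on S. P s) \<longleftrightarrow> (\<exists>N. negligible N \<and> (\<forall>s\<in>S - N. P s))"
proof -
  have "(AE s in lebesgue_on S. P s) \<longleftrightarrow> (AE s in lebesgue. s \<in> S \<longrightarrow> P s)"
    using assms by (simp add: AE_restrict_space_iff)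
  also have "\<dots> \<longleftrightarrow> (\<exists>N. negligible N \<and> (\<forall>s\<in>S - N. P s))"
    unfolding eventually_ae_filter_negligible by (simp add: subset_iff) blast
  finally show ?thesis .
qed

lemma absolutely_continuous_onE:
  assumes "absolutely_continuous_on S f" "0 < e"
  obtains d where "0 < d" "\<And>I. finite I \<Longrightarrow> \<forall>(a, b)\<in>I. a \<le> b \<and> {a..b} \<subseteq> S \<Longrightarrow>
    pairwise (\<lambda>(a, b) (c, d). {a<..<b} \<inter> {c<..<d} = {}) I \<Longrightarrow>
    (\<Sum>(a, b)\<in>I. b - a) < d \<Longrightarrow> (\<Sum>(a, b)\<in>I. norm (f b - f a)) < e"
proof -
  have "\<exists>\<delta>>0. \<forall>I. finite I \<longrightarrow> (\<forall>(a, b)\<in>I. a \<le> b \<and> {a..b} \<subseteq> S) \<longrightarrow>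
        pairwise (\<lambda>(a, b) (c, d). {a<..<b} \<inter> {c<..<d} = {}) I \<longrightarrow>
        (\<Sum>(a, b)\<in>I. b - a) < \<delta> \<longrightarrow> (\<Sum>(a, b)\<in>I. norm (f b - f a)) < e"
    using assms unfolding absolutely_continuous_on_def by (elim allE impE)
  then show thesis using that by (elim exE conjE) simp
qed

lemma lipschitz_imp_absolutely_continuous_on:
  fixes f :: "real \<Rightarrow> 'a::real_normed_vector"
  assumes "L-lipschitz_on S f"
  shows "absolutely_continuous_on S f"
  unfolding absolutely_continuous_on_def
proof (intro allI impI)
  fix e :: real assume "e > 0"
  have L: "L \<ge> 0" using assms lipschitz_on_nonneg by blast
  show "\<exists>\<delta>>0. \<forall>I. finite I \<longrightarrow> (\<forall>(a, b)\<in>I. a \<le> b \<and> {a..b} \<subseteq> S) \<longrightarrow>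
        pairwise (\<lambda>(a, b) (c, d). {a<..<b} \<inter> {c<..<d} = {}) I \<longrightarrow>
        (\<Sum>(a, b)\<in>I. b - a) < \<delta> \<longrightarrow> (\<Sum>(a, b)\<in>I. norm (f b - f a)) < e"
  proof (intro exI[of _ "e / (L + 1)"] conjI allI impI)
    fix I :: "(real \<times> real) set"
    assume I: "\<forall>(a, b)\<in>I. a \<le> b \<and> {a..b} \<subseteq> S" and sum: "(\<Sum>(a, b)\<in>I. b - a) < e / (L + 1)"
    have "(\<Sum>(a, b)\<in>I. norm (f b - f a)) \<le> (\<Sum>(a, b)\<in>I. L * (b - a))"
    proof (rule sum_mono, clarify)
      fix a b assume "(a, b) \<in> I"
      then have "a \<le> b" "a \<in> S" "b \<in> S" using bspec[OF I \<open>(a, b) \<in> I\<close>] by auto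
      then show "norm (f b - f a) \<le> L * (b - a)"
        using lipschitz_on_normD[OF assms, of b a] by auto
    qed
    also have "\<dots> = L * (\<Sum>(a, b)\<in>I. b - a)" by (simp add: sum_distrib_left case_prod_unfold)
    also have "\<dots> \<le> L * (e / (L + 1))" using sum L by (intro mult_left_mono) auto
    also have "\<dots> < e" using L \<open>e > 0\<close> by (simp add: field_simps)
    finally show "(\<Sum>(a, b)\<in>I. norm (f b - f a)) < e" .
  qed (use \<open>e > 0\<close> L in auto)
qed

text \<open>It transfers absolute continuity from a curve to scalar functions derived from it, such
  as an inner product with a fixed vector plus a linear term.\<close>

lemma absolutely_continuous_on_dominated:
  fixes f :: "real \<Rightarrow> 'a::real_normed_vector" and g :: "real \<Rightarrow> 'b::real_normed_vector"
  assumes g: "absolutely_continuous_on S g"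
    and dom: "\<And>s t. s \<in> S \<Longrightarrow> t \<in> S \<Longrightarrow> s \<le> t \<Longrightarrow> norm (f t - f s) \<le> C * norm (g t - g s) + C * (t - s)"
  shows "absolutely_continuous_on S f"
  unfolding absolutely_continuous_on_def
proof (intro allI impI)
  fix e :: real assume "e > 0"
  define c where "c = \<bar>C\<bar> + 1"
  have c: "c > 0" by (simp add: c_def)
  have dom': "norm (f t - f s) \<le> c * norm (g t - g s) + c * (t - s)" if "s \<in> S" "t \<in> S" "s \<le> t" for s t
  proof -
    have "C * norm (g t - g s) + C * (t - s) \<le> c * norm (g t - g s) + c * (t - s)"
      using that by (intro add_mono mult_right_mono) (auto simp: c_def)
    then show ?thesis using dom[OF that] by linarith
  qed
  have "0 < e / (2 * c)" using \<open>e > 0\<close> c by simp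
  obtain d where d: "d > 0" "\<And>I. finite I \<Longrightarrow> (\<forall>(a, b)\<in>I. a \<le> b \<and> {a..b} \<subseteq> S) \<Longrightarrow>
        pairwise (\<lambda>(a, b) (c, d). {a<..<b} \<inter> {c<..<d} = {}) I \<Longrightarrow>
        (\<Sum>(a, b)\<in>I. b - a) < d \<Longrightarrow> (\<Sum>(a, b)\<in>I. norm (g b - g a)) < e / (2 * c)"
    by (fact absolutely_continuous_onE[OF g \<open>0 < e / (2 * c)\<close>])
  show "\<exists>\<delta>>0. \<forall>I. finite I \<longrightarrow> (\<forall>(a, b)\<in>I. a \<le> b \<and> {a..b} \<subseteq> S) \<longrightarrow>
        pairwise (\<lambda>(a, b) (c, d). {a<..<b} \<inter> {c<..<d} = {}) I \<longrightarrow>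
        (\<Sum>(a, b)\<in>I. b - a) < \<delta> \<longrightarrow> (\<Sum>(a, b)\<in>I. norm (f b - f a)) < e"
  proof (intro exI[of _ "min d (e / (2 * c))"] conjI allI impI)
    fix I :: "(real \<times> real) set"
    assume fin: "finite I" and I: "\<forall>(a, b)\<in>I. a \<le> b \<and> {a..b} \<subseteq> S"
      and pw: "pairwise (\<lambda>(a, b) (c, d). {a<..<b} \<inter> {c<..<d} = {}) I"
      and sum: "(\<Sum>(a, b)\<in>I. b - a) < min d (e / (2 * c))"
    have "(\<Sum>(a, b)\<in>I. norm (f b - f a)) \<le> (\<Sum>(a, b)\<in>I. c * norm (g b - g a) + c * (b - a))"
    proof (rule sum_mono, clarify)
      fix a b assume "(a, b) \<in> I"
      then show "norm (f b - f a) \<le> c * norm (g b - g a) + c * (b - a)"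
        using bspec[OF I \<open>(a, b) \<in> I\<close>] by (intro dom') auto
    qed
    also have "\<dots> = c * (\<Sum>(a, b)\<in>I. norm (g b - g a)) + c * (\<Sum>(a, b)\<in>I. b - a)"
      by (simp add: sum_distrib_left sum.distrib case_prod_unfold)
    also have "\<dots> < c * (e / (2 * c)) + c * (e / (2 * c))"
      using d(2)[OF fin I pw] sum c by (intro add_strict_mono mult_strict_left_mono) auto
    also have "\<dots> = e" using c by simp
    finally show "(\<Sum>(a, b)\<in>I. norm (f b - f a)) < e" .
  qed (use \<open>e > 0\<close> c d in auto)
qed

lemma absolutely_continuous_on_imp_continuous_on:
  fixes f :: "real \<Rightarrow> 'a::real_normed_vector"
  assumes "absolutely_continuous_on {a..b} f"
  shows "continuous_on {a..b} f"
  unfolding continuous_on_iff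
proof (intro ballI allI impI)
  fix x e :: real assume x: "x \<in> {a..b}" and "e > 0"
  obtain d where d: "d > 0" "\<And>I. finite I \<Longrightarrow> (\<forall>(u, v)\<in>I. u \<le> v \<and> {u..v} \<subseteq> {a..b}) \<Longrightarrow>
        pairwise (\<lambda>(a, b) (c, d). {a<..<b} \<inter> {c<..<d} = {}) I \<Longrightarrow>
        (\<Sum>(a, b)\<in>I. b - a) < d \<Longrightarrow> (\<Sum>(a, b)\<in>I. norm (f b - f a)) < e"
    by (fact absolutely_continuous_onE[OF assms \<open>e > 0\<close>])
  have "dist (f y) (f x) < e" if "y \<in> {a..b}" "dist y x < d" for y
  proof (cases "x \<le> y")
    case True
    then show ?thesis using d(2)[of "{(x, y)}"] that x by (auto simp: dist_norm)
  next
    case False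
    then show ?thesis using d(2)[of "{(y, x)}"] that x by (auto simp: dist_norm norm_minus_commute)
  qed
  then show "\<exists>d>0. \<forall>x'\<in>{a..b}. dist x' x < d \<longrightarrow> dist (f x') (f x) < e" using d(1) by blast
qed

lemma absolutely_continuous_on_subset:
  assumes "absolutely_continuous_on S f" "T \<subseteq> S"
  shows "absolutely_continuous_on T f"
  unfolding absolutely_continuous_on_def
proof (intro allI impI)
  fix e :: real assume "0 < e"
  obtain d where d: "0 < d" "\<And>I. finite I \<Longrightarrow> \<forall>(a, b)\<in>I. a \<le> b \<and> {a..b} \<subseteq> S \<Longrightarrow>
    pairwise (\<lambda>(a, b) (c, d). {a<..<b} \<inter> {c<..<d} = {}) I \<Longrightarrow>
    (\<Sum>(a, b)\<in>I. b - a) < d \<Longrightarrow> (\<Sum>(a, b)\<in>I. norm (f b - f a)) < e"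
    by (fact absolutely_continuous_onE[OF assms(1) \<open>0 < e\<close>])
  have "\<forall>(a, b)\<in>I. a \<le> b \<and> {a..b} \<subseteq> S" if "\<forall>(a, b)\<in>I. a \<le> b \<and> {a..b} \<subseteq> T" for I :: "(real \<times> real) set"
    using that assms(2) by (simp add: case_prod_unfold) (meson subset_trans)
  then show "\<exists>\<delta>>0. \<forall>I. finite I \<longrightarrow> (\<forall>(a, b)\<in>I. a \<le> b \<and> {a..b} \<subseteq> T) \<longrightarrow>
        pairwise (\<lambda>(a, b) (c, d). {a<..<b} \<inter> {c<..<d} = {}) I \<longrightarrow>
        (\<Sum>(a, b)\<in>I. b - a) < \<delta> \<longrightarrow> (\<Sum>(a, b)\<in>I. norm (f b - f a)) < e"
    using d by (intro exI[of _ d] conjI allI impI) simp_all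
qed

text \<open>This stands in for integrating a derivative known only almost everywhere. In a fine
  tagged division, an interval tagged outside the null set has increment at most \<open>e\<close>
  times its length, by differentiability at the tag. The intervals tagged inside it lie in an open
  set of small measure, where absolute continuity makes the total increment small.\<close>

lemma absolutely_continuous_decreasing:
  fixes f :: "real \<Rightarrow> real"
  assumes ac: "absolutely_continuous_on {a..b} f" and "a \<le> b" and N: "negligible N"
    and deriv: "\<And>s. s \<in> {a<..<b} - N \<Longrightarrow> \<exists>d\<le>0. (f has_real_derivative d) (at s)"
  shows "f b \<le> f a"
proof -
  \<comment> \<open>No derivative is assumed at the endpoints, so they are treated as exceptional
    tags.\<close>
  define N' where "N' = N \<union> {a, b}"
  have N': "negligible N'" using N unfolding N'_def by auto
  have main: "f b - f a \<le> e * (b - a) + e" if "e > 0" for e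
  proof -
    obtain \<delta> where \<delta>: "\<delta> > 0" "\<And>I. finite I \<Longrightarrow> (\<forall>(u, v)\<in>I. u \<le> v \<and> {u..v} \<subseteq> {a..b}) \<Longrightarrow>
          pairwise (\<lambda>(a, b) (c, d). {a<..<b} \<inter> {c<..<d} = {}) I \<Longrightarrow>
          (\<Sum>(a, b)\<in>I. b - a) < \<delta> \<Longrightarrow> (\<Sum>(a, b)\<in>I. norm (f b - f a)) < e"
      by (fact absolutely_continuous_onE[OF ac \<open>e > 0\<close>])
    obtain U where U: "open U" "N' \<subseteq> U" "emeasure lebesgue (U - N') < ennreal \<delta>"
      using sets_lebesgue_outer_open[OF negligible_imp_sets[OF N'] \<open>\<delta> > 0\<close>] by metis
    have "emeasure lebesgue U = emeasure lebesgue ((U - N') \<union> N')" using U by (simp add: Un_absorb1 Un_commute)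
    also have "\<dots> = emeasure lebesgue (U - N')"
      using N' U(1) by (intro emeasure_Un_null_set) (auto simp: negligible_iff_null_sets)
    finally have emU: "emeasure lebesgue U < ennreal \<delta>" using U by simp
    have "\<exists>d>0. \<forall>y. \<bar>y - s\<bar> < d \<longrightarrow> (s \<le> y \<longrightarrow> f y - f s \<le> e * (y - s)) \<and> (y \<le> s \<longrightarrow> f s - f y \<le> e * (s - y))"
      if "s \<in> {a..b} - N'" for s
    proof -
      have "s \<in> {a<..<b} - N" using that by (auto simp: N'_def)
      then obtain D where D: "D \<le> 0" "(f has_derivative (\<lambda>h. D * h)) (at s)"
        using deriv by (auto simp: has_field_derivative_def)
      then obtain d where d: "d > 0" "\<And>y. norm (y - s) < d \<Longrightarrow> norm (f y - f s - D * (y - s)) \<le> e * norm (y - s)"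
        using \<open>e > 0\<close> unfolding has_derivative_at_alt by blast
      show ?thesis
      proof (intro exI[of _ d] conjI allI impI)
        fix y assume y: "\<bar>y - s\<bar> < d"
        have *: "\<bar>f y - f s - D * (y - s)\<bar> \<le> e * \<bar>y - s\<bar>" using d(2) y by simp
        { assume "s \<le> y"
          then have "D * (y - s) \<le> 0" using D by (simp add: mult_nonpos_nonneg)
          then show "f y - f s \<le> e * (y - s)" using * \<open>s \<le> y\<close> by simp }
        { assume "y \<le> s"
          then have "D * (y - s) \<ge> 0" using D by (simp add: mult_nonpos_nonpos)
          moreover have "\<bar>y - s\<bar> = s - y" using \<open>y \<le> s\<close> by simp
          ultimately show "f s - f y \<le> e * (s - y)" using * by simp }
      qed (use d in auto)
    qed
    then obtain r where r: "\<And>s. s \<in> {a..b} - N' \<Longrightarrow> r s > 0"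
      "\<And>s y. s \<in> {a..b} - N' \<Longrightarrow> \<bar>y - s\<bar> < r s \<Longrightarrow> s \<le> y \<Longrightarrow> f y - f s \<le> e * (y - s)"
      "\<And>s y. s \<in> {a..b} - N' \<Longrightarrow> \<bar>y - s\<bar> < r s \<Longrightarrow> y \<le> s \<Longrightarrow> f s - f y \<le> e * (s - y)"
      by metis
    define \<gamma> where "\<gamma> = (\<lambda>x. if x \<in> N' then U else if x \<in> {a..b} then ball x (r x) else ball x 1)"
    have "gauge \<gamma>" unfolding gauge_def \<gamma>_def using U r(1) by auto
    then obtain p where p: "p tagged_division_of {a..b}" "\<gamma> fine p" using fine_division_exists_real by blast
    have fin: "finite p" using p(1) by auto
    have K: "Inf K \<le> Sup K \<and> K = {Inf K..Sup K} \<and> x \<in> K \<and> K \<subseteq> {a..b} \<and> K \<subseteq> \<gamma> x" if "(x, K) \<in> p" for x K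
    proof -
      have 1: "x \<in> K" "K \<subseteq> {a..b}" "\<exists>u v. K = cbox u v" using tagged_division_ofD(2-4)[OF p(1) that] by auto
      then obtain u v where "K = {u..v}" "u \<le> v" by (auto simp: cbox_interval)
      then show ?thesis using 1 p(2) that by (auto simp: fine_def)
    qed
    \<comment> \<open>Degenerate intervals have increment 0 and are left to \<open>good\<close>. The
      remaining exceptional ones are determined by their endpoints, which is needed because absolute
      continuity is phrased with sets of endpoint pairs.\<close>
    define bad where "bad = {(x, K) \<in> p. x \<in> N' \<and> Inf K < Sup K}"
    define good where "good = p - bad"
    have finb: "finite bad" using fin by (rule finite_subset[rotated]) (auto simp: bad_def)
    have disj: "{Inf K<..<Sup K} \<inter> {Inf K'<..<Sup K'} = {}" if "(x, K) \<in> p" "(x', K') \<in> p" "(x, K) \<noteq> (x', K')" for x K x' K'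
    proof -
      have "interior K \<inter> interior K' = {}" using tagged_division_ofD(5)[OF p(1) that] .
      moreover have "interior K = {Inf K<..<Sup K}" "interior K' = {Inf K'<..<Sup K'}"
        using K[OF that(1)] K[OF that(2)] by (metis interior_atLeastAtMost_real)+
      ultimately show ?thesis by simp
    qed
    let ?J = "\<lambda>(x::real, K::real set). (Inf K, Sup K)"
    have inj: "inj_on ?J bad"
    proof (rule inj_onI, clarify)
      fix x K x' K' assume *: "(x, K) \<in> bad" "(x', K') \<in> bad" "Inf K = Inf K'" "Sup K = Sup K'"
      then have "(Inf K + Sup K) / 2 \<in> {Inf K<..<Sup K} \<inter> {Inf K'<..<Sup K'}" by (auto simp: bad_def)
      then show "x = x' \<and> K = K'" using disj[of x K x' K'] * by (auto simp: bad_def)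
    qed
    have "ennreal (\<Sum>(x, K)\<in>bad. Sup K - Inf K) = (\<Sum>(x, K)\<in>bad. ennreal (Sup K - Inf K))"
      using K by (subst sum_ennreal[symmetric]) (auto simp: case_prod_unfold bad_def)
    also have "\<dots> = (\<Sum>i\<in>bad. emeasure lebesgue {Inf (snd i)<..<Sup (snd i)})"
      by (intro sum.cong) (auto simp: bad_def)
    also have "\<dots> = emeasure lebesgue (\<Union>i\<in>bad. {Inf (snd i)<..<Sup (snd i)})"
    proof (rule sum_emeasure)
      show "disjoint_family_on (\<lambda>i. {Inf (snd i)<..<Sup (snd i)}) bad"
        unfolding disjoint_family_on_def
      proof (intro ballI impI)
        fix i j assume "i \<in> bad" "j \<in> bad" "i \<noteq> j"
        then show "{Inf (snd i)<..<Sup (snd i)} \<inter> {Inf (snd j)<..<Sup (snd j)} = {}"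
          using disj[of "fst i" "snd i" "fst j" "snd j"] by (auto simp: bad_def)
      qed
    qed (use finb in auto)
    also have "\<dots> \<le> emeasure lebesgue U"
    proof (rule emeasure_mono)
      have "{Inf (snd i)<..<Sup (snd i)} \<subseteq> U" if "i \<in> bad" for i
      proof -
        have i: "(fst i, snd i) \<in> p" "fst i \<in> N'" using that by (auto simp: bad_def)
        have "{Inf (snd i)<..<Sup (snd i)} \<subseteq> {Inf (snd i)..Sup (snd i)}" by auto
        also have "\<dots> \<subseteq> U" using K[OF i(1)] i(2) by (simp add: \<gamma>_def)
        finally show ?thesis .
      qed
      then show "(\<Union>i\<in>bad. {Inf (snd i)<..<Sup (snd i)}) \<subseteq> U" by blast
    qed (use U in auto)
    finally have "ennreal (\<Sum>(x, K)\<in>bad. Sup K - Inf K) < ennreal \<delta>" using emU by simp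
    moreover have "0 \<le> (\<Sum>(x, K)\<in>bad. Sup K - Inf K)" by (intro sum_nonneg) (auto simp: bad_def)
    ultimately have len: "(\<Sum>(x, K)\<in>bad. Sup K - Inf K) < \<delta>" by (simp only: ennreal_less_iff)
    have "(\<Sum>(u, v)\<in>?J ` bad. norm (f v - f u)) < e"
    proof (rule \<delta>(2))
      have "Inf (snd i) \<le> Sup (snd i) \<and> {Inf (snd i)..Sup (snd i)} \<subseteq> {a..b}" if "i \<in> bad" for i
        using K[of "fst i" "snd i"] that by (simp add: bad_def case_prod_unfold)
      then show "\<forall>(u, v)\<in>?J ` bad. u \<le> v \<and> {u..v} \<subseteq> {a..b}" by (simp add: case_prod_unfold)
      show "pairwise (\<lambda>(a, b) (c, d). {a<..<b} \<inter> {c<..<d} = {}) (?J ` bad)"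
      proof (rule pairwiseI)
        fix u v assume "u \<in> ?J ` bad" "v \<in> ?J ` bad" "u \<noteq> v"
        then obtain i j where ij: "i \<in> bad" "j \<in> bad" "u = ?J i" "v = ?J j" "i \<noteq> j" by blast
        have "{Inf (snd i)<..<Sup (snd i)} \<inter> {Inf (snd j)<..<Sup (snd j)} = {}"
          using disj[of "fst i" "snd i" "fst j" "snd j"] ij(1,2,5) by (simp add: bad_def case_prod_unfold prod_eq_iff)
        then show "(case u of (a, b) \<Rightarrow> \<lambda>(c, d). {a<..<b} \<inter> {c<..<d} = {}) v"
          unfolding ij(3,4) by (simp add: case_prod_unfold)
      qed
      show "(\<Sum>(a, b)\<in>?J ` bad. b - a) < \<delta>"
        using len inj by (simp add: sum.reindex case_prod_unfold)
    qed (use finb in simp)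
    then have bad_sum: "(\<Sum>(x, K)\<in>bad. norm (f (Sup K) - f (Inf K))) < e"
      using inj by (simp add: sum.reindex case_prod_unfold)
    have "f b - f a = (\<Sum>(x, K)\<in>p. f (Sup K) - f (Inf K))"
      using additive_tagged_division_1[OF \<open>a \<le> b\<close> p(1), of f] by simp
    also have "\<dots> = (\<Sum>(x, K)\<in>good. f (Sup K) - f (Inf K)) + (\<Sum>(x, K)\<in>bad. f (Sup K) - f (Inf K))"
      unfolding good_def by (rule sum.subset_diff) (auto simp: bad_def fin)
    also have "(\<Sum>(x, K)\<in>good. f (Sup K) - f (Inf K)) \<le> (\<Sum>(x, K)\<in>good. e * (Sup K - Inf K))"
    proof (rule sum_mono, clarify)
      fix x K assume xK: "(x, K) \<in> good"
      then have xp: "(x, K) \<in> p" by (simp add: good_def)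
      note k = K[OF xp]
      show "f (Sup K) - f (Inf K) \<le> e * (Sup K - Inf K)"
      proof (cases "x \<in> N'")
        case True
        then have "Inf K = Sup K" using xK k by (auto simp: good_def bad_def)
        then show ?thesis by simp
      next
        case False
        have x: "x \<in> {a..b} - N'" using k False by auto
        have "{Inf K..Sup K} \<subseteq> ball x (r x)" using k x by (auto simp: \<gamma>_def)
        then have "Inf K \<in> ball x (r x)" "Sup K \<in> ball x (r x)" using k by (auto simp: subset_iff)
        moreover have "Inf K \<le> x" "x \<le> Sup K" using k by (metis atLeastAtMost_iff)+
        ultimately have "f (Sup K) - f x \<le> e * (Sup K - x)" "f x - f (Inf K) \<le> e * (x - Inf K)"
          using r(2)[OF x, of "Sup K"] r(3)[OF x, of "Inf K"] by (auto simp: dist_real_def abs_minus_commute)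
        then show ?thesis by (simp add: algebra_simps)
      qed
    qed
    also have "\<dots> \<le> (\<Sum>(x, K)\<in>p. e * (Sup K - Inf K))"
      using K \<open>e > 0\<close> by (intro sum_mono2) (auto simp: good_def fin case_prod_unfold)
    also have "\<dots> = e * (b - a)"
      using additive_tagged_division_1[OF \<open>a \<le> b\<close> p(1), of "\<lambda>x. x"]
      by (simp add: sum_distrib_left[symmetric] case_prod_unfold)
    also have "(\<Sum>(x, K)\<in>bad. f (Sup K) - f (Inf K)) \<le> (\<Sum>(x, K)\<in>bad. norm (f (Sup K) - f (Inf K)))"
      by (intro sum_mono) auto
    also have "\<dots> \<le> e" using bad_sum by simp
    finally show ?thesis by simp
  qed
  have "f b - f a \<le> 0"
    by (rule le_if_le_add_small[of 1 _ _ "b - a + 1"]) (use main in \<open>auto simp: algebra_simps\<close>)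
  then show ?thesis by simp
qed

section \<open>Hamiltonians and strongly convex sets\<close>

lemma bdd_above_inner_image:
  fixes A :: "'a::real_inner set"
  assumes "compact A"
  shows "bdd_above ((\<lambda>v. v \<bullet> p) ` A)"
  using assms by (intro bounded_imp_bdd_above compact_imp_bounded compact_continuous_image continuous_intros)

lemma inner_le_hamiltonian:
  assumes "compact (F x)" "v \<in> F x"
  shows "v \<bullet> p \<le> hamiltonian F x p"
  unfolding hamiltonian_def using assms by (intro cSUP_upper bdd_above_inner_image)

lemma hamiltonian_attained:
  assumes "compact (F x)" "F x \<noteq> {}"
  obtains v where "v \<in> F x" "hamiltonian F x p = v \<bullet> p"
proof -
  obtain v where v: "v \<in> F x" "\<forall>w\<in>F x. w \<bullet> p \<le> v \<bullet> p"
    using continuous_attains_sup[OF assms, of "\<lambda>v. v \<bullet> p"] continuous_on_inner[OF continuous_on_id continuous_on_const, of "F x" p]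
    by auto
  have "hamiltonian F x p = v \<bullet> p"
  proof (rule antisym)
    show "hamiltonian F x p \<le> v \<bullet> p"
      unfolding hamiltonian_def using v assms(2) by (intro cSUP_least) auto
  qed (use inner_le_hamiltonian[of F x v p] assms(1) v(1) in simp)
  then show thesis using v that by blast
qed

text \<open>The function \<open>hamiltonian F x p' - v \<bullet> p'\<close> of \<open>p'\<close> is
  nonnegative and vanishes at \<open>p\<close>, hence has zero derivative there. So
  differentiability in \<open>p\<close> makes the maximizer unique.\<close>

lemma hamiltonian_maximizer_eq_gradient:
  assumes "compact (F x)" "v \<in> F x" "hamiltonian F x p = v \<bullet> p" "GDERIV (hamiltonian F x) p :> z"
  shows "v = z"
proof -
  have "((\<lambda>p'. hamiltonian F x p' - v \<bullet> p') has_derivative (\<lambda>h. h \<bullet> z - v \<bullet> h)) (at p)"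
    using assms(4) unfolding gderiv_def by (intro derivative_intros)
  then have "(\<lambda>h. h \<bullet> z - v \<bullet> h) = (\<lambda>h. 0)"
    using assms(1-3) inner_le_hamiltonian[of F x v]
    by (intro differential_zero_maxmin[of _ UNIV]) auto
  then have "(z - v) \<bullet> z - v \<bullet> (z - v) = 0" by metis
  then have "(z - v) \<bullet> (z - v) = 0" by (simp add: algebra_simps inner_commute)
  then show ?thesis by simp
qed

text \<open>Replace a maximizer over \<open>F x\<close> by its nearest point in
  \<open>F y\<close>.\<close>

lemma hamiltonian_le_add_hausdorff_dist:
  fixes F :: "'a::metric_space \<Rightarrow> 'b::euclidean_space set"
  assumes "compact (F x)" "compact (F y)" "F x \<noteq> {}" "F y \<noteq> {}"
  shows "hamiltonian F x p \<le> hamiltonian F y p + hausdorff_dist (F x) (F y) * norm p"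
proof -
  obtain v where v: "v \<in> F x" "hamiltonian F x p = v \<bullet> p" by (rule hamiltonian_attained[of F x p, OF assms(1,3)])
  obtain w where w: "w \<in> F y" "infdist v (F y) = dist v w"
    using infdist_attains_inf[of "F y" v] assms compact_imp_closed by blast
  have "bdd_above ((\<lambda>a. infdist a (F y)) ` F x)"
    by (intro bounded_imp_bdd_above compact_imp_bounded compact_continuous_image continuous_intros assms)
  then have "infdist v (F y) \<le> hausdorff_dist (F x) (F y)"
    unfolding hausdorff_dist_def using v(1) by (intro max.coboundedI1 cSUP_upper)
  then have d: "norm (v - w) \<le> hausdorff_dist (F x) (F y)" using w by (simp add: dist_norm)
  have "v \<bullet> p = w \<bullet> p + (v - w) \<bullet> p" by (simp add: inner_diff_left)
  also have "\<dots> \<le> hamiltonian F y p + norm (v - w) * norm p"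
    using inner_le_hamiltonian[of F y w p, OF assms(2) w(1)] norm_cauchy_schwarz[of "v - w" p] by simp
  also have "\<dots> \<le> hamiltonian F y p + hausdorff_dist (F x) (F y) * norm p"
    using d by (simp add: mult_right_mono)
  finally show ?thesis using v by simp
qed

text \<open>Take a Lebesgue number \<open>e\<close> of a finite subcover. Points closer than
  \<open>e\<close> share one ball with a local constant; for points farther apart the common bound
  \<open>B\<close> suffices. Neither choice depends on the index \<open>i\<close>.\<close>

lemma uniformly_lipschitz_on_compact:
  fixes g :: "'i \<Rightarrow> 'a::metric_space \<Rightarrow> 'b::real_normed_vector"
  assumes "compact K" and bound: "\<And>i y. i \<in> I \<Longrightarrow> y \<in> K \<Longrightarrow> norm (g i y) \<le> B"
    and loc: "\<And>x. x \<in> K \<Longrightarrow> \<exists>u>0. \<exists>L. \<forall>i\<in>I. L-lipschitz_on (cball x u \<inter> K) (g i)"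
  obtains L where "L \<ge> 0" "\<And>i. i \<in> I \<Longrightarrow> L-lipschitz_on K (g i)"
proof -
  obtain u L where uL: "\<And>x. x \<in> K \<Longrightarrow> u x > 0" "\<And>x i. x \<in> K \<Longrightarrow> i \<in> I \<Longrightarrow> (L x)-lipschitz_on (cball x (u x) \<inter> K) (g i)"
    using loc by metis
  have "K \<subseteq> (\<Union>x\<in>K. ball x (u x))" using uL(1) by auto
  then obtain D where D: "D \<subseteq> K" "finite D" "K \<subseteq> (\<Union>x\<in>D. ball x (u x))"
    by (rule compactE_image[OF \<open>compact K\<close>, rotated]) auto
  obtain e where e: "e > 0" "\<And>x. x \<in> K \<Longrightarrow> \<exists>G\<in>(\<lambda>x. ball x (u x)) ` D. ball x e \<subseteq> G"
    by (rule Heine_Borel_lemma[OF \<open>compact K\<close>, of "(\<lambda>x. ball x (u x)) ` D"]) (use D in auto)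
  define L' where "L' = (\<Sum>x\<in>D. \<bar>L x\<bar>) + 2 * \<bar>B\<bar> / e"
  have "L' \<ge> 0" unfolding L'_def using e by (intro add_nonneg_nonneg sum_nonneg) auto
  moreover have "L'-lipschitz_on K (g i)" if i: "i \<in> I" for i
  proof (rule lipschitz_onI)
    fix y z assume yz: "y \<in> K" "z \<in> K"
    show "dist (g i y) (g i z) \<le> L' * dist y z"
    proof (cases "dist y z < e")
      case True
      obtain x where x: "x \<in> D" "ball y e \<subseteq> ball x (u x)" using e(2)[OF yz(1)] by auto
      have "y \<in> ball x (u x)" "z \<in> ball x (u x)" using x True e(1) by (auto simp: subset_iff)
      then have "dist (g i y) (g i z) \<le> L x * dist y z"
        using lipschitz_onD[OF uL(2)[of x i], of y z] x D i yz by auto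
      also have "\<dots> \<le> L' * dist y z"
      proof (rule mult_right_mono)
        have "L x \<le> \<bar>L x\<bar>" by simp
        also have "\<dots> \<le> (\<Sum>x\<in>D. \<bar>L x\<bar>)" using x D by (intro member_le_sum) auto
        also have "\<dots> \<le> L'" using e unfolding L'_def by simp
        finally show "L x \<le> L'" .
      qed simp
      finally show ?thesis .
    next
      case False
      have "dist (g i y) (g i z) \<le> 2 * \<bar>B\<bar>"
        using bound[OF i yz(1)] bound[OF i yz(2)] norm_triangle_ineq4[of "g i y" "g i z"] by (simp add: dist_norm)
      also have "\<dots> = 2 * \<bar>B\<bar> / e * e" using e by simp
      also have "\<dots> \<le> 2 * \<bar>B\<bar> / e * dist y z" using False e by (intro mult_left_mono) auto
      also have "\<dots> \<le> L' * dist y z"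
        unfolding L'_def by (intro mult_right_mono) (auto intro: sum_nonneg)
      finally show ?thesis .
    qed
  qed fact
  ultimately show thesis using that by blast
qed

lemma maximizer_in_frontier:
  fixes A :: "'a::real_inner set"
  assumes "z \<in> A" "\<And>v. v \<in> A \<Longrightarrow> v \<bullet> p \<le> z \<bullet> p" "p \<noteq> 0"
  shows "z \<in> frontier A"
proof -
  have "z \<notin> interior A"
  proof
    assume "z \<in> interior A"
    then obtain e where e: "e > 0" "cball z e \<subseteq> A" by (meson mem_interior_cball)
    then have "z + (e / norm p) *\<^sub>R p \<in> A" using assms(3) by (intro subsetD[OF e(2)]) (simp add: dist_norm)
    from assms(2)[OF this] have "(e / norm p) * (p \<bullet> p) \<le> 0" by (simp add: inner_add_left)
    moreover have "0 < (e / norm p) * (p \<bullet> p)" using e assms(3) by simp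
    ultimately show False by linarith
  qed
  then show ?thesis using assms(1) closure_subset by (auto simp: frontier_def)
qed

lemma R_convex_maximizers:
  assumes "R_convex R A" "z \<in> A" "y \<in> A" "norm n = 1" "norm m = 1"
    and "\<And>v. v \<in> A \<Longrightarrow> v \<bullet> n \<le> z \<bullet> n" "\<And>v. v \<in> A \<Longrightarrow> v \<bullet> m \<le> y \<bullet> m"
  shows "norm (z - y) \<le> R * norm (n - m)"
proof -
  have "z \<in> frontier A" "y \<in> frontier A"
    using assms by (auto intro!: maximizer_in_frontier)
  moreover have "n \<in> normal_cone A z" "m \<in> normal_cone A y"
    using assms(6,7) by (auto simp: normal_cone_def inner_diff_right inner_commute)
  ultimately show ?thesis using assms(1,4,5) by (auto simp: R_convex_def)
qed

text \<open>
  By \<open>R\<close>-convexity the maximizer is a Lipschitz function of the unit normal, so the support function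
  has quadratic upper bounds; testing them in the direction of \<open>v - z\<close> gives the claim.
\<close>
lemma R_convex_quadratic_gap:
  fixes A :: "'a::euclidean_space set"
  assumes A: "R_convex R A" "R > 0" and z: "z \<in> A" "\<And>v. v \<in> A \<Longrightarrow> v \<bullet> p \<le> z \<bullet> p"
    and v: "v \<in> A" "norm (v - z) \<le> 16 * R"
  shows "norm p * (norm (v - z))\<^sup>2 / (32 * R) \<le> (z - v) \<bullet> p"
proof (cases "p = 0")
  case False
  define n where "n = p /\<^sub>R norm p"
  have n: "norm n = 1" "p = norm p *\<^sub>R n" using False by (auto simp: n_def)
  have zn: "v \<bullet> n \<le> z \<bullet> n" if "v \<in> A" for v
    using z(2)[OF that] False by (simp add: n_def divide_right_mono)
  have "compact A" using A by (simp add: R_convex_def)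
  have unit: "(v - z) \<bullet> m \<le> R * (norm (m - n))\<^sup>2" if m: "norm m = 1" for m
  proof -
    obtain y where y: "y \<in> A" "\<forall>w\<in>A. w \<bullet> m \<le> y \<bullet> m"
      using continuous_attains_sup[OF \<open>compact A\<close>, of "\<lambda>v. v \<bullet> m"] v(1) continuous_on_inner[OF continuous_on_id continuous_on_const, of A m]
      by auto
    have "(v - z) \<bullet> m \<le> (y - z) \<bullet> (m - n) + (y - z) \<bullet> n"
      using y(2) v(1) by (simp add: inner_diff_left inner_diff_right)
    also have "\<dots> \<le> norm (y - z) * norm (m - n)"
      using zn[OF y(1)] norm_cauchy_schwarz[of "y - z" "m - n"] by (simp add: inner_diff_left)
    also have "\<dots> \<le> (R * norm (m - n)) * norm (m - n)"
      using R_convex_maximizers[OF A(1) y(1) z(1) m n(1)] y(2) zn by (intro mult_right_mono) auto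
    finally show ?thesis by (simp add: power2_eq_square)
  qed
  define w where "w = v - z"
  \<comment> \<open>With \<open>\<tau> = s *\<^sub>R w\<close> the inequality proved next gives
    \<open>(s - 8 * R * s\<^sup>2) * (norm w)\<^sup>2\<close> as a lower bound for
    \<open>- (w \<bullet> n)\<close>. The best choice is \<open>s = 1 / (16 * R)\<close>, with value
    \<open>1 / (32 * R)\<close>. The assumption \<open>norm (v - z) \<le> 16 * R\<close> says
    exactly that \<open>norm \<tau> \<le> 1\<close>.\<close>
  define \<tau> where "\<tau> = (1 / (16 * R)) *\<^sub>R w"
  have \<tau>: "norm \<tau> \<le> 1" using v A by (simp add: \<tau>_def w_def)
  have "w \<bullet> (n + \<tau>) \<le> 8 * R * (norm \<tau>)\<^sup>2"
  proof (cases "n + \<tau> = 0")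
    case True
    then show ?thesis using A by simp
  next
    case False
    define m where "m = (n + \<tau>) /\<^sub>R norm (n + \<tau>)"
    have m: "norm m = 1" "n + \<tau> = norm (n + \<tau>) *\<^sub>R m" using False by (auto simp: m_def)
    have "norm (m - (n + \<tau>)) = \<bar>1 - norm (n + \<tau>)\<bar>"
    proof -
      have "m - (n + \<tau>) = (1 - norm (n + \<tau>)) *\<^sub>R m" using m(2) by (simp add: scaleR_diff_left)
      then show ?thesis using m(1) by (metis mult.right_neutral norm_scaleR)
    qed
    also have "\<dots> \<le> norm \<tau>"
      using norm_triangle_ineq3[of n "n + \<tau>"] n(1) by simp
    finally have "norm (m - n) \<le> 2 * norm \<tau>"
      using norm_triangle_ineq[of "m - (n + \<tau>)" \<tau>] by simp
    then have "(norm (m - n))\<^sup>2 \<le> (2 * norm \<tau>)\<^sup>2" by (intro power_mono) auto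
    then have 1: "w \<bullet> m \<le> R * (4 * (norm \<tau>)\<^sup>2)"
      using order_trans[OF unit[OF m(1)] mult_left_mono[of "(norm (m - n))\<^sup>2" "(2 * norm \<tau>)\<^sup>2" R]] A(2)
      by (simp add: w_def power_mult_distrib)
    have 2: "norm (n + \<tau>) \<le> 2" using norm_triangle_ineq[of n \<tau>] n \<tau> by simp
    have "w \<bullet> (n + \<tau>) = norm (n + \<tau>) * (w \<bullet> m)" by (subst m(2)) simp
    also have "\<dots> \<le> norm (n + \<tau>) * (R * (4 * (norm \<tau>)\<^sup>2))" using 1 by (intro mult_left_mono) auto
    also have "\<dots> \<le> 2 * (R * (4 * (norm \<tau>)\<^sup>2))" using 2 A by (intro mult_right_mono) auto
    finally show ?thesis by simp
  qed
  moreover have "w \<bullet> (n + \<tau>) = w \<bullet> n + (norm w)\<^sup>2 / (16 * R)"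
    by (simp add: \<tau>_def inner_add_right power2_norm_eq_inner)
  moreover have "8 * R * (norm \<tau>)\<^sup>2 = (norm w)\<^sup>2 / (32 * R)"
    using A(2) by (simp add: \<tau>_def power_divide power2_eq_square field_simps)
  moreover have "(norm w)\<^sup>2 / (16 * R) = 2 * ((norm w)\<^sup>2 / (32 * R))" by simp
  ultimately have "(norm w)\<^sup>2 / (32 * R) \<le> - (w \<bullet> n)" by linarith
  then have "norm p * ((norm w)\<^sup>2 / (32 * R)) \<le> norm p * (- (w \<bullet> n))" by (intro mult_left_mono) auto
  also have "\<dots> = (z - v) \<bullet> p"
    by (subst (2) n(2)) (simp add: w_def inner_diff_left algebra_simps)
  finally show ?thesis by (simp add: w_def)
qed simp

section \<open>Subgradients of semiconvex functions\<close>

lemma frechet_subdifferentialD: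
  assumes "w \<in> frechet_subdifferential u x" "e > 0"
  shows "\<exists>d>0. \<forall>y. norm (y - x) < d \<longrightarrow> w \<bullet> (y - x) - e * norm (y - x) \<le> u y - u x"
proof -
  have "\<forall>z<0. \<forall>\<^sub>F y in at x. z < ereal ((u y - u x - w \<bullet> (y - x)) / norm (y - x))"
    using assms(1) unfolding frechet_subdifferential_def by (simp add: le_Liminf_iff)
  from this[rule_format, of "ereal (- e)"]
  have "\<forall>\<^sub>F y in at x. ereal (- e) < ereal ((u y - u x - w \<bullet> (y - x)) / norm (y - x))"
    using assms(2) by simp
  then obtain d where d: "d > 0" "\<And>y. y \<noteq> x \<Longrightarrow> dist y x < d \<Longrightarrow> - e < (u y - u x - w \<bullet> (y - x)) / norm (y - x)"
    by (auto simp: eventually_at)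
  have "w \<bullet> (y - x) - e * norm (y - x) \<le> u y - u x" if "norm (y - x) < d" for y
  proof (cases "y = x")
    case False
    then show ?thesis using d(2)[of y] that by (simp add: dist_norm field_simps)
  qed simp
  then show ?thesis using d(1) by blast
qed

lemma frechet_subdifferentialI:
  assumes "x \<in> interior K" "\<And>y. y \<in> K \<Longrightarrow> u x + w \<bullet> (y - x) - c * (norm (y - x))\<^sup>2 \<le> u y"
  shows "w \<in> frechet_subdifferential u x"
proof -
  obtain r where r: "r > 0" "ball x r \<subseteq> K" using assms(1) by (meson mem_interior)
  have "\<forall>\<^sub>F y in at x. ereal (- e) < ereal ((u y - u x - w \<bullet> (y - x)) / norm (y - x))" if "0 < e" for e
    unfolding eventually_at
  proof (intro exI[of _ "min r (e / (\<bar>c\<bar> + 1))"] conjI ballI impI)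
    show "0 < min r (e / (\<bar>c\<bar> + 1))" using r that by simp
    fix y assume y: "y \<noteq> x \<and> dist y x < min r (e / (\<bar>c\<bar> + 1))"
    then have "y \<in> K" using r by (auto simp: dist_commute subset_iff)
    have "c * norm (y - x) \<le> (\<bar>c\<bar> + 1) * norm (y - x)" by (intro mult_right_mono) auto
    also have "\<dots> < e" using y by (simp add: dist_norm pos_less_divide_eq mult.commute)
    finally have "- e * norm (y - x) < - c * norm (y - x) * norm (y - x)"
      using y by (intro mult_strict_right_mono) auto
    also have "\<dots> \<le> u y - u x - w \<bullet> (y - x)"
      using assms(2)[OF \<open>y \<in> K\<close>] by (simp add: power2_eq_square)
    finally show "ereal (- e) < ereal ((u y - u x - w \<bullet> (y - x)) / norm (y - x))"
      using y by (simp add: pos_less_divide_eq)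
  qed
  then have "\<forall>z<0. \<forall>\<^sub>F y in at x. z < ereal ((u y - u x - w \<bullet> (y - x)) / norm (y - x))"
  proof (intro allI impI)
    fix z :: ereal assume *: "\<And>e. 0 < e \<Longrightarrow> \<forall>\<^sub>F y in at x. ereal (- e) < ereal ((u y - u x - w \<bullet> (y - x)) / norm (y - x))" and "z < 0"
    show "\<forall>\<^sub>F y in at x. z < ereal ((u y - u x - w \<bullet> (y - x)) / norm (y - x))"
      using *[of "- real_of_ereal z"] \<open>z < 0\<close> by (cases z) auto
  qed
  then show ?thesis unfolding frechet_subdifferential_def by (simp add: le_Liminf_iff)
qed

text \<open>Repeated bisection of the segment from \<open>x\<close> to \<open>y\<close> carries the first-order bound at \<open>x\<close> to \<open>y\<close>.\<close>
lemma semiconvex_on_frechet_bound: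
  assumes u: "semiconvex_on K C u" and "C \<ge> 0" "convex K" "x \<in> K" "y \<in> K"
    and w: "w \<in> frechet_subdifferential u x"
  shows "u x + w \<bullet> (y - x) - C / 2 * (norm (y - x))\<^sup>2 \<le> u y"
proof (cases "y = x")
  case False
  define h where "h = y - x"
  define t :: "nat \<Rightarrow> real" where "t n = (1/2) ^ n" for n
  define g where "g = (\<lambda>n. (u (x + t n *\<^sub>R h) - u x) / t n)"
  have t: "0 < t n" "t n \<le> 1" "t (Suc n) = t n / 2" for n
    by (auto simp: t_def power_le_one)
  have inK: "x + s *\<^sub>R h \<in> K" if "0 \<le> s" "s \<le> 1" for s
  proof -
    have "x + s *\<^sub>R h = (1 - s) *\<^sub>R x + s *\<^sub>R y" by (simp add: h_def algebra_simps)
    then show ?thesis using assms that by (simp add: convexD_alt)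
  qed
  have step: "g (Suc n) \<le> g n + C * (norm h)\<^sup>2 / 4 * t n" for n
  proof -
    define k where "k = (t n / 2) *\<^sub>R h"
    define m where "m = x + k"
    have mk: "m + k = x + t n *\<^sub>R h" "m - k = x" by (auto simp: m_def k_def scaleR_left_distrib[symmetric])
    then have "closed_segment (m - k) (m + k) \<subseteq> K"
      using inK[of "t n"] t(1,2)[of n] assms by (intro closed_segment_subset) auto
    then have "u (m + k) + u (m - k) - 2 * u m \<ge> - C * (norm k)\<^sup>2"
      using u unfolding semiconvex_on_def by blast
    moreover have "(norm k)\<^sup>2 = (t n)\<^sup>2 / 4 * (norm h)\<^sup>2"
      by (simp add: k_def power_mult_distrib power_divide)
    ultimately have *: "2 * (u (x + k) - u x) \<le> (u (x + t n *\<^sub>R h) - u x) + C * ((t n)\<^sup>2 / 4 * (norm h)\<^sup>2)"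
      unfolding mk by (simp add: m_def)
    have "g (Suc n) = 2 * (u (x + k) - u x) / t n"
      using t(1)[of n] by (simp add: g_def t(3) k_def field_simps)
    also have "\<dots> \<le> ((u (x + t n *\<^sub>R h) - u x) + C * ((t n)\<^sup>2 / 4 * (norm h)\<^sup>2)) / t n"
      using * t(1)[of n] by (intro divide_right_mono) auto
    also have "\<dots> = g n + C * (norm h)\<^sup>2 / 4 * t n"
      using t(1)[of n] by (simp add: g_def add_divide_distrib power2_eq_square)
    finally show ?thesis .
  qed
  \<comment> \<open>The errors \<open>C * (norm h)\<^sup>2 / 4 * t k\<close> form a geometric
    series; this is the origin of the constant \<open>C / 2\<close>.\<close>
  have gn: "g n \<le> u y - u x + C / 2 * (norm h)\<^sup>2 * (1 - t n)" for n
  proof (induction n)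
    case 0
    show ?case by (simp add: g_def t_def h_def)
  next
    case (Suc n)
    then show ?case using step[of n] by (simp add: t(3) field_simps)
  qed
  have "w \<bullet> h \<le> u y - u x + C / 2 * (norm h)\<^sup>2"
  proof (rule le_if_le_add_small[of 1 _ _ "norm h"])
    fix e :: real assume "0 < e"
    obtain d where d: "d > 0" "\<And>y. norm (y - x) < d \<Longrightarrow> w \<bullet> (y - x) - e * norm (y - x) \<le> u y - u x"
      using frechet_subdifferentialD[OF w \<open>0 < e\<close>] by blast
    obtain n where n: "(1/2::real) ^ n < d / norm h"
      using real_arch_pow_inv[of "d / norm h" "1/2"] d(1) False by (auto simp: h_def)
    have "w \<bullet> (t n *\<^sub>R h) - e * norm (t n *\<^sub>R h) \<le> u (x + t n *\<^sub>R h) - u x"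
    proof -
      have "t n * norm h < d" using n False by (simp add: t_def h_def pos_less_divide_eq)
      then show ?thesis using d(2)[of "x + t n *\<^sub>R h"] t(1)[of n] by simp
    qed
    then have "w \<bullet> h - e * norm h \<le> g n"
      using t(1)[of n] by (simp add: g_def field_simps)
    also have "\<dots> \<le> u y - u x + C / 2 * (norm h)\<^sup>2 * (1 - t n)" by (rule gn)
    also have "\<dots> \<le> u y - u x + C / 2 * (norm h)\<^sup>2"
      using t[of n] \<open>C \<ge> 0\<close> by (simp add: mult_left_le)
    finally show "w \<bullet> h \<le> u y - u x + C / 2 * (norm h)\<^sup>2 + norm h * e" by (simp add: mult.commute)
  qed simp
  then show ?thesis by (simp add: h_def)
qed simp

text \<open>Test with a short step in the direction of \<open>w\<close> itself; the quadratic error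
  disappears in the limit. Applied to the Hamiltonian, the bound makes the adjoint inclusion
  linearly bounded in \<open>p\<close>, on which both the regularity and the nonvanishing of adjoint
  arcs rest.\<close>

lemma proximal_subgradient_norm_le:
  fixes w :: "'a::real_inner"
  assumes "x \<in> interior K" "\<And>y. y \<in> K \<Longrightarrow> u x + w \<bullet> (y - x) - c * (norm (y - x))\<^sup>2 \<le> u y"
    and lip: "\<And>y. y \<in> K \<Longrightarrow> u y - u x \<le> L * norm (y - x)" and "L \<ge> 0"
  shows "norm w \<le> L"
proof (cases "w = 0")
  case False
  obtain r where r: "r > 0" "ball x r \<subseteq> K" using assms(1) by (meson mem_interior)
  have "norm w \<le> L"
  proof (rule le_if_le_add_small[of "r / norm w" _ _ "c * norm w"])
    show "0 < r / norm w" using r False by simp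
    fix t assume t: "0 < t" "t < r / norm w"
    have "x + t *\<^sub>R w \<in> K" using t r False by (intro subsetD[OF r(2)]) (simp add: dist_norm field_simps)
    then have "t * (norm w)\<^sup>2 - c * (t * norm w)\<^sup>2 \<le> L * (t * norm w)"
      using assms(2)[of "x + t *\<^sub>R w"] lip[of "x + t *\<^sub>R w"] t by (simp add: power2_norm_eq_inner)
    then have "(t * norm w) * norm w \<le> (t * norm w) * (L + c * norm w * t)"
      by (simp add: power2_eq_square algebra_simps)
    then show "norm w \<le> L + c * norm w * t" using t False by simp
  qed
  then show ?thesis .
qed (use assms in simp)

text \<open>
  The minimizers of \<open>u + k |\<cdot> - x|\<^sup>2\<close> tend to \<open>x\<close> as \<open>k\<close> tends to infinity and carry Frechet subgradients,
  which by semiconvexity satisfy a global quadratic bound that survives the limit.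
\<close>
lemma semiconvex_proximal_subgradient_exists:
  fixes x :: "'a::euclidean_space"
  assumes u: "semiconvex_on K C u" and "C \<ge> 0" "convex K" "compact K" and x: "x \<in> interior K"
    and lip: "L-lipschitz_on K u"
  shows "\<exists>w. \<forall>y\<in>K. u x + w \<bullet> (y - x) - C / 2 * (norm (y - x))\<^sup>2 \<le> u y"
proof -
  have xK: "x \<in> K" using x interior_subset by blast
  have "L \<ge> 0" using lip lipschitz_on_nonneg by blast
  have lipD: "\<bar>u y - u z\<bar> \<le> L * norm (y - z)" if "y \<in> K" "z \<in> K" for y z
    using lipschitz_on_normD[OF lip that] by simp
  have cont: "continuous_on K u" using u by (simp add: semiconvex_on_def)
  have "\<exists>z\<in>K. \<forall>y\<in>K. u z + k * (norm (z - x))\<^sup>2 \<le> u y + k * (norm (y - x))\<^sup>2" for k :: real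
    using xK by (intro continuous_attains_inf \<open>compact K\<close>) (auto intro!: continuous_intros cont)
  then obtain z where zK: "\<And>k. z k \<in> K"
    and z: "\<And>k y. y \<in> K \<Longrightarrow> u (z k) + k * (norm (z k - x))\<^sup>2 \<le> u y + k * (norm (y - x))\<^sup>2"
    by metis
  define s where "s = (\<lambda>k::nat. z (real (Suc k)))"
  \<comment> \<open>This is minus the gradient of the penalty at its minimizer \<open>s k\<close>.
    Counting from \<open>Suc k\<close> keeps the penalty weight positive.\<close>
  define w where "w = (\<lambda>k::nat. (- 2 * real (Suc k)) *\<^sub>R (s k - x))"
  have near: "real (Suc k) * norm (s k - x) \<le> L" for k
  proof (cases "s k = x")
    case False
    have "real (Suc k) * (norm (s k - x))\<^sup>2 \<le> u x - u (s k)"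
      using z[OF xK, of "real (Suc k)"] by (simp add: s_def)
    also have "\<dots> \<le> L * norm (s k - x)"
      using lipD[OF xK zK[of "real (Suc k)"]] by (simp add: s_def norm_minus_commute)
    finally show ?thesis using False by (simp add: power2_eq_square)
  qed (use \<open>L \<ge> 0\<close> in simp)
  have quad: "u (s k) + w k \<bullet> (y - s k) - real (Suc k) * (norm (y - s k))\<^sup>2 \<le> u y" if "y \<in> K" for k y
  proof -
    have "(norm (y - x))\<^sup>2 = (norm (y - s k))\<^sup>2 + 2 * ((s k - x) \<bullet> (y - s k)) + (norm (s k - x))\<^sup>2"
      unfolding power2_norm_eq_inner by (simp add: algebra_simps inner_commute)
    then have e: "real (Suc k) * (norm (y - x))\<^sup>2 = real (Suc k) * (norm (y - s k))\<^sup>2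
        - w k \<bullet> (y - s k) + real (Suc k) * (norm (s k - x))\<^sup>2"
    proof -
      have "w k \<bullet> (y - s k) = - (real (Suc k) * (2 * ((s k - x) \<bullet> (y - s k))))"
        unfolding w_def inner_scaleR_left by (simp only: algebra_simps)
      then show ?thesis unfolding \<open>(norm (y - x))\<^sup>2 = _\<close> distrib_left by linarith
    qed
    have "u (s k) + real (Suc k) * (norm (s k - x))\<^sup>2 \<le> u y + real (Suc k) * (norm (y - x))\<^sup>2"
      using z[OF that, of "real (Suc k)"] unfolding s_def .
    then show ?thesis using e by linarith
  qed
  have wbound: "norm (w k) \<le> 2 * L" for k proof -
    have "\<bar>- 2 * real (Suc k)\<bar> = 2 * real (Suc k)" by simp
    then show ?thesis using near[of k] by (simp only: w_def norm_scaleR mult.assoc)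
  qed
  have "(\<lambda>k. s k - x) \<longlonglongrightarrow> 0"
  proof (rule Lim_null_comparison)
    show "\<forall>\<^sub>F k in sequentially. norm (s k - x) \<le> L / real (Suc k)"
      using near by (auto simp: field_simps)
    show "(\<lambda>k. L / real (Suc k)) \<longlonglongrightarrow> 0" 
      using tendsto_mult[OF tendsto_const[of L] LIMSEQ_inverse_real_of_nat] by (simp add: divide_inverse)
  qed
  then have s: "s \<longlonglongrightarrow> x" by (simp add: LIM_zero_iff)
  have "compact (cball (0::'a) (2 * L))" by simp
  then obtain w0 r where r: "strict_mono r" "(w \<circ> r) \<longlonglongrightarrow> w0"
    using wbound unfolding compact_def by (metis mem_cball_0)
  have sr: "(s \<circ> r) \<longlonglongrightarrow> x" using s r(1) by (rule LIMSEQ_subseq_LIMSEQ)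
  have usr: "(\<lambda>k. u (s (r k))) \<longlonglongrightarrow> u x"
    using continuous_on_tendsto_compose[OF cont sr xK] zK by (simp add: s_def)
  have "\<forall>\<^sub>F k in sequentially. s (r k) \<in> interior K"
    using sr x by (auto simp: tendsto_def o_def)
  \<comment> \<open>The quadratic constant in \<open>quad\<close> grows with \<open>k\<close> and
    cannot be passed to the limit. It is used only to recognize \<open>w (r k)\<close> as a Frechet
    subgradient; semiconvexity then replaces it by \<open>C / 2\<close>, independent of
    \<open>k\<close>.\<close>
  then have ev: "\<forall>\<^sub>F k in sequentially. u (s (r k)) + w (r k) \<bullet> (y - s (r k)) - C / 2 * (norm (y - s (r k)))\<^sup>2 \<le> u y"
    if "y \<in> K" for y
  proof eventually_elim
    case (elim k)
    have "w (r k) \<in> frechet_subdifferential u (s (r k))"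
      using elim by (rule frechet_subdifferentialI) (rule quad)
    then show ?case using semiconvex_on_frechet_bound[OF u \<open>C \<ge> 0\<close> \<open>convex K\<close> _ that] zK by (simp add: s_def)
  qed
  have "u x + w0 \<bullet> (y - x) - C / 2 * (norm (y - x))\<^sup>2 \<le> u y" if "y \<in> K" for y
  proof (rule tendsto_upperbound[OF _ ev[OF that]])
    show "(\<lambda>k. u (s (r k)) + w (r k) \<bullet> (y - s (r k)) - C / 2 * (norm (y - s (r k)))\<^sup>2)
        \<longlonglongrightarrow> u x + w0 \<bullet> (y - x) - C / 2 * (norm (y - x))\<^sup>2"
      using r(2) sr usr unfolding o_def by (intro tendsto_intros)
  qed simp
  then show ?thesis by blast
qed

section \<open>Existence for differential inclusions\<close>

lemma vector_derivative_inner_le: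
  fixes P :: "real \<Rightarrow> 'a::real_inner"
  assumes "(P has_vector_derivative v) (at s)" "s < r"
    and le: "\<And>t. s < t \<Longrightarrow> t < r \<Longrightarrow> (P t - P s) \<bullet> a \<le> (t - s) * c"
  shows "v \<bullet> a \<le> c"
proof (rule tendsto_upperbound)
  have "((\<lambda>t. P t \<bullet> a) has_real_derivative v \<bullet> a) (at s)"
    using bounded_linear.has_vector_derivative[OF bounded_linear_inner_left assms(1)]
    by (simp add: has_real_derivative_iff_has_vector_derivative)
  then have "((\<lambda>t. (P t \<bullet> a - P s \<bullet> a) / (t - s)) \<longlongrightarrow> v \<bullet> a) (at s)"
    by (simp add: has_field_derivative_iff)
  then show "((\<lambda>t. (P t \<bullet> a - P s \<bullet> a) / (t - s)) \<longlongrightarrow> v \<bullet> a) (at_right s)"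
    by (rule filterlim_mono) (auto intro: at_le)
  have "(P t \<bullet> a - P s \<bullet> a) / (t - s) \<le> c" if "s < t" "t < r" for t
    using le[OF that] that by (simp add: inner_diff_left pos_divide_le_eq mult.commute)
  then show "\<forall>\<^sub>F t in at_right s. (P t \<bullet> a - P s \<bullet> a) / (t - s) \<le> c"
    using \<open>s < r\<close> by (auto simp: eventually_at_right_field)
qed simp

text \<open>By Tychonoff's theorem the sequence has a cluster point in a product of balls. The
  filter \<open>G\<close> plays the role of a subsequence that converges at all of the possibly
  uncountably many \<open>s\<close> at once; the functions may be discontinuous, as Euler step
  functions are.\<close>

lemma pointwise_cluster_point:
  fixes X :: "nat \<Rightarrow> 'i \<Rightarrow> 'a::euclidean_space"
  assumes "\<And>n s. norm (X n s) \<le> B"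
  obtains P G where "G \<noteq> bot" "G \<le> sequentially" "\<And>s. ((\<lambda>n. X n s) \<longlongrightarrow> P s) G"
proof -
  have "compactin (product_topology (\<lambda>_. euclidean) UNIV) (PiE UNIV (\<lambda>_::'i. cball (0::'a) B))"
    by (simp add: compactin_PiE)
  then have "compact (PiE UNIV (\<lambda>_::'i. cball (0::'a) B))"
    by (simp add: euclidean_product_topology)
  moreover have "filtermap X sequentially \<noteq> bot" by (simp add: filtermap_bot_iff)
  moreover have "\<forall>\<^sub>F f in filtermap X sequentially. f \<in> PiE UNIV (\<lambda>_. cball 0 B)"
    using assms by (auto simp: eventually_filtermap PiE_iff mem_cball_0 intro!: always_eventually simp del: mem_cball)
  ultimately obtain P where P: "inf (nhds P) (filtermap X sequentially) \<noteq> bot"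
    unfolding compact_filter by blast
  define G where "G = inf (filtercomap X (nhds P)) sequentially"
  have "G \<noteq> bot"
  proof
    assume "G = bot"
    then have "eventually (\<lambda>_. False) G" by simp
    then obtain Q R where QR: "eventually Q (filtercomap X (nhds P))" "eventually R sequentially" "\<And>n. Q n \<Longrightarrow> R n \<Longrightarrow> False"
      unfolding G_def eventually_inf by blast
    then obtain Q' where Q': "eventually Q' (nhds P)" "\<And>n. Q' (X n) \<Longrightarrow> Q n"
      unfolding eventually_filtercomap by blast
    have "eventually (\<lambda>f. \<not> Q' f) (filtermap X sequentially)"
      unfolding eventually_filtermap using QR(2) by (rule eventually_mono) (use QR(3) Q'(2) in blast)
    with Q'(1) have "eventually (\<lambda>_. False) (inf (nhds P) (filtermap X sequentially))"
      unfolding eventually_inf by blast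
    then show False using P by (simp add: trivial_limit_def)
  qed
  moreover have "G \<le> sequentially" by (simp add: G_def)
  moreover have "((\<lambda>n. X n s) \<longlongrightarrow> P s) G" for s
  proof (rule topological_tendstoI)
    fix V assume "open V" "P s \<in> V"
    have "open ((\<lambda>f::'i \<Rightarrow> 'a. f s) -` V)"
      using \<open>open V\<close> by (intro open_vimage) (auto intro: continuous_on_product_coordinates)
    then have "eventually (\<lambda>f. f s \<in> V) (nhds P)"
      using \<open>P s \<in> V\<close> by (auto simp: eventually_nhds)
    then have "eventually (\<lambda>n. X n s \<in> V) (filtercomap X (nhds P))"
      unfolding eventually_filtercomap by (intro exI[of _ "\<lambda>f. f s \<in> V"]) auto
    then show "eventually (\<lambda>n. X n s \<in> V) G" unfolding G_def by (rule filter_leD[OF inf_le1])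
  qed
  ultimately show thesis by (rule that)
qed

text \<open>
  The solution is a pointwise cluster point of Euler step functions. The right-hand side enters only
  through the linear inequalities \<open>v \<bullet> \<alpha> i s \<le> \<beta> i s p\<close>, which are stable under averaging and limits.
\<close>
lemma differential_inclusion_exists:
  fixes W :: "real \<Rightarrow> 'a::euclidean_space \<Rightarrow> 'a"
  assumes "a < b" "0 \<le> L"
    and W_bound: "\<And>s p. s \<in> {a..b} \<Longrightarrow> norm (W s p) \<le> L * (1 + norm p)"
    and W_le: "\<And>i s p. i \<in> I \<Longrightarrow> s \<in> {a..b} \<Longrightarrow> W s p \<bullet> \<alpha> i s \<le> \<beta> i s p"
    and \<alpha>: "\<And>i. i \<in> I \<Longrightarrow> continuous_on {a..b} (\<alpha> i)"
    and \<beta>: "\<And>i. i \<in> I \<Longrightarrow> continuous_on ({a..b} \<times> UNIV) (\<lambda>(s, p). \<beta> i s p)"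
  obtains P M where "P a = p0" "M-lipschitz_on {a..b} P"
    "\<And>s v i. s \<in> {a<..<b} \<Longrightarrow> (P has_vector_derivative v) (at s) \<Longrightarrow> i \<in> I \<Longrightarrow> v \<bullet> \<alpha> i s \<le> \<beta> i s (P s)"
proof -
  define h where "h = (\<lambda>n::nat. (b - a) / real (Suc n))"
  define q where "q = (\<lambda>n. rec_nat p0 (\<lambda>k p. p + h n *\<^sub>R W (a + real k * h n) p))"
  have q: "q n 0 = p0" "q n (Suc k) = q n k + h n *\<^sub>R W (a + real k * h n) (q n k)" for n k
    by (simp_all add: q_def)
  have h: "h n > 0" "h n * real (Suc n) = b - a" for n using \<open>a < b\<close> by (simp_all add: h_def)
  have node: "a + real k * h n \<in> {a..b}" if "k \<le> Suc n" for k n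
  proof -
    have "real k * h n \<le> real (Suc n) * h n" using that h(1)[of n] by (intro mult_right_mono) auto
    also have "\<dots> = b - a" using h(2)[of n] by (simp only: mult.commute)
    finally show ?thesis using h(1)[of n] by simp
  qed
  \<comment> \<open>Discrete Gronwall bound: each Euler step multiplies
    \<open>1 + norm (q n k)\<close> by at most \<open>1 + L * h n\<close>, which is below
    \<open>exp (L * h n)\<close>.\<close>
  define B where "B = (1 + norm p0) * exp (L * (b - a))"
  have "B > 0" unfolding B_def by (simp add: add_pos_nonneg)
  have qB: "1 + norm (q n k) \<le> B" if "k \<le> Suc n" for n k
  proof -
    have "1 + norm (q n k) \<le> (1 + norm p0) * exp (L * (real k * h n))"
      using that
    proof (induction k)
      case (Suc k)
      have "norm (q n (Suc k)) \<le> norm (q n k) + h n * norm (W (a + real k * h n) (q n k))"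
        unfolding q using norm_triangle_ineq[of "q n k" "h n *\<^sub>R W (a + real k * h n) (q n k)"] h(1)[of n] by simp
      also have "\<dots> \<le> norm (q n k) + h n * (L * (1 + norm (q n k)))"
        using W_bound node[of k n] Suc.prems h(1)[of n] by (intro add_left_mono mult_left_mono) auto
      finally have "1 + norm (q n (Suc k)) \<le> (1 + norm (q n k)) * (1 + L * h n)" by (simp add: algebra_simps)
      also have "\<dots> \<le> ((1 + norm p0) * exp (L * (real k * h n))) * exp (L * h n)"
        using Suc h(1)[of n] \<open>0 \<le> L\<close> by (intro mult_mono exp_ge_add_one_self) (auto intro!: mult_nonneg_nonneg add_nonneg_nonneg)
      also have "\<dots> = (1 + norm p0) * exp (L * (real (Suc k) * h n))"
        by (simp add: mult_exp_exp[symmetric] algebra_simps exp_add)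
      finally show ?case .
    qed (simp add: q)
    also have "\<dots> \<le> B"
      unfolding B_def using node[OF that] \<open>0 \<le> L\<close> by (intro mult_left_mono) (auto intro!: mult_left_mono)
    finally show ?thesis .
  qed
  define M where "M = L * B"
  have "M \<ge> 0" using \<open>0 \<le> L\<close> \<open>B > 0\<close> by (simp add: M_def)
  have WM: "norm (W (a + real k * h n) (q n k)) \<le> M" if "k \<le> Suc n" for k n
    using order_trans[OF W_bound[OF node[OF that]] mult_left_mono[OF qB[OF that] \<open>0 \<le> L\<close>]] by (simp add: M_def)
  have q_sum: "q n l - q n k = (\<Sum>j=k..<l. h n *\<^sub>R W (a + real j * h n) (q n j))" if "k \<le> l" for n k l
    using that by (induction l rule: dec_induct) (simp_all add: q algebra_simps)
  have qlip: "norm (q n l - q n k) \<le> M * (h n * (real l - real k))" if "k \<le> l" "l \<le> Suc n" for n k l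
  proof -
    have "norm (q n l - q n k) \<le> (\<Sum>j=k..<l. h n * M)"
      unfolding q_sum[OF that(1)]
    proof (rule sum_norm_le)
      fix j assume "j \<in> {k..<l}"
      then show "norm (h n *\<^sub>R W (a + real j * h n) (q n j)) \<le> h n * M"
        using WM[of j n] that h(1)[of n] by simp
    qed
    also have "\<dots> = M * (h n * (real l - real k))" using that by (simp add: of_nat_diff)
    finally show ?thesis .
  qed
  have qlip': "norm (q n l - q n k) \<le> M * (h n * \<bar>real l - real k\<bar>)" if "k \<le> Suc n" "l \<le> Suc n" for n k l
    using qlip[of k l n] qlip[of l k n] that by (cases "k \<le> l") (auto simp: norm_minus_commute abs_if)
  \<comment> \<open>This is the index of the last grid point not after \<open>s\<close>. At
    \<open>s = b\<close> it equals \<open>Suc n\<close>, so the estimates on nodes have to include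
    that index.\<close>
  define \<kappa> where "\<kappa> = (\<lambda>n s. nat \<lfloor>(s - a) / h n\<rfloor>)"
  have \<kappa>: "\<kappa> n s \<le> Suc n" "h n * real (\<kappa> n s) \<le> s - a" "s - a \<le> h n * real (\<kappa> n s) + h n" if "s \<in> {a..b}" for n s
  proof -
    have 0: "0 \<le> (s - a) / h n" using that h(1)[of n] by simp
    then have r: "real (\<kappa> n s) = of_int \<lfloor>(s - a) / h n\<rfloor>" by (simp add: \<kappa>_def)
    have "of_int \<lfloor>(s - a) / h n\<rfloor> * h n \<le> s - a"
      using of_int_floor_le[of "(s - a) / h n"] h(1)[of n] by (simp only: pos_le_divide_eq)
    then show 1: "h n * real (\<kappa> n s) \<le> s - a" unfolding r by (simp add: mult.commute)
    have "(s - a) / h n \<le> of_int \<lfloor>(s - a) / h n\<rfloor> + 1" by linarith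
    then have "s - a \<le> (of_int \<lfloor>(s - a) / h n\<rfloor> + 1) * h n" using h(1)[of n] by (simp only: pos_divide_le_eq)
    then show "s - a \<le> h n * real (\<kappa> n s) + h n" unfolding r by (simp add: algebra_simps)
    have "h n * real (\<kappa> n s) \<le> h n * real (Suc n)" using 1 that h(2)[of n] by auto
    then show "\<kappa> n s \<le> Suc n" using h(1)[of n] by simp
  qed
  \<comment> \<open>The value 0 off the interval provides the bound at every \<open>s\<close> that
    the cluster point argument asks for.\<close>
  define X where "X = (\<lambda>n s. if s \<in> {a..b} then q n (\<kappa> n s) else 0)"
  have XB: "norm (X n s) \<le> B" for n s
    using qB[OF \<kappa>(1)[of s n]] \<open>B > 0\<close> by (auto simp: X_def)
  obtain P G where G: "G \<noteq> bot" "G \<le> sequentially" and P: "\<And>s. ((\<lambda>n. X n s) \<longlongrightarrow> P s) G"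
    by (rule pointwise_cluster_point[of X B, OF XB]) (rule that)
  have "h \<longlonglongrightarrow> 0"
    using tendsto_mult[OF tendsto_const[of "b - a"] LIMSEQ_inverse_real_of_nat] by (simp add: h_def[abs_def] divide_inverse)
  then have hG: "(h \<longlongrightarrow> 0) G" using G(2) tendsto_mono by blast
  have Pq: "((\<lambda>n. q n (\<kappa> n s)) \<longlongrightarrow> P s) G" if "s \<in> {a..b}" for s
    using P[of s] that by (simp add: X_def)
  have h\<kappa>: "((\<lambda>n. h n * real (\<kappa> n s)) \<longlongrightarrow> s - a) G" if "s \<in> {a..b}" for s
  proof (rule tendsto_sandwich)
    show "((\<lambda>n. s - a - h n) \<longlongrightarrow> s - a) G" using hG by (auto intro!: tendsto_eq_intros)
    show "\<forall>\<^sub>F n in G. s - a - h n \<le> h n * real (\<kappa> n s)" "\<forall>\<^sub>F n in G. h n * real (\<kappa> n s) \<le> s - a"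
      using \<kappa>[OF that] by (auto simp: algebra_simps)
  qed simp
  have mono\<kappa>: "\<kappa> n s \<le> \<kappa> n t" if "s \<le> t" for n s t
    unfolding \<kappa>_def using that h(1)[of n] by (intro nat_mono floor_mono divide_right_mono) auto
  show thesis
  proof (rule that[of P M])
    have "((\<lambda>n. q n (\<kappa> n a)) \<longlongrightarrow> p0) G" by (simp add: \<kappa>_def q)
    then show "P a = p0" using Pq[of a] \<open>a < b\<close> G(1) tendsto_unique[of G] by auto
    show "M-lipschitz_on {a..b} P"
    proof (rule lipschitz_onI)
      fix s t assume st: "s \<in> {a..b}" "t \<in> {a..b}"
      show "dist (P s) (P t) \<le> M * dist s t"
      proof (rule tendsto_le[OF G(1)])
        show "((\<lambda>n. dist (q n (\<kappa> n s)) (q n (\<kappa> n t))) \<longlongrightarrow> dist (P s) (P t)) G"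
          using st by (intro tendsto_dist Pq)
        have "((\<lambda>n. M * \<bar>h n * real (\<kappa> n s) - h n * real (\<kappa> n t)\<bar>) \<longlongrightarrow> M * \<bar>(s - a) - (t - a)\<bar>) G"
          by (rule tendsto_mult[OF tendsto_const tendsto_rabs[OF tendsto_diff[OF h\<kappa>[OF st(1)] h\<kappa>[OF st(2)]]]])
        then show "((\<lambda>n. M * \<bar>h n * real (\<kappa> n s) - h n * real (\<kappa> n t)\<bar>) \<longlongrightarrow> M * dist s t) G"
          by (simp add: dist_real_def)
        show "\<forall>\<^sub>F n in G. dist (q n (\<kappa> n s)) (q n (\<kappa> n t)) \<le> M * \<bar>h n * real (\<kappa> n s) - h n * real (\<kappa> n t)\<bar>"
        proof (intro always_eventually allI)
          fix n
          show "dist (q n (\<kappa> n s)) (q n (\<kappa> n t)) \<le> M * \<bar>h n * real (\<kappa> n s) - h n * real (\<kappa> n t)\<bar>"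
            using qlip'[OF \<kappa>(1)[OF st(2)] \<kappa>(1)[OF st(1)]] h(1)[of n]
            by (simp add: dist_norm right_diff_distrib[symmetric] abs_mult)
        qed
      qed
    qed fact
    fix s v i assume s: "s \<in> {a<..<b}" and v: "(P has_vector_derivative v) (at s)" and i: "i \<in> I"
    have sab: "s \<in> {a..b}" using s by auto
    have "v \<bullet> \<alpha> i s \<le> \<beta> i s (P s) + (1 + M) * e" if "e > 0" for e
    proof -
      obtain d1 where d1: "d1 > 0" "\<And>t. t \<in> {a..b} \<Longrightarrow> dist t s < d1 \<Longrightarrow> dist (\<alpha> i t) (\<alpha> i s) < e"
        using \<alpha>[OF i] sab \<open>e > 0\<close> unfolding continuous_on_iff by blast
      have "\<exists>d>0. \<forall>z\<in>{a..b} \<times> UNIV. dist z (s, P s) < d \<longrightarrow> dist ((\<lambda>(s, p). \<beta> i s p) z) ((\<lambda>(s, p). \<beta> i s p) (s, P s)) < e"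
        using \<beta>[OF i] sab \<open>e > 0\<close> unfolding continuous_on_iff by blast
      then obtain d2 where d2: "d2 > 0" "\<And>t p. t \<in> {a..b} \<Longrightarrow> dist (t, p) (s, P s) < d2 \<Longrightarrow> dist (\<beta> i t p) (\<beta> i s (P s)) < e"
        by auto
      \<comment> \<open>The distance to \<open>(s, P s)\<close> must stay below \<open>d2\<close>.
        Time uses at most \<open>d2 / 2\<close>. The state uses another \<open>d2 / 2\<close>: a
        quarter of \<open>d2\<close> from moving for a time \<open>r\<close> at speed
        \<open>M\<close>, an eighth from one grid step, an eighth from the convergence at
        \<open>s\<close>. Writing \<open>M + 1\<close> avoids division by zero.\<close>
      define r where "r = min d1 (min (d2 / 2) (min (d2 / (4 * (M + 1))) (b - s)))"
      have "0 < d2 / (4 * (M + 1))" "0 < d2 / 2" "0 < b - s" using d2(1) \<open>M \<ge> 0\<close> s by simp_all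
      then have "0 < r" using d1(1) unfolding r_def min_less_iff_conj by blast
      moreover have "r \<le> d1" "r \<le> d2 / 2" "r \<le> d2 / (4 * (M + 1))" "r \<le> b - s" unfolding r_def
        by (rule min.cobounded1 min.coboundedI2[OF min.cobounded1] min.coboundedI2[OF min.coboundedI2[OF min.cobounded1]]
            min.coboundedI2[OF min.coboundedI2[OF min.cobounded2]])+
      ultimately have r: "0 < r" "r \<le> d1" "r \<le> d2 / 2" "r \<le> d2 / (4 * (M + 1))" "r \<le> b - s" by blast+
      have Mr: "M * r \<le> d2 / 4"
      proof -
        have "M * r \<le> (M + 1) * r" using r(1) by (intro mult_right_mono) simp_all
        also have "\<dots> \<le> d2 / 4" using r(4) \<open>M \<ge> 0\<close> by (simp add: field_simps)
        finally show ?thesis .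
      qed
      define c where "c = \<beta> i s (P s) + (1 + M) * e"
      show ?thesis
      proof (rule vector_derivative_inner_le[OF v, of "s + r"])
        fix t assume t: "s < t" "t < s + r"
        have tab: "t \<in> {a..b}" using t sab r by auto
        have ev1: "\<forall>\<^sub>F n in G. h n < min r (d2 / (8 * (M + 1)))"
        proof (rule order_tendstoD(2)[OF hG])
          show "0 < min r (d2 / (8 * (M + 1)))" using r(1) d2(1) \<open>M \<ge> 0\<close> by simp
        qed
        have ev2: "\<forall>\<^sub>F n in G. dist (q n (\<kappa> n s)) (P s) < d2 / 8"
          using d2(1) by (intro tendstoD[OF Pq[OF sab]]) simp
        show "(P t - P s) \<bullet> \<alpha> i s \<le> (t - s) * (\<beta> i s (P s) + (1 + M) * e)"
        proof (rule tendsto_le[OF G(1)])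
          show "((\<lambda>n. (q n (\<kappa> n t) - q n (\<kappa> n s)) \<bullet> \<alpha> i s) \<longlongrightarrow> (P t - P s) \<bullet> \<alpha> i s) G"
            using tab sab by (intro tendsto_intros Pq)
          have "((\<lambda>n. (h n * real (\<kappa> n t) - h n * real (\<kappa> n s)) * c) \<longlongrightarrow> ((t - a) - (s - a)) * c) G"
            by (rule tendsto_mult[OF tendsto_diff[OF h\<kappa>[OF tab] h\<kappa>[OF sab]] tendsto_const])
          then show "((\<lambda>n. (h n * real (\<kappa> n t) - h n * real (\<kappa> n s)) * c) \<longlongrightarrow> (t - s) * (\<beta> i s (P s) + (1 + M) * e)) G"
            by (simp add: c_def)
          show "\<forall>\<^sub>F n in G. (q n (\<kappa> n t) - q n (\<kappa> n s)) \<bullet> \<alpha> i s \<le> (h n * real (\<kappa> n t) - h n * real (\<kappa> n s)) * c"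
            using ev1 ev2
          proof eventually_elim
            case (elim n)
            \<comment> \<open>The index \<open>\<kappa> n s\<close> may belong to a node up to one
              step before \<open>s\<close>, hence the requirement that \<open>h n\<close> be below
              \<open>r\<close>. The error \<open>(1 + M) * e\<close> in \<open>c\<close> consists of
              \<open>e\<close> from freezing \<open>\<beta>\<close> and \<open>M * e\<close> from
              freezing \<open>\<alpha>\<close>.\<close>
            have le: "W (a + real j * h n) (q n j) \<bullet> \<alpha> i s \<le> c" if j: "j \<in> {\<kappa> n s..<\<kappa> n t}" for j
            proof -
              have jn: "j \<le> Suc n" using j \<kappa>(1)[OF tab, of n] by auto
              have k1: "h n * real (\<kappa> n s) \<le> h n * real j" "h n * real (Suc j) \<le> h n * real (\<kappa> n t)"
                using j h(1)[of n] by (auto intro!: mult_left_mono simp del: of_nat_Suc)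
              moreover have "h n * real (Suc j) = h n * real j + h n" by (simp add: algebra_simps)
              ultimately have j1: "s - a - h n \<le> h n * real j" "h n * real j \<le> t - a"
                using \<kappa>(2,3)[OF sab, of n] \<kappa>(2,3)[OF tab, of n] h(1)[of n] by linarith+
              then have dj: "dist (a + real j * h n) s < r" using elim t h(1)[of n]
                by (auto simp: dist_real_def abs_less_iff algebra_simps)
              have "norm (q n j - q n (\<kappa> n s)) \<le> M * (h n * (real j - real (\<kappa> n s)))"
                using j jn by (intro qlip) auto
              also have "\<dots> \<le> M * (r + h n)"
                using j1 t \<kappa>(2,3)[OF sab, of n] \<open>M \<ge> 0\<close> by (intro mult_left_mono) (auto simp: algebra_simps)
              also have "\<dots> \<le> d2 / 4 + d2 / 8"
              proof -
                have "M * h n \<le> (M + 1) * (d2 / (8 * (M + 1)))" using elim \<open>M \<ge> 0\<close> h(1)[of n] by (intro mult_mono) auto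
                also have "\<dots> = d2 / 8"
                  using \<open>M \<ge> 0\<close> nonzero_mult_div_cancel_left[of "M + 1" "d2 / 8"] by (simp add: mult.commute)
                finally show ?thesis using Mr by (simp add: distrib_left)
              qed
              finally have "dist (q n j) (P s) < d2 / 2"
                using elim(2) dist_triangle[of "q n j" "P s" "q n (\<kappa> n s)"] by (simp add: dist_norm)
              moreover have "dist (a + real j * h n, q n j) (s, P s) \<le> dist (a + real j * h n) s + dist (q n j) (P s)"
                unfolding dist_Pair_Pair by (rule sqrt_sum_squares_le_sum) auto
              ultimately have "dist (a + real j * h n, q n j) (s, P s) < d2" using dj r by linarith
              then have b1: "\<beta> i (a + real j * h n) (q n j) < \<beta> i s (P s) + e"
                using d2(2)[OF node[OF jn]] by (force simp: dist_real_def)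
              have "W (a + real j * h n) (q n j) \<bullet> (\<alpha> i s - \<alpha> i (a + real j * h n))
                  \<le> norm (W (a + real j * h n) (q n j)) * norm (\<alpha> i s - \<alpha> i (a + real j * h n))"
                by (rule norm_cauchy_schwarz)
              also have "\<dots> \<le> M * e"
                using d1(2)[OF node[OF jn]] dj r(2) WM[OF jn] \<open>M \<ge> 0\<close>
                by (intro mult_mono) (auto simp: dist_norm norm_minus_commute)
              finally show ?thesis
                using W_le[OF i node[OF jn], of "q n j"] b1 by (simp add: c_def inner_diff_right algebra_simps)
            qed
            have "(q n (\<kappa> n t) - q n (\<kappa> n s)) \<bullet> \<alpha> i s
                = (\<Sum>j=\<kappa> n s..<\<kappa> n t. h n * (W (a + real j * h n) (q n j) \<bullet> \<alpha> i s))"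
              using mono\<kappa>[of s t n] t by (simp add: q_sum inner_sum_left)
            also have "\<dots> \<le> (\<Sum>j=\<kappa> n s..<\<kappa> n t. h n * c)"
              using le h(1)[of n] by (intro sum_mono mult_left_mono) auto
            also have "\<dots> = (h n * real (\<kappa> n t) - h n * real (\<kappa> n s)) * c"
              using mono\<kappa>[of s t n] t by (simp add: of_nat_diff algebra_simps)
            finally show ?case .
          qed
        qed
      qed (use r in simp)
    qed
    then show "v \<bullet> \<alpha> i s \<le> \<beta> i s (P s)"
      by (rule le_if_le_add_small[OF zero_less_one])
  qed
qed

section \<open>Gronwall estimates\<close>

text \<open>Project the curve onto its own increment \<open>e\<close>, so that the scalar
  monotonicity principle applies.\<close>

lemma absolutely_continuous_on_imp_lipschitz:
  fixes f :: "real \<Rightarrow> 'a::real_inner"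
  assumes ac: "absolutely_continuous_on {a..b} f" and N: "negligible N" and "M \<ge> 0"
    and deriv: "\<And>s. s \<in> {a<..<b} - N \<Longrightarrow> \<exists>v. (f has_vector_derivative v) (at s) \<and> norm v \<le> M"
  shows "M-lipschitz_on {a..b} f"
proof (rule lipschitz_on_leI)
  fix s t assume st: "s \<in> {a..b}" "t \<in> {a..b}" "s \<le> t"
  define e where "e = f t - f s"
  have "f t \<bullet> e - M * norm e * t \<le> f s \<bullet> e - M * norm e * s"
  proof (rule absolutely_continuous_decreasing[OF _ \<open>s \<le> t\<close> N])
    show "absolutely_continuous_on {s..t} (\<lambda>r. f r \<bullet> e - M * norm e * r)"
    proof (rule absolutely_continuous_on_dominated)
      show "absolutely_continuous_on {s..t} f"
        using ac by (rule absolutely_continuous_on_subset) (use st in auto)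
      fix r u assume ru: "r \<in> {s..t}" "u \<in> {s..t}" "r \<le> u"
      have "norm (f u \<bullet> e - M * norm e * u - (f r \<bullet> e - M * norm e * r))
          \<le> \<bar>(f u - f r) \<bullet> e\<bar> + \<bar>M * norm e * (u - r)\<bar>"
        by (simp add: inner_diff_left right_diff_distrib)
      also have "\<dots> \<le> norm e * norm (f u - f r) + M * norm e * (u - r)"
        using Cauchy_Schwarz_ineq2[of "f u - f r" e] ru \<open>M \<ge> 0\<close> by (simp add: mult.commute)
      also have "\<dots> \<le> (norm e + M * norm e) * norm (f u - f r) + (norm e + M * norm e) * (u - r)"
        using ru \<open>M \<ge> 0\<close> by (intro add_mono mult_right_mono) auto
      finally show "norm (f u \<bullet> e - M * norm e * u - (f r \<bullet> e - M * norm e * r))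
          \<le> (norm e + M * norm e) * norm (f u - f r) + (norm e + M * norm e) * (u - r)" .
    qed
    fix r assume r: "r \<in> {s<..<t} - N"
    then obtain v where v: "(f has_vector_derivative v) (at r)" "norm v \<le> M"
      using deriv[of r] st by auto
    have "((\<lambda>r. f r \<bullet> e - M * norm e * r) has_real_derivative v \<bullet> e - M * norm e) (at r)"
      unfolding has_real_derivative_iff_has_vector_derivative
      using bounded_linear.has_vector_derivative[OF bounded_linear_inner_left v(1)]
      by (auto intro!: derivative_eq_intros)
    moreover have "v \<bullet> e - M * norm e \<le> 0"
      using norm_cauchy_schwarz[of v e] mult_right_mono[OF v(2) norm_ge_zero[of e]] by linarith
    ultimately show "\<exists>d\<le>0. ((\<lambda>r. f r \<bullet> e - M * norm e * r) has_real_derivative d) (at r)" by blast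
  qed
  then have "norm e * norm e \<le> norm e * (M * (t - s))"
    by (simp add: e_def inner_diff_left power2_norm_eq_inner[symmetric] power2_eq_square[symmetric])
      (simp add: power2_norm_eq_inner inner_diff_left algebra_simps)
  then have "norm e \<le> M * (t - s)"
    using st \<open>M \<ge> 0\<close> by (cases "e = 0") auto
  then show "dist (f s) (f t) \<le> M * dist s t"
    using st by (simp add: e_def dist_norm norm_minus_commute)
qed fact

lemma lipschitz_on_inner_compact:
  fixes f g :: "'c::metric_space \<Rightarrow> 'a::real_inner"
  assumes "compact S" and f: "A-lipschitz_on S f" and g: "B-lipschitz_on S g"
  obtains C where "C-lipschitz_on S (\<lambda>t. f t \<bullet> g t)"
proof -
  have "bounded (f ` S)" "bounded (g ` S)"
    using f g lipschitz_on_continuous_on \<open>compact S\<close> by (blast intro: compact_imp_bounded compact_continuous_image)+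
  then obtain F G where F: "\<And>s. s \<in> S \<Longrightarrow> norm (f s) \<le> F" and G: "\<And>s. s \<in> S \<Longrightarrow> norm (g s) \<le> G"
    by (auto simp: bounded_iff)
  have AB: "A \<ge> 0" "B \<ge> 0" using f g lipschitz_on_nonneg by blast+
  have "(A * \<bar>G\<bar> + \<bar>F\<bar> * B)-lipschitz_on S (\<lambda>t. f t \<bullet> g t)"
  proof (rule lipschitz_onI)
    fix s t assume st: "s \<in> S" "t \<in> S"
    have "dist (f s \<bullet> g s) (f t \<bullet> g t) = \<bar>(f s - f t) \<bullet> g s + f t \<bullet> (g s - g t)\<bar>"
      by (simp add: dist_real_def inner_diff_left inner_diff_right)
    also have "\<dots> \<le> norm (f s - f t) * norm (g s) + norm (f t) * norm (g s - g t)"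
      using Cauchy_Schwarz_ineq2[of "f s - f t" "g s"] Cauchy_Schwarz_ineq2[of "f t" "g s - g t"] by linarith
    also have "\<dots> \<le> (A * dist s t) * \<bar>G\<bar> + \<bar>F\<bar> * (B * dist s t)"
      using lipschitz_onD[OF f st] lipschitz_onD[OF g st] F[OF st(2)] G[OF st(1)] AB
      by (intro add_mono mult_mono) (auto simp: dist_norm)
    finally show "dist (f s \<bullet> g s) (f t \<bullet> g t) \<le> (A * \<bar>G\<bar> + \<bar>F\<bar> * B) * dist s t"
      by (simp add: algebra_simps)
  qed (use AB in auto)
  then show thesis by (rule that)
qed

lemma lipschitz_gronwall:
  fixes D G :: "real \<Rightarrow> real"
  assumes D: "K-lipschitz_on {a..b} D" and G: "L-lipschitz_on {a..b} G" and N: "negligible N"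
    and "a \<le> b" "0 \<le> A" "0 \<le> B"
    and deriv: "\<And>s. s \<in> {a<..<b} - N \<Longrightarrow> \<exists>d g. (D has_real_derivative d) (at s) \<and>
      (G has_real_derivative g) (at s) \<and> 0 \<le> g \<and> d \<le> A * D s + B * g"
  shows "D b \<le> exp (A * (b - a)) * (D a + B * (G b - G a))"
proof -
  let ?e = "\<lambda>t. exp (- A * (t - a))"
  have "A-lipschitz_on {a..b} ?e"
  proof (rule bounded_derivative_imp_lipschitz)
    show "(?e has_derivative (\<lambda>h. h * (- A * ?e t))) (at t within {a..b})" if "t \<in> {a..b}" for t
      by (auto intro!: derivative_eq_intros)
    show "onorm (\<lambda>h. h * (- A * ?e t)) \<le> A" if "t \<in> {a..b}" for t
    proof (rule onorm_le)
      fix h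
      have "\<bar>h\<bar> * A * ?e t \<le> \<bar>h\<bar> * A * 1" using that \<open>0 \<le> A\<close> by (intro mult_left_mono) auto
      then show "norm (h * (- A * ?e t)) \<le> A * norm h" using \<open>0 \<le> A\<close> by (simp add: abs_mult mult_ac)
    qed
  qed (use \<open>0 \<le> A\<close> in auto)
  then obtain C where C: "C-lipschitz_on {a..b} (\<lambda>t. ?e t \<bullet> D t)"
    using lipschitz_on_inner_compact[OF compact_Icc _ D] by blast
  have "?e b * D b - B * G b \<le> ?e a * D a - B * G a"
  proof (rule absolutely_continuous_decreasing[OF _ \<open>a \<le> b\<close> N])
    have "(C + B * L)-lipschitz_on {a..b} (\<lambda>t. ?e t * D t - B * G t)"
      using C G \<open>0 \<le> B\<close> by (intro lipschitz_on_diff lipschitz_on_cmult_real_nonneg) (auto simp: inner_real_def)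
    then show "absolutely_continuous_on {a..b} (\<lambda>t. ?e t * D t - B * G t)"
      by (rule lipschitz_imp_absolutely_continuous_on)
    fix s assume s: "s \<in> {a<..<b} - N"
    then obtain d g where d: "(D has_real_derivative d) (at s)" "(G has_real_derivative g) (at s)"
      "0 \<le> g" "d \<le> A * D s + B * g" using deriv by blast
    have der: "((\<lambda>t. ?e t * D t - B * G t) has_real_derivative ?e s * (d - A * D s) - B * g) (at s)"
      by (auto intro!: derivative_eq_intros d(1,2) simp: algebra_simps)
    have "?e s * (d - A * D s) \<le> ?e s * (B * g)" using d(4) by (intro mult_left_mono) auto
    moreover have "?e s * (B * g) \<le> 1 * (B * g)"
      using s d(3) \<open>0 \<le> A\<close> \<open>0 \<le> B\<close> by (intro mult_right_mono) auto
    ultimately have "?e s * (d - A * D s) - B * g \<le> 0" by linarith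
    with der show "\<exists>d\<le>0. ((\<lambda>t. ?e t * D t - B * G t) has_real_derivative d) (at s)" by blast
  qed
  then have "?e b * D b \<le> D a + B * (G b - G a)" by (simp add: algebra_simps)
  then have "exp (A * (b - a)) * (?e b * D b) \<le> exp (A * (b - a)) * (D a + B * (G b - G a))"
    by (intro mult_left_mono) auto
  moreover have "exp (A * (b - a)) * (?e b * D b) = D b"
    using exp_minus_inverse[of "A * (b - a)"] by (simp add: mult.assoc[symmetric])
  ultimately show ?thesis by (simp only:)
qed

text \<open>
  The modified function \<open>G t = g t + c * S * (t - b)\<close>, where \<open>S\<close> is the maximum of \<open>D\<close>, is increasing and
  bounds \<open>D\<close> by \<open>C * \<delta> * G T\<close>; on a short window this forces \<open>G T \<le> 0\<close>.
\<close>
lemma window_estimate: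
  fixes D g n :: "real \<Rightarrow> real"
  assumes D: "K-lipschitz_on {b..T} D" and g: "L-lipschitz_on {b..T} g" and N: "negligible N"
    and ba: "b \<le> a" "a \<le> T" "a \<le> b + \<delta>" and pos: "0 < \<delta>" "0 \<le> A" "0 < \<kappa>" "0 \<le> c" "0 \<le> c'"
    and D_nonneg: "\<And>s. s \<in> {b..T} \<Longrightarrow> 0 \<le> D s" and "D b = 0" "g b = 0"
    and deriv: "\<And>s. s \<in> {b<..<T} - N \<Longrightarrow> \<exists>d g'. (D has_real_derivative d) (at s) \<and>
      (g has_real_derivative g') (at s) \<and> d \<le> A * D s + 2 * sqrt (D s) * n s \<and> \<kappa> * (n s)\<^sup>2 - c * D s \<le> g'"
    and n: "\<And>s. s \<in> {b<..<T} - N \<Longrightarrow> a < s \<Longrightarrow> n s = 0"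
    and end_le: "g T \<le> c' * D T"
    and small: "(c * (T - b) + c') * (exp (A * (T - b) + 1) / \<kappa> * \<delta>) < 1"
    and t: "t \<in> {b..T}"
  shows "D t = 0"
proof -
  have "continuous_on {b..T} D" using D by (rule lipschitz_on_continuous_on)
  moreover have "{b..T} \<noteq> {}" using t by auto
  ultimately obtain m where m: "m \<in> {b..T}" "\<And>s. s \<in> {b..T} \<Longrightarrow> D s \<le> D m"
    using continuous_attains_sup[of "{b..T}" D] compact_Icc by blast
  define S where "S = D m"
  have "S \<ge> 0" using D_nonneg m by (simp add: S_def)
  define G where "G = (\<lambda>t. g t + c * S * (t - b))"
  have G: "(L + c * S)-lipschitz_on {b..T} G"
    unfolding G_def
  proof (rule lipschitz_on_add[OF g], rule lipschitz_onI)
    fix s t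
    show "dist (c * S * (s - b)) (c * S * (t - b)) \<le> c * S * dist s t"
      using \<open>S \<ge> 0\<close> \<open>0 \<le> c\<close> by (simp add: dist_real_def right_diff_distrib[symmetric] abs_mult)
  qed (use \<open>S \<ge> 0\<close> \<open>0 \<le> c\<close> in simp)
  have Gb: "G b = 0" using \<open>g b = 0\<close> by (simp add: G_def)
  have Gd: "\<exists>d G'. (D has_real_derivative d) (at s) \<and> (G has_real_derivative G') (at s) \<and>
      d \<le> A * D s + 2 * sqrt (D s) * n s \<and> \<kappa> * (n s)\<^sup>2 \<le> G'" if s: "s \<in> {b<..<T} - N" for s
  proof -
    obtain d g' where d: "(D has_real_derivative d) (at s)" "(g has_real_derivative g') (at s)"
      "d \<le> A * D s + 2 * sqrt (D s) * n s" "\<kappa> * (n s)\<^sup>2 - c * D s \<le> g'" using deriv[OF s] by blast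
    have "(G has_real_derivative g' + c * S) (at s)"
      unfolding G_def by (auto intro!: derivative_eq_intros d(2))
    moreover have "c * D s \<le> c * S" using m(2)[of s] s \<open>0 \<le> c\<close> by (auto simp: S_def intro!: mult_left_mono)
    ultimately show ?thesis using d by (intro exI[of _ d] exI[of _ "g' + c * S"]) auto
  qed
  have sub: "{u..v} \<subseteq> {b..T}" if "b \<le> u" "v \<le> T" for u v using that by auto
  have mono: "G u \<le> G v" if uv: "b \<le> u" "u \<le> v" "v \<le> T" for u v
  proof -
    have "- G v \<le> - G u"
    proof (rule absolutely_continuous_decreasing[OF _ uv(2) N])
      show "absolutely_continuous_on {u..v} (\<lambda>t. - G t)"
        using lipschitz_on_subset[OF G sub] uv by (intro lipschitz_imp_absolutely_continuous_on) auto
      fix s assume "s \<in> {u<..<v} - N"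
      then obtain d G' where "(G has_real_derivative G') (at s)" "\<kappa> * (n s)\<^sup>2 \<le> G'"
        using Gd[of s] uv by auto
      moreover have "0 \<le> \<kappa> * (n s)\<^sup>2" using \<open>0 < \<kappa>\<close> by simp
      ultimately show "\<exists>d\<le>0. ((\<lambda>t. - G t) has_real_derivative d) (at s)"
        by (intro exI[of _ "- G'"]) (auto intro: DERIV_minus)
    qed
    then show ?thesis by simp
  qed
  have window: "D s \<le> exp (A * (s - b) + 1) * (\<delta> / \<kappa> * G s)" if s: "b \<le> s" "s \<le> a" for s
  proof -
    \<comment> \<open>Young's inequality with weight \<open>\<delta>\<close> splits the mixed term
      into \<open>D r / \<delta> + \<delta> * (n r)\<^sup>2\<close>. The extra rate
      \<open>1 / \<delta>\<close> acts for a time at most \<open>\<delta>\<close> and costs only a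
      factor \<open>exp 1\<close>, while the defect acquires the small factor
      \<open>\<delta>\<close>.\<close>
    have "D s \<le> exp ((A + 1 / \<delta>) * (s - b)) * (D b + \<delta> / \<kappa> * (G s - G b))"
    proof (rule lipschitz_gronwall[OF lipschitz_on_subset[OF D sub] lipschitz_on_subset[OF G sub] N])
      fix r assume "r \<in> {b<..<s} - N"
      then have r: "r \<in> {b<..<T} - N" using s ba by auto
      obtain d G' where d: "(D has_real_derivative d) (at r)" "(G has_real_derivative G') (at r)"
        "d \<le> A * D r + 2 * sqrt (D r) * n r" "\<kappa> * (n r)\<^sup>2 \<le> G'" using Gd[OF r] by blast
      have "0 \<le> (sqrt (D r) - \<delta> * n r)\<^sup>2 / \<delta>" using pos by simp
      also have "\<dots> = D r / \<delta> - 2 * sqrt (D r) * n r + \<delta> * (n r)\<^sup>2"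
        using pos D_nonneg[of r] r by (simp add: power2_diff field_simps power2_eq_square)
      also have "\<delta> * (n r)\<^sup>2 \<le> \<delta> / \<kappa> * G'"
        using mult_left_mono[OF d(4), of "\<delta> / \<kappa>"] pos by simp
      finally have "d \<le> (A + 1 / \<delta>) * D r + \<delta> / \<kappa> * G'" using d(3) by (simp add: algebra_simps)
      moreover have "0 \<le> G'" using d(4) pos zero_le_power2[of "n r"] by (meson mult_nonneg_nonneg order_trans less_imp_le)
      ultimately show "\<exists>d g. (D has_real_derivative d) (at r) \<and> (G has_real_derivative g) (at r) \<and> 0 \<le> g \<and>
          d \<le> (A + 1 / \<delta>) * D r + \<delta> / \<kappa> * g" using d by blast
    qed (use s ba pos in auto)
    also have "\<dots> \<le> exp (A * (s - b) + 1) * (\<delta> / \<kappa> * G s)"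
    proof -
      have "0 \<le> G s" using mono[of b s] Gb s ba by simp
      moreover have "(A + 1 / \<delta>) * (s - b) \<le> A * (s - b) + 1" using s ba pos by (simp add: field_simps)
      ultimately show ?thesis using pos Gb \<open>D b = 0\<close> by (intro mult_mono) auto
    qed
    finally show ?thesis .
  qed
  have bound: "D s \<le> exp (A * (T - b) + 1) / \<kappa> * \<delta> * G T" if s: "s \<in> {b..T}" for s
  proof -
    have "D s \<le> exp (A * (s - b) + 1) * (\<delta> / \<kappa> * G s)"
    proof (cases "s \<le> a")
      case True
      then show ?thesis using window s by simp
    next
      case False
      have "D s \<le> exp (A * (s - a)) * (D a + 0 * (G s - G a))"
      proof (rule lipschitz_gronwall[OF lipschitz_on_subset[OF D sub] lipschitz_on_subset[OF G sub] N])
        fix r assume "r \<in> {a<..<s} - N"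
        then have r: "r \<in> {b<..<T} - N" "a < r" using s ba by auto
        obtain d G' where d: "(D has_real_derivative d) (at r)" "(G has_real_derivative G') (at r)"
          "d \<le> A * D r + 2 * sqrt (D r) * n r" "\<kappa> * (n r)\<^sup>2 \<le> G'" using Gd[OF r(1)] by blast
        then show "\<exists>d g. (D has_real_derivative d) (at r) \<and> (G has_real_derivative g) (at r) \<and> 0 \<le> g \<and>
          d \<le> A * D r + 0 * g" using n[OF r] by (intro exI[of _ d] exI[of _ G']) auto
      qed (use s ba False pos in auto)
      also have "\<dots> \<le> exp (A * (s - a)) * (exp (A * (a - b) + 1) * (\<delta> / \<kappa> * G a))"
        using mult_left_mono[OF window[of a], of "exp (A * (s - a))"] ba by simp
      also have "\<dots> = exp (A * (s - b) + 1) * (\<delta> / \<kappa> * G a)"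
      proof -
        have "A * (s - b) + 1 = A * (s - a) + (A * (a - b) + 1)" by (simp add: algebra_simps)
        then show ?thesis by (simp only: exp_add mult.assoc)
      qed
      also have "\<dots> \<le> exp (A * (s - b) + 1) * (\<delta> / \<kappa> * G s)"
        using mono[of a s] False s ba pos by (intro mult_left_mono) auto
      finally show ?thesis .
    qed
    also have "\<dots> \<le> exp (A * (T - b) + 1) * (\<delta> / \<kappa> * G T)"
      using mono[of s T] mono[of b s] s Gb pos by (intro mult_mono) (auto intro!: mult_left_mono)
    finally show ?thesis by (simp add: algebra_simps)
  qed
  define C where "C = exp (A * (T - b) + 1) / \<kappa> * \<delta>"
  have "b \<le> T" using ba by simp
  \<comment> \<open>Here the loop closes: \<open>D\<close> is bounded by \<open>C * G T\<close>, and
    \<open>G T\<close> by a multiple of \<open>D\<close>; \<open>small\<close> says that the product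
    of the two factors is below 1.\<close>
  have "S \<le> C * G T" using bound[OF m(1)] by (simp add: S_def C_def)
  have "G T \<le> c' * D T + c * S * (T - b)" using end_le by (simp add: G_def)
  also have "\<dots> \<le> c' * (C * G T) + c * (C * G T) * (T - b)"
    using \<open>S \<le> C * G T\<close> bound[of T] \<open>b \<le> T\<close> pos
    by (intro add_mono mult_left_mono mult_right_mono) (auto simp: C_def)
  also have "\<dots> = ((c * (T - b) + c') * C) * G T" by (simp add: algebra_simps)
  finally have "(1 - (c * (T - b) + c') * C) * G T \<le> 0" by (simp add: algebra_simps)
  then have "G T \<le> 0" using small by (simp add: C_def mult_le_0_iff)
  moreover have "0 \<le> C" using pos by (simp add: C_def)
  ultimately have "C * G T \<le> 0" by (simp add: mult_nonneg_nonpos)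
  then show ?thesis using bound[OF t] D_nonneg[OF t] by (simp add: C_def)
qed

text \<open>Gronwall's inequality applied to \<open>f t \<bullet> f t\<close>, with zero initial
  value and no forcing.\<close>

lemma lipschitz_vanishes_forward:
  fixes f :: "real \<Rightarrow> 'a::real_inner"
  assumes f: "K-lipschitz_on {a..b} f" and N: "negligible N" and "a \<le> b" "0 \<le> L"
    and deriv: "\<And>s. s \<in> {a<..<b} - N \<Longrightarrow> \<exists>v. (f has_vector_derivative v) (at s) \<and> norm v \<le> L * norm (f s)"
    and "f a = 0"
  shows "f b = 0"
proof -
  obtain C where C: "C-lipschitz_on {a..b} (\<lambda>t. f t \<bullet> f t)"
    using lipschitz_on_inner_compact[OF compact_Icc f f] .
  have "f b \<bullet> f b \<le> exp (2 * L * (b - a)) * (f a \<bullet> f a + 0 * (0 - 0))"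
  proof (rule lipschitz_gronwall[OF C lipschitz_on_constant N \<open>a \<le> b\<close>])
    fix s assume "s \<in> {a<..<b} - N"
    then obtain v where v: "(f has_vector_derivative v) (at s)" "norm v \<le> L * norm (f s)"
      using deriv by blast
    have "((\<lambda>t. f t \<bullet> f t) has_derivative (\<lambda>h. f s \<bullet> (h *\<^sub>R v) + (h *\<^sub>R v) \<bullet> f s)) (at s)"
      using v(1) unfolding has_vector_derivative_def by (intro has_derivative_inner)
    moreover have "(\<lambda>h. f s \<bullet> (h *\<^sub>R v) + (h *\<^sub>R v) \<bullet> f s) = (*) (2 * (f s \<bullet> v))"
      by (auto simp: inner_commute algebra_simps)
    ultimately have "((\<lambda>t. f t \<bullet> f t) has_real_derivative 2 * (f s \<bullet> v)) (at s)"
      by (simp add: has_field_derivative_def)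
    moreover have "f s \<bullet> v \<le> L * (f s \<bullet> f s)"
      using norm_cauchy_schwarz[of "f s" v] mult_left_mono[OF v(2) norm_ge_zero[of "f s"]]
      by (simp add: power2_norm_eq_inner[symmetric] power2_eq_square algebra_simps)
    ultimately show "\<exists>d g. ((\<lambda>t. f t \<bullet> f t) has_real_derivative d) (at s) \<and>
        ((\<lambda>_. 0) has_real_derivative g) (at s) \<and> 0 \<le> g \<and> d \<le> 2 * L * (f s \<bullet> f s) + 0 * g"
      by (intro exI[of _ "2 * (f s \<bullet> v)"] exI[of _ 0]) auto
  qed (use \<open>0 \<le> L\<close> in auto)
  then have "f b \<bullet> f b \<le> 0" using \<open>f a = 0\<close> by simp
  then show ?thesis by (metis inner_ge_zero inner_eq_zero_iff antisym)
qed

lemma lipschitz_vanishes_backward: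
  fixes f :: "real \<Rightarrow> 'a::real_inner"
  assumes f: "K-lipschitz_on {a..b} f" and N: "negligible N" and "a \<le> b" "0 \<le> L"
    and deriv: "\<And>s. s \<in> {a<..<b} - N \<Longrightarrow> \<exists>v. (f has_vector_derivative v) (at s) \<and> norm v \<le> L * norm (f s)"
    and "f b = 0"
  shows "f a = 0"
proof -
  have "f (- (- a)) = 0"
  proof (rule lipschitz_vanishes_forward[of K "- b" "- a" "\<lambda>t. f (- t)" "uminus ` N" L])
    show "K-lipschitz_on {- b..- a} (\<lambda>t. f (- t))"
      using lipschitz_onD[OF f] lipschitz_on_nonneg[OF f]
      by (intro lipschitz_onI) (auto simp: dist_real_def abs_minus_commute add.commute, smt (verit, best))
    show "negligible (uminus ` N)"
      using N by (rule negligible_differentiable_image_negligible[rotated]) (auto intro!: derivative_intros)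
    fix s assume s: "s \<in> {- b<..<- a} - uminus ` N"
    then have "- s \<in> {a<..<b} - N" by (force simp: image_iff)
    then obtain v where v: "(f has_vector_derivative v) (at (- s))" "norm v \<le> L * norm (f (- s))"
      using deriv by blast
    have "((f \<circ> uminus) has_vector_derivative (- 1) *\<^sub>R v) (at s)"
      using v(1) by (intro vector_diff_chain_at) (auto intro!: derivative_eq_intros)
    then show "\<exists>v. ((\<lambda>t. f (- t)) has_vector_derivative v) (at s) \<and> norm v \<le> L * norm (f (- s))"
      using v(2) by (intro exI[of _ "- v"]) (simp add: o_def)
  qed (use assms in auto)
  then show ?thesis by simp
qed

text \<open>The difference between \<open>f\<close> and the integral of \<open>h\<close> has zero
  derivative almost everywhere and is therefore constant. This upgrades an equation valid almost
  everywhere to one valid at every time, with one-sided derivatives at the ends.\<close>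

lemma lipschitz_continuous_derivative:
  fixes f h :: "real \<Rightarrow> 'a::euclidean_space"
  assumes f: "K-lipschitz_on {a..b} f" and h: "continuous_on {a..b} h" and N: "negligible N"
    and deriv: "\<And>s. s \<in> {a<..<b} - N \<Longrightarrow> (f has_vector_derivative h s) (at s)"
    and t: "t \<in> {a..b}"
  shows "(f has_vector_derivative h t) (at t within {a..b})"
proof -
  define z where "z = (\<lambda>u. f a + integral {a..u} h)"
  have z: "(z has_vector_derivative h u) (at u within {a..b})" if "u \<in> {a..b}" for u
    unfolding z_def using integral_has_vector_derivative[OF h that]
    by (auto intro!: derivative_eq_intros)
  obtain B where B: "\<And>s. s \<in> {a..b} \<Longrightarrow> norm (h s) \<le> B"
    using compact_imp_bounded[OF compact_continuous_image[OF h compact_Icc]] unfolding bounded_iff by blast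
  have "(\<bar>B\<bar>)-lipschitz_on {a..b} z"
  proof (rule bounded_derivative_imp_lipschitz)
    show "(z has_derivative (\<lambda>r. r *\<^sub>R h u)) (at u within {a..b})" if "u \<in> {a..b}" for u
      using z[OF that] by (simp add: has_vector_derivative_def)
    show "onorm (\<lambda>r. r *\<^sub>R h u) \<le> \<bar>B\<bar>" if "u \<in> {a..b}" for u
    proof (rule onorm_le)
      fix r :: real
      have "\<bar>r\<bar> * norm (h u) \<le> \<bar>r\<bar> * \<bar>B\<bar>" using B[OF that] by (intro mult_left_mono) auto
      then show "norm (r *\<^sub>R h u) \<le> \<bar>B\<bar> * norm r" by (simp add: mult.commute)
    qed
  qed auto
  then have "absolutely_continuous_on {a..b} (\<lambda>u. f u - z u)"
    using f by (blast intro: lipschitz_imp_absolutely_continuous_on lipschitz_on_diff)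
  then have "0-lipschitz_on {a..b} (\<lambda>u. f u - z u)"
  proof (rule absolutely_continuous_on_imp_lipschitz[OF _ N])
    fix s assume s: "s \<in> {a<..<b} - N"
    then have "(z has_vector_derivative h s) (at s)"
      using z[of s] by (simp add: at_within_Icc_at)
    then have "((\<lambda>u. f u - z u) has_vector_derivative h s - h s) (at s)"
      using deriv[OF s] by (intro has_vector_derivative_diff)
    then show "\<exists>v. ((\<lambda>u. f u - z u) has_vector_derivative v) (at s) \<and> norm v \<le> 0" by auto
  qed simp
  then have const: "f u - z u = f a - z a" if "u \<in> {a..b}" for u
    using lipschitz_onD[of 0 "{a..b}" "\<lambda>u. f u - z u" u a] that by (simp add: dist_norm)
  have eq: "f u = z u" if "u \<in> {a..b}" for u
    using const[OF that] by (simp add: z_def)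
  show ?thesis by (rule has_vector_derivative_transform[OF t eq z[OF t]])
qed

section \<open>Adjoint arcs and optimal trajectories\<close>

text \<open>The uniform constants that the hypotheses yield on one compact convex set. The factor
  \<open>norm p\<close> in the bounds on \<open>hamiltonian F y p\<close> reflects its positive
  homogeneity in \<open>p\<close>; \<open>Z y p\<close> depends only on the direction of
  \<open>p\<close>, so its Lipschitz constant is controlled only for \<open>p\<close> in compact
  sets avoiding 0.\<close>

locale strongly_convex_hamiltonian =
  fixes F :: "'a::euclidean_space \<Rightarrow> 'a set" and K :: "'a set" and Z :: "'a \<Rightarrow> 'a \<Rightarrow> 'a"
    and L M c R :: real
  assumes compact_K: "compact K" and convex_K: "convex K" and nonempty_K: "K \<noteq> {}"
    and F_nonempty: "F y \<noteq> {}" and F_compact: "compact (F y)"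
    and F_bound: "\<And>v. y \<in> K \<Longrightarrow> v \<in> F y \<Longrightarrow> norm v \<le> M"
    and H_lipschitz: "(L * norm p)-lipschitz_on K (\<lambda>y. hamiltonian F y p)"
    and nonneg: "0 \<le> L" "0 \<le> M" "0 \<le> c"
    and H_semiconvex: "semiconvex_on K (c * norm p) (\<lambda>y. hamiltonian F y p)"
    and H_gradient: "y \<in> K \<Longrightarrow> p \<noteq> 0 \<Longrightarrow> GDERIV (hamiltonian F y) p :> Z y p"
    and Z_lipschitz: "compact P \<Longrightarrow> 0 \<notin> P \<Longrightarrow> \<exists>l. \<forall>p\<in>P. l-lipschitz_on K (\<lambda>y. Z y p)"
    and R_pos: "R > 0" and R_convex: "y \<in> K \<Longrightarrow> R_convex R (F y)"
begin

section \<open>Regularity of the Hamiltonian and its maximizer on \<open>K\<close>\<close>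

abbreviation "H \<equiv> hamiltonian F"

lemma H_diff: "y \<in> K \<Longrightarrow> z \<in> K \<Longrightarrow> \<bar>H y p - H z p\<bar> \<le> L * norm p * norm (y - z)"
  using lipschitz_onD[OF H_lipschitz, of y z p] by (simp add: dist_norm)

lemma inner_le_H: "v \<in> F y \<Longrightarrow> v \<bullet> p \<le> H y p"
  by (rule inner_le_hamiltonian[of F, OF F_compact])

lemma Z_maximizes:
  assumes "y \<in> K" "p \<noteq> 0"
  shows "Z y p \<in> F y" "H y p = Z y p \<bullet> p"
proof -
  obtain v where v: "v \<in> F y" "H y p = v \<bullet> p" using hamiltonian_attained[of F y p, OF F_compact F_nonempty] .
  moreover have "v = Z y p" using hamiltonian_maximizer_eq_gradient[of F y v p, OF F_compact v H_gradient[OF assms]] .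
  ultimately show "Z y p \<in> F y" "H y p = Z y p \<bullet> p" by simp_all
qed

lemma norm_Z_le: "y \<in> K \<Longrightarrow> p \<noteq> 0 \<Longrightarrow> norm (Z y p) \<le> M"
  using F_bound Z_maximizes(1) by blast

lemma H_le_add:
  assumes "y \<in> K"
  shows "H y p \<le> H y q + M * norm (p - q)"
proof -
  obtain v where v: "v \<in> F y" "H y p = v \<bullet> p" using hamiltonian_attained[of F y p, OF F_compact F_nonempty] .
  have "v \<bullet> p = v \<bullet> q + v \<bullet> (p - q)" by (simp add: inner_diff_right)
  also have "\<dots> \<le> H y q + norm v * norm (p - q)"
    using inner_le_H[OF v(1)] by (intro add_mono norm_cauchy_schwarz)
  also have "\<dots> \<le> H y q + M * norm (p - q)"
    using F_bound[OF assms v(1)] by (intro add_left_mono mult_right_mono) auto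
  finally show ?thesis using v(2) by simp
qed

lemma continuous_on_H:
  assumes "continuous_on S f" "f ` S \<subseteq> K" "continuous_on S g"
  shows "continuous_on S (\<lambda>x. H (f x) (g x))"
  unfolding continuous_on_def
proof (rule ballI)
  fix x assume x: "x \<in> S"
  have f: "(f \<longlongrightarrow> f x) (at x within S)" and g: "(g \<longlongrightarrow> g x) (at x within S)"
    using assms x by (auto simp: continuous_on_def)
  show "((\<lambda>x. H (f x) (g x)) \<longlongrightarrow> H (f x) (g x)) (at x within S)"
  proof (rule LIM_zero_cancel, rule Lim_null_comparison)
    show "\<forall>\<^sub>F z in at x within S. norm (H (f z) (g z) - H (f x) (g x)) \<le>
        L * norm (g x) * norm (f z - f x) + M * norm (g z - g x)"
      unfolding eventually_at_filter
    proof (intro always_eventually allI impI)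
      fix z assume "z \<in> S"
      then have "f z \<in> K" "f x \<in> K" using assms(2) x by auto
      then show "norm (H (f z) (g z) - H (f x) (g x)) \<le> L * norm (g x) * norm (f z - f x) + M * norm (g z - g x)"
        using H_diff[of "f z" "f x" "g x"] H_le_add[of "f z" "g z" "g x"] H_le_add[of "f z" "g x" "g z"]
        by (simp add: norm_minus_commute[of "g x" "g z"])
    qed
    have "((\<lambda>z. L * norm (g x) * norm (f z - f x) + M * norm (g z - g x)) \<longlongrightarrow>
        L * norm (g x) * norm (f x - f x) + M * norm (g x - g x)) (at x within S)"
      by (intro tendsto_intros f g)
    then show "((\<lambda>z. L * norm (g x) * norm (f z - f x) + M * norm (g z - g x)) \<longlongrightarrow> 0) (at x within S)"
      by simp
  qed
qed

text \<open>Regularity in \<open>y\<close> is part of the locale, but continuity in \<open>p\<close>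
  is not: it comes from \<open>R\<close>-convexity, which makes the maximizer a Lipschitz function
  of the unit vector in the direction of \<open>p\<close>.\<close>

lemma continuous_on_Z:
  assumes "continuous_on S f" "f ` S \<subseteq> K" "continuous_on S g" "g ` S \<subseteq> S'" "0 \<notin> S'" "compact S'"
  shows "continuous_on S (\<lambda>x. Z (f x) (g x))"
  unfolding continuous_on_def
proof (rule ballI)
  fix x assume x: "x \<in> S"
  obtain l where l: "\<And>p. p \<in> S' \<Longrightarrow> l-lipschitz_on K (\<lambda>y. Z y p)" using Z_lipschitz[OF assms(6,5)] by blast
  have f: "(f \<longlongrightarrow> f x) (at x within S)" and g: "(g \<longlongrightarrow> g x) (at x within S)"
    using assms x by (auto simp: continuous_on_def)
  have gx: "g x \<noteq> 0" using assms(4,5) x by auto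
  show "((\<lambda>x. Z (f x) (g x)) \<longlongrightarrow> Z (f x) (g x)) (at x within S)"
  proof (rule LIM_zero_cancel, rule Lim_null_comparison)
    show "\<forall>\<^sub>F z in at x within S. norm (Z (f z) (g z) - Z (f x) (g x)) \<le>
        l * norm (f z - f x) + R * norm (g z /\<^sub>R norm (g z) - g x /\<^sub>R norm (g x))"
      unfolding eventually_at_filter
    proof (intro always_eventually allI impI)
      fix z assume "z \<in> S"
      then have z: "f z \<in> K" "f x \<in> K" "g z \<in> S'" "g x \<in> S'" using assms(2,4) x by blast+
      then have gz: "g z \<noteq> 0" using assms(5) by auto
      have "norm (Z (f z) (g z) - Z (f x) (g z)) \<le> l * norm (f z - f x)"
        using lipschitz_onD[OF l[OF z(3)] z(1,2)] by (simp add: dist_norm)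
      moreover have "norm (Z (f x) (g z) - Z (f x) (g x)) \<le> R * norm (g z /\<^sub>R norm (g z) - g x /\<^sub>R norm (g x))"
      proof (rule R_convex_maximizers[OF R_convex[OF z(2)] Z_maximizes(1)[OF z(2) gz] Z_maximizes(1)[OF z(2) gx]])
        fix v assume v: "v \<in> F (f x)"
        show "v \<bullet> (g z /\<^sub>R norm (g z)) \<le> Z (f x) (g z) \<bullet> (g z /\<^sub>R norm (g z))"
          using inner_le_H[OF v, of "g z"] Z_maximizes(2)[OF z(2) gz] by (simp add: mult_left_mono)
        show "v \<bullet> (g x /\<^sub>R norm (g x)) \<le> Z (f x) (g x) \<bullet> (g x /\<^sub>R norm (g x))"
          using inner_le_H[OF v, of "g x"] Z_maximizes(2)[OF z(2) gx] by (simp add: mult_left_mono)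
      qed (use gz gx in auto)
      ultimately show "norm (Z (f z) (g z) - Z (f x) (g x)) \<le>
          l * norm (f z - f x) + R * norm (g z /\<^sub>R norm (g z) - g x /\<^sub>R norm (g x))"
        using norm_triangle_ineq[of "Z (f z) (g z) - Z (f x) (g z)" "Z (f x) (g z) - Z (f x) (g x)"] by simp
    qed
    have "((\<lambda>z. l * norm (f z - f x) + R * norm (g z /\<^sub>R norm (g z) - g x /\<^sub>R norm (g x))) \<longlongrightarrow>
        l * norm (f x - f x) + R * norm (g x /\<^sub>R norm (g x) - g x /\<^sub>R norm (g x))) (at x within S)"
      using gx by (intro tendsto_intros f g) auto
    then show "((\<lambda>z. l * norm (f z - f x) + R * norm (g z /\<^sub>R norm (g z) - g x /\<^sub>R norm (g x))) \<longlongrightarrow> 0) (at x within S)"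
      by simp
  qed
qed

lemma quadratic_gap:
  assumes "y \<in> K" "p \<noteq> 0" "v \<in> F y" "2 * M \<le> 16 * R"
  shows "norm p * (norm (Z y p - v))\<^sup>2 / (32 * R) \<le> H y p - v \<bullet> p"
proof -
  have "norm (v - Z y p) \<le> 16 * R"
    using norm_triangle_ineq4[of v "Z y p"] F_bound[OF assms(1,3)] norm_Z_le[OF assms(1,2)] assms(4) by linarith
  then have "norm p * (norm (v - Z y p))\<^sup>2 / (32 * R) \<le> (Z y p - v) \<bullet> p"
    using assms Z_maximizes[OF assms(1,2)] inner_le_H[of _ y p]
    by (intro R_convex_quadratic_gap[OF R_convex[OF assms(1)] R_pos]) auto
  then show ?thesis using Z_maximizes(2)[OF assms(1,2)] by (simp add: inner_diff_left norm_minus_commute)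
qed

lemma subgradient_le:
  assumes "w \<in> frechet_subdifferential (\<lambda>y. H y p) x" "x \<in> K" "y \<in> K"
  shows "w \<bullet> (y - x) \<le> H y p - H x p + c * norm p / 2 * (norm (y - x))\<^sup>2"
  using semiconvex_on_frechet_bound[OF H_semiconvex _ convex_K assms(2,3,1)] nonneg by (simp add: algebra_simps)

lemma subgradient_norm_le:
  assumes "w \<in> frechet_subdifferential (\<lambda>y. H y p) x" "x \<in> interior K"
  shows "norm w \<le> L * norm p"
proof (rule proximal_subgradient_norm_le[OF assms(2), where u = "\<lambda>y. H y p" and c = "c * norm p / 2"])
  have x: "x \<in> K" using assms(2) interior_subset by blast
  show "H x p + w \<bullet> (y - x) - c * norm p / 2 * (norm (y - x))\<^sup>2 \<le> H y p" if "y \<in> K" for y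
    using subgradient_le[OF assms(1) x that] by simp
  show "H y p - H x p \<le> L * norm p * norm (y - x)" if "y \<in> K" for y
    using H_diff[OF that x, of p] by simp
qed (use nonneg in simp)

lemma proximal_subgradient_exists:
  assumes "x \<in> interior K"
  shows "\<exists>w. norm w \<le> L * norm p \<and> (\<forall>y\<in>K. w \<bullet> (y - x) \<le> H y p - H x p + c * norm p / 2 * (norm (y - x))\<^sup>2)"
proof -
  have x: "x \<in> K" using assms interior_subset by blast
  obtain w where w: "\<forall>y\<in>K. H x p + w \<bullet> (y - x) - c * norm p / 2 * (norm (y - x))\<^sup>2 \<le> H y p"
    using semiconvex_proximal_subgradient_exists[OF H_semiconvex _ convex_K compact_K assms H_lipschitz] nonneg by auto
  have "norm w \<le> L * norm p"
    using w nonneg H_diff[OF _ x, of _ p]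
    by (intro proximal_subgradient_norm_le[OF assms, where u = "\<lambda>y. H y p" and c = "c * norm p / 2"])
       (auto simp: abs_le_iff)
  then show ?thesis using w by (intro exI[of _ w]) (auto simp: algebra_simps)
qed

section \<open>Existence and nonvanishing of adjoint arcs\<close>

text \<open>The condition is imposed at the final time, so the inclusion is solved for
  \<open>P s = p (- s)\<close>, which also removes the minus sign from the derivative. The selection
  \<open>W\<close> of proximal subgradients is arbitrary; what survives the limit is the family of
  subgradient inequalities, one for each \<open>y\<close> in \<open>K\<close>, and these
  characterize the derivative as a subgradient.\<close>

lemma adjoint_exists:
  assumes "t0 < T" and x: "continuous_on {t0..T} x" "x ` {t0..T} \<subseteq> interior K"
  shows "\<exists>p. adjoint_solution F T t0 x q p"
proof -
  define \<beta> where "\<beta> = (\<lambda>y s p. H y p - H (x (- s)) p + c * norm p / 2 * (norm (y - x (- s)))\<^sup>2)"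
  have xi: "x (- s) \<in> interior K" if "s \<in> {- T..- t0}" for s using that x(2) by auto
  then have "\<forall>s p. \<exists>w. s \<in> {- T..- t0} \<longrightarrow> norm w \<le> L * norm p \<and> (\<forall>y\<in>K. w \<bullet> (y - x (- s)) \<le> \<beta> y s p)"
    unfolding \<beta>_def using proximal_subgradient_exists by blast
  then obtain W where W: "\<And>s p. s \<in> {- T..- t0} \<Longrightarrow> norm (W s p) \<le> L * norm p"
    "\<And>s p y. s \<in> {- T..- t0} \<Longrightarrow> y \<in> K \<Longrightarrow> W s p \<bullet> (y - x (- s)) \<le> \<beta> y s p" by metis
  have cx: "continuous_on {- T..- t0} (\<lambda>s. x (- s))"
    by (rule continuous_on_compose2[OF x(1)]) (auto intro!: continuous_intros)
  have cx2: "continuous_on ({- T..- t0} \<times> UNIV) (\<lambda>z::real \<times> 'a. x (- fst z))"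
    by (rule continuous_on_compose2[OF cx]) (auto intro!: continuous_intros)
  obtain P B where P: "P (- T) = - q" "B-lipschitz_on {- T..- t0} P"
    "\<And>s v y. s \<in> {- T<..<- t0} \<Longrightarrow> (P has_vector_derivative v) (at s) \<Longrightarrow> y \<in> K \<Longrightarrow>
       v \<bullet> (y - x (- s)) \<le> \<beta> y s (P s)"
  proof (rule differential_inclusion_exists[of "- T" "- t0" L W K "\<lambda>y s. y - x (- s)" \<beta> "- q"])
    show "norm (W s p) \<le> L * (1 + norm p)" if "s \<in> {- T..- t0}" for s p
      using W(1)[OF that, of p] nonneg by (simp add: distrib_left)
    show "continuous_on ({- T..- t0} \<times> UNIV) (\<lambda>(s, p). \<beta> y s p)" if "y \<in> K" for y
      unfolding \<beta>_def split_def using xi interior_subset that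
      by (intro continuous_intros continuous_on_H cx2) fastforce+
    show "continuous_on {- T..- t0} (\<lambda>s. y - x (- s))" for y
      by (intro continuous_intros cx)
  qed (use W assms nonneg in auto)
  define p where "p = (\<lambda>t. P (- t))"
  have p: "B-lipschitz_on {t0..T} p"
  proof (rule lipschitz_onI)
    fix s t assume "s \<in> {t0..T}" "t \<in> {t0..T}"
    then show "dist (p s) (p t) \<le> B * dist s t"
      using lipschitz_onD[OF P(2), of "- s" "- t"] by (auto simp: p_def dist_real_def abs_minus_commute)
  qed (rule lipschitz_on_nonneg[OF P(2)])
  obtain N where N: "negligible N" "\<And>t. t \<in> {t0<..<T} - N \<Longrightarrow> \<exists>v. (p has_vector_derivative v) (at t)"
    using lipschitz_ae_differentiable[OF p] by blast
  have "adjoint_solution F T t0 x q p"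
    unfolding adjoint_solution_def
  proof (intro conjI)
    show "absolutely_continuous_on {t0..T} p" using p by (rule lipschitz_imp_absolutely_continuous_on)
    show "- p T = q" using P(1) by (simp add: p_def)
    show "AE s in lebesgue_on {t0..T}. \<exists>w. (p has_vector_derivative w) (at s within {t0..T}) \<and>
        - w \<in> frechet_subdifferential (\<lambda>y. H y (p s)) (x s)"
      unfolding AE_lebesgue_on_iff_negligible[OF fmeasurableD[OF lmeasurable_interval(1)]]
    proof (intro exI[of _ "N \<union> {t0, T}"] conjI ballI)
      show "negligible (N \<union> {t0, T})" using N(1) by auto
      fix s assume "s \<in> {t0..T} - (N \<union> {t0, T})"
      then have s: "s \<in> {t0<..<T} - N" by auto
      obtain v where v: "(p has_vector_derivative v) (at s)" using N(2)[OF s] by blast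
      have "((p \<circ> uminus) has_vector_derivative (- 1) *\<^sub>R v) (at (- s))"
        using v by (intro vector_diff_chain_at) (auto intro!: derivative_eq_intros)
      then have "(P has_vector_derivative - v) (at (- s))" by (simp add: p_def o_def)
      then have "- v \<bullet> (y - x s) \<le> \<beta> y (- s) (p s)" if "y \<in> K" for y
        using P(3)[of "- s" "- v" y] s that by (simp add: p_def)
      then have le: "H (x s) (p s) + - v \<bullet> (y - x s) - c * norm (p s) / 2 * (norm (y - x s))\<^sup>2 \<le> H y (p s)" if "y \<in> K" for y
        using that by (fastforce simp: \<beta>_def)
      have "x s \<in> interior K" using xi[of "- s"] s by auto
      then have "- v \<in> frechet_subdifferential (\<lambda>y. H y (p s)) (x s)"
        using le by (rule frechet_subdifferentialI)
      then show "\<exists>w. (p has_vector_derivative w) (at s within {t0..T}) \<and>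
          - w \<in> frechet_subdifferential (\<lambda>y. H y (p s)) (x s)"
        using v has_vector_derivative_at_within by blast
    qed
  qed
  then show ?thesis by blast
qed

text \<open>An arbitrary solution is only known to be absolutely continuous, hence bounded. The
  bound \<open>L * norm (p s)\<close> on subgradients then bounds its derivative and makes it
  Lipschitz.\<close>

lemma adjoint_solution_lipschitz:
  assumes p: "adjoint_solution F T t0 x q p" and x: "x ` {t0..T} \<subseteq> interior K"
  obtains N B where "negligible N" "B-lipschitz_on {t0..T} p"
    "\<And>s. s \<in> {t0<..<T} - N \<Longrightarrow> \<exists>w. (p has_vector_derivative - w) (at s) \<and> norm w \<le> L * norm (p s) \<and>
       (\<forall>y\<in>K. w \<bullet> (y - x s) \<le> H y (p s) - H (x s) (p s) + c * norm (p s) / 2 * (norm (y - x s))\<^sup>2)"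
proof -
  have ac: "absolutely_continuous_on {t0..T} p" using p by (simp add: adjoint_solution_def)
  obtain N where N: "negligible N" "\<And>s. s \<in> {t0..T} - N \<Longrightarrow> \<exists>w. (p has_vector_derivative w) (at s within {t0..T}) \<and>
        - w \<in> frechet_subdifferential (\<lambda>y. H y (p s)) (x s)"
    using p unfolding adjoint_solution_def AE_lebesgue_on_iff_negligible[OF fmeasurableD[OF lmeasurable_interval(1)]] by blast
  have d: "\<exists>w. (p has_vector_derivative - w) (at s) \<and> norm w \<le> L * norm (p s) \<and>
       (\<forall>y\<in>K. w \<bullet> (y - x s) \<le> H y (p s) - H (x s) (p s) + c * norm (p s) / 2 * (norm (y - x s))\<^sup>2)"
    if s: "s \<in> {t0<..<T} - N" for s
  proof -
    obtain w where w: "(p has_vector_derivative w) (at s within {t0..T})"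
        "- w \<in> frechet_subdifferential (\<lambda>y. H y (p s)) (x s)" using N(2)[of s] s by auto
    have xs: "x s \<in> interior K" using x s by auto
    then have "x s \<in> K" using interior_subset by blast
    then show ?thesis
      using w(1) s subgradient_norm_le[OF w(2) xs] subgradient_le[OF w(2)]
      by (intro exI[of _ "- w"]) (auto simp: at_within_Icc_at)
  qed
  obtain b where b: "\<And>s. s \<in> {t0..T} \<Longrightarrow> norm (p s) \<le> b"
    using compact_imp_bounded[OF compact_continuous_image[OF absolutely_continuous_on_imp_continuous_on[OF ac] compact_Icc]] unfolding bounded_iff by blast
  have "(L * \<bar>b\<bar>)-lipschitz_on {t0..T} p"
  proof (rule absolutely_continuous_on_imp_lipschitz[OF ac N(1)])
    fix s assume s: "s \<in> {t0<..<T} - N"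
    then have "L * norm (p s) \<le> L * \<bar>b\<bar>" using b[of s] nonneg by (intro mult_left_mono) auto
    then show "\<exists>v. (p has_vector_derivative v) (at s) \<and> norm v \<le> L * \<bar>b\<bar>"
      using d[OF s] by (metis norm_minus_cancel order_trans)
  qed (use nonneg in simp)
  then show thesis using that N(1) d by blast
qed

text \<open>The derivative is bounded by \<open>L * norm (p s)\<close>, so a zero at one time
  propagates forwards and backwards. For \<open>q\<close> different from 0 the maximizer is thus
  available along the whole arc.\<close>

lemma adjoint_solution_zero_iff:
  assumes p: "adjoint_solution F T t0 x q p" and x: "x ` {t0..T} \<subseteq> interior K" and t: "t \<in> {t0..T}"
  shows "p t = 0 \<longleftrightarrow> q = 0"
proof -
  obtain N B where N: "negligible N" "B-lipschitz_on {t0..T} p"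
    "\<And>s. s \<in> {t0<..<T} - N \<Longrightarrow> \<exists>w. (p has_vector_derivative - w) (at s) \<and> norm w \<le> L * norm (p s) \<and>
       (\<forall>y\<in>K. w \<bullet> (y - x s) \<le> H y (p s) - H (x s) (p s) + c * norm (p s) / 2 * (norm (y - x s))\<^sup>2)"
    using adjoint_solution_lipschitz[OF p x] by blast
  have lip: "B-lipschitz_on {t..T} p" using N(2) t by (auto intro: lipschitz_on_subset)
  have d: "\<exists>v. (p has_vector_derivative v) (at s) \<and> norm v \<le> L * norm (p s)" if "s \<in> {t<..<T} - N" for s
    using N(3)[of s] that t by (metis DiffD1 DiffD2 DiffI atLeastAtMost_iff greaterThanLessThan_iff norm_minus_cancel order_le_less_trans)
  have "t \<le> T" using t by simp
  have "- p T = q" using p by (simp add: adjoint_solution_def)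
  then have "p T = 0 \<longleftrightarrow> q = 0" by auto
  then show ?thesis
    using lipschitz_vanishes_forward[OF lip N(1) \<open>t \<le> T\<close> nonneg(1) d]
      lipschitz_vanishes_backward[OF lip N(1) \<open>t \<le> T\<close> nonneg(1) d] by blast
qed

section \<open>Comparison curves\<close>

text \<open>
  The projection onto \<open>K\<close> makes the right-hand side global; it is inactive as long as \<open>y\<close> stays in \<open>K\<close>.
\<close>
lemma optimal_flow_exists:
  assumes "b < T" and p: "continuous_on {b..T} p" "0 \<notin> p ` {b..T}"
  obtains y where "y b = x0" "M-lipschitz_on {b..T} y"
    "\<And>t. t \<in> {b..T} \<Longrightarrow> (y has_vector_derivative Z (closest_point K (y t)) (p t)) (at t within {b..T})"
proof -
  have cK: "closed K" using compact_K by (rule compact_imp_closed)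
  have \<pi>: "closest_point K v \<in> K" for v using closest_point_in_set[OF cK nonempty_K] .
  have c\<pi>: "continuous_on S (closest_point K)" for S
    by (rule continuous_on_closest_point[OF convex_K cK nonempty_K])
  have cp: "continuous_on ({b..T} \<times> UNIV) (\<lambda>z::real \<times> 'a. p (fst z))"
    by (rule continuous_on_compose2[OF p(1)]) (auto intro!: continuous_intros)
  have cpt: "compact (p ` {b..T})" by (rule compact_continuous_image[OF p(1) compact_Icc])
  have nz: "p s \<noteq> 0" if "s \<in> {b..T}" for s using p(2) that by (metis image_eqI)
  have cZ: "continuous_on ({b..T} \<times> UNIV) (\<lambda>z. Z (closest_point K (snd z)) (p (fst z)))"
    by (rule continuous_on_Z[OF continuous_on_compose2[OF c\<pi> continuous_on_snd[OF continuous_on_id]] _ cp _ p(2) cpt])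
       (use \<pi> in auto)
  \<comment> \<open>Using every vector \<open>e\<close> as a test direction, with equality on the
    right, turns the inclusion into a differential equation.\<close>
  obtain y B where y: "y b = x0" "B-lipschitz_on {b..T} y"
    "\<And>s v e. s \<in> {b<..<T} \<Longrightarrow> (y has_vector_derivative v) (at s) \<Longrightarrow> e \<in> UNIV \<Longrightarrow>
       v \<bullet> e \<le> Z (closest_point K (y s)) (p s) \<bullet> e"
  proof (rule differential_inclusion_exists[of b T M "\<lambda>s v. Z (closest_point K v) (p s)" UNIV "\<lambda>e s. e"
        "\<lambda>e s v. Z (closest_point K v) (p s) \<bullet> e" x0])
    show "norm (Z (closest_point K v) (p s)) \<le> M * (1 + norm v)" if "s \<in> {b..T}" for s v
      using norm_Z_le[OF \<pi> nz[OF that], of v] nonneg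
      by (meson le_add_same_cancel1 mult_left_le_one_le norm_ge_zero order_trans mult_le_cancel_left1 linorder_not_less)
    show "continuous_on ({b..T} \<times> UNIV) (\<lambda>(s, v). Z (closest_point K v) (p s) \<bullet> e)" for e
      unfolding split_def by (intro continuous_intros cZ)
  qed (use assms nonneg in auto)
  obtain N where N: "negligible N" "\<And>t. t \<in> {b<..<T} - N \<Longrightarrow> \<exists>v. (y has_vector_derivative v) (at t)"
    using lipschitz_ae_differentiable[OF y(2)] by blast
  have d: "(y has_vector_derivative Z (closest_point K (y s)) (p s)) (at s)" if s: "s \<in> {b<..<T} - N" for s
  proof -
    obtain v where v: "(y has_vector_derivative v) (at s)" using N(2)[OF s] by blast
    define u where "u = v - Z (closest_point K (y s)) (p s)"
    have "u \<bullet> u \<le> 0" using y(3)[OF _ v, of u] s by (simp add: u_def inner_diff_left)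
    then have "u = 0" by (metis inner_ge_zero inner_eq_zero_iff antisym)
    then show ?thesis using v by (simp add: u_def)
  qed
  have "continuous_on {b..T} (\<lambda>s. (s, y s))"
    using lipschitz_on_continuous_on[OF y(2)] by (intro continuous_intros)
  from continuous_on_compose2[OF cZ this]
  have cont: "continuous_on {b..T} (\<lambda>s. Z (closest_point K (y s)) (p s))" by auto
  have "M-lipschitz_on {b..T} y"
  proof (rule absolutely_continuous_on_imp_lipschitz[OF lipschitz_imp_absolutely_continuous_on[OF y(2)] N(1) nonneg(2)])
    fix s assume s: "s \<in> {b<..<T} - N"
    show "\<exists>v. (y has_vector_derivative v) (at s) \<and> norm v \<le> M"
      using d[OF s] norm_Z_le[OF \<pi> nz, of s "y s"] s by auto
  qed
  then show thesis
    using that[of y, OF y(1)] lipschitz_continuous_derivative[OF y(2) cont N(1) d] by blast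
qed

end

lemma trajectory_concat:
  assumes x: "trajectory F T t0 x0 x" "B-lipschitz_on {t0..T} x" and y: "B-lipschitz_on {b..T} y" "y b = x b"
    and b: "t0 \<le> b" "b < T"
    and y_deriv: "\<And>s. s \<in> {b<..<T} \<Longrightarrow> \<exists>v\<in>F (y s). (y has_vector_derivative v) (at s)"
  shows "trajectory F T t0 x0 (\<lambda>t. if t \<le> b then x t else y t)"
  unfolding trajectory_def
proof (intro conjI)
  let ?z = "\<lambda>t. if t \<le> b then x t else y t"
  have "B-lipschitz_on {t0..b} x" using x(2) by (rule lipschitz_on_subset) (use b in auto)
  then have "B-lipschitz_on {t0..T} ?z" using y by (intro lipschitz_on_concat) auto
  then show "absolutely_continuous_on {t0..T} ?z" by (rule lipschitz_imp_absolutely_continuous_on)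
  show "?z t0 = x0" using x b by (simp add: trajectory_def)
  obtain N where N: "negligible N" "\<And>s. s \<in> {t0..T} - N \<Longrightarrow>
      \<exists>v. (x has_vector_derivative v) (at s within {t0..T}) \<and> v \<in> F (x s)"
    using x(1) unfolding trajectory_def AE_lebesgue_on_iff_negligible[OF fmeasurableD[OF lmeasurable_interval(1)]] by blast
  show "AE s in lebesgue_on {t0..T}. \<exists>v. (?z has_vector_derivative v) (at s within {t0..T}) \<and> v \<in> F (?z s)"
    unfolding AE_lebesgue_on_iff_negligible[OF fmeasurableD[OF lmeasurable_interval(1)]]
  proof (intro exI[of _ "N \<union> {t0, b, T}"] conjI ballI)
    show "negligible (N \<union> {t0, b, T})" using N(1) by auto
    fix s assume s: "s \<in> {t0..T} - (N \<union> {t0, b, T})"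
    have "\<exists>v. (?z has_vector_derivative v) (at s) \<and> v \<in> F (?z s)"
    proof (cases "s < b")
      case True
      obtain v where v: "(x has_vector_derivative v) (at s)" "v \<in> F (x s)"
        using N(2)[of s] s by (auto simp: at_within_Icc_at)
      have "(?z has_vector_derivative v) (at s)"
        by (rule has_vector_derivative_transform_within_open[OF v(1), of "{..<b}"]) (use True in auto)
      then show ?thesis using v(2) True by auto
    next
      case False
      then have "s \<in> {b<..<T}" using s by auto
      then obtain v where v: "(y has_vector_derivative v) (at s)" "v \<in> F (y s)"
        using y_deriv by blast
      have "(?z has_vector_derivative v) (at s)"
        by (rule has_vector_derivative_transform_within_open[OF v(1), of "{b<..}"]) (use False s in auto)
      then show ?thesis using v(2) False s by auto
    qed
    then show "\<exists>v. (?z has_vector_derivative v) (at s within {t0..T}) \<and> v \<in> F (?z s)"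
      using has_vector_derivative_at_within by blast
  qed
qed

section \<open>Backward propagation of the equation for the optimal trajectory\<close>

context strongly_convex_hamiltonian
begin

lemma trajectory_lipschitz:
  assumes x: "trajectory F T t0 x0 x" "x ` {t0..T} \<subseteq> K"
  obtains N where "negligible N" "M-lipschitz_on {t0..T} x"
    "\<And>s. s \<in> {t0<..<T} - N \<Longrightarrow> \<exists>v\<in>F (x s). (x has_vector_derivative v) (at s)"
proof -
  obtain N where N: "negligible N" "\<And>s. s \<in> {t0..T} - N \<Longrightarrow>
      \<exists>v. (x has_vector_derivative v) (at s within {t0..T}) \<and> v \<in> F (x s)"
    using x(1) unfolding trajectory_def AE_lebesgue_on_iff_negligible[OF fmeasurableD[OF lmeasurable_interval(1)]] by blast
  have d: "\<exists>v\<in>F (x s). (x has_vector_derivative v) (at s)" if s: "s \<in> {t0<..<T} - N" for s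
    using N(2)[of s] s by (auto simp: at_within_Icc_at)
  have "M-lipschitz_on {t0..T} x"
  proof (rule absolutely_continuous_on_imp_lipschitz[OF _ N(1) nonneg(2)])
    show "absolutely_continuous_on {t0..T} x" using x(1) by (simp add: trajectory_def)
    fix s assume s: "s \<in> {t0<..<T} - N"
    then have "x s \<in> K" using x(2) by auto
    then show "\<exists>v. (x has_vector_derivative v) (at s) \<and> norm v \<le> M" using d[OF s] F_bound by blast
  qed
  then show thesis using that N(1) d by blast
qed

text \<open>One backward step: the equation, known after \<open>a\<close>, is extended to
  \<open>b\<close>, at most \<open>\<delta>\<close> earlier. The assumption \<open>opt\<close>
  condenses optimality and the proximal inequality. \<open>near\<close> confines the comparison
  curve to the tube, and \<open>small\<close> is the contraction condition of
  \<open>window_estimate\<close> with defect weight \<open>pmin / (32 * R)\<close> from the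
  quadratic gap and loss \<open>c * pmax / 2\<close> from semiconvexity.\<close>

lemma window_step:
  fixes x p :: "real \<Rightarrow> 'a"
  assumes MR: "2 * M \<le> 16 * R"
    and x: "M-lipschitz_on {b..T} x" and tube: "0 < r" "\<And>s. s \<in> {b..T} \<Longrightarrow> cball (x s) r \<subseteq> K"
    and p: "B-lipschitz_on {b..T} p" and p_bound: "0 < pmin" "\<And>s. s \<in> {b..T} \<Longrightarrow> pmin \<le> norm (p s)" "\<And>s. s \<in> {b..T} \<Longrightarrow> norm (p s) \<le> pmax"
    and l: "0 \<le> l" "\<And>s. s \<in> {b..T} \<Longrightarrow> l-lipschitz_on K (\<lambda>y. Z y (p s))"
    and N: "negligible N"
    and x_deriv: "\<And>s. s \<in> {b<..<T} - N \<Longrightarrow> \<exists>v\<in>F (x s). (x has_vector_derivative v) (at s)"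
    and p_deriv: "\<And>s. s \<in> {b<..<T} - N \<Longrightarrow> \<exists>w. (p has_vector_derivative - w) (at s) \<and>
       (\<forall>y\<in>K. w \<bullet> (y - x s) \<le> H y (p s) - H (x s) (p s) + c * norm (p s) / 2 * (norm (y - x s))\<^sup>2)"
    and ba: "b < T" "b \<le> a" "a \<le> T" "a \<le> b + \<delta>" and "0 < \<delta>"
    and after: "\<And>s. s \<in> {a<..<T} \<Longrightarrow> (x has_vector_derivative Z (x s) (p s)) (at s)"
    and opt: "\<And>y. M-lipschitz_on {b..T} y \<Longrightarrow> y b = x b \<Longrightarrow> norm (y T - x T) \<le> r \<Longrightarrow>
       (\<And>s. s \<in> {b<..<T} \<Longrightarrow> \<exists>v\<in>F (y s). (y has_vector_derivative v) (at s)) \<Longrightarrow>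
       p T \<bullet> (y T - x T) \<le> c' * (norm (y T - x T))\<^sup>2" and "0 \<le> c'"
    and near: "exp (2 * l * (T - b)) * (2 * M * \<delta>)\<^sup>2 \<le> r\<^sup>2"
    and small: "(c * pmax / 2 * (T - b) + c') * (exp (2 * l * (T - b) + 1) / (pmin / (32 * R)) * \<delta>) < 1"
    and t: "t \<in> {b..T}"
  shows "(x has_vector_derivative Z (x t) (p t)) (at t within {b..T})"
proof -
  have nz: "p s \<noteq> 0" if "s \<in> {b..T}" for s using p_bound(1) p_bound(2)[of s] that by auto
  have xK: "x s \<in> K" if "s \<in> {b..T}" for s using tube(2)[OF that] tube(1) by auto
  obtain y where y: "y b = x b" "M-lipschitz_on {b..T} y"
    "\<And>t. t \<in> {b..T} \<Longrightarrow> (y has_vector_derivative Z (closest_point K (y t)) (p t)) (at t within {b..T})"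
    using optimal_flow_exists[OF \<open>b < T\<close> lipschitz_on_continuous_on[OF p], of "x b"] nz by (metis (no_types, lifting) image_iff)
  define D where "D = (\<lambda>s. (y s - x s) \<bullet> (y s - x s))"
  define g where "g = (\<lambda>s. p s \<bullet> (y s - x s))"
  have D_norm: "D s = (norm (y s - x s))\<^sup>2" for s by (simp add: D_def power2_norm_eq_inner)
  have yx: "(M + M)-lipschitz_on {b..T} (\<lambda>s. y s - x s)" using y(2) x by (rule lipschitz_on_diff)
  obtain KD where KD: "KD-lipschitz_on {b..T} D"
    unfolding D_def using lipschitz_on_inner_compact[OF compact_Icc yx yx] .
  obtain Kg where Kg: "Kg-lipschitz_on {b..T} g"
    unfolding g_def using lipschitz_on_inner_compact[OF compact_Icc p yx] .
  have \<pi>: "closest_point K v \<in> K" for v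
    using closest_point_in_set[OF compact_imp_closed[OF compact_K] nonempty_K] .
  have Z_diff: "norm (Z (closest_point K (y s)) (p s) - Z (x s) (p s)) \<le> l * norm (y s - x s)" if s: "s \<in> {b..T}" for s
  proof -
    have "norm (Z (closest_point K (y s)) (p s) - Z (x s) (p s)) \<le> l * dist (closest_point K (y s)) (x s)"
      using lipschitz_onD[OF l(2)[OF s] \<pi> xK[OF s], of "y s"] by (simp add: dist_norm)
    also have "dist (closest_point K (y s)) (x s) \<le> dist (y s) (x s)"
      using closest_point_lipschitz[OF convex_K compact_imp_closed[OF compact_K] nonempty_K, of "y s" "x s"]
      by (simp add: closest_point_self[OF xK[OF s]])
    finally show ?thesis using l(1) by (simp add: dist_norm mult_left_mono)
  qed
  have D_deriv: "\<exists>d. (D has_real_derivative d) (at s) \<and> d \<le> 2 * l * D s + 2 * sqrt (D s) * norm (Z (x s) (p s) - v)"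
    if s: "s \<in> {b<..<T}" and v: "(x has_vector_derivative v) (at s)" for s v
  proof -
    define u where "u = Z (closest_point K (y s)) (p s) - v"
    have "(y has_vector_derivative Z (closest_point K (y s)) (p s)) (at s)"
      using y(3)[of s] s by (simp add: at_within_Icc_at)
    then have "((\<lambda>s. y s - x s) has_vector_derivative u) (at s)"
      unfolding u_def using v by (rule has_vector_derivative_diff)
    then have "(D has_derivative (\<lambda>h. (y s - x s) \<bullet> (h *\<^sub>R u) + (h *\<^sub>R u) \<bullet> (y s - x s))) (at s)"
      unfolding D_def has_vector_derivative_def by (intro has_derivative_inner)
    moreover have "(\<lambda>h. (y s - x s) \<bullet> (h *\<^sub>R u) + (h *\<^sub>R u) \<bullet> (y s - x s)) = (*) (2 * ((y s - x s) \<bullet> u))"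
      by (rule ext) (simp add: inner_commute)
    ultimately have "(D has_real_derivative 2 * ((y s - x s) \<bullet> u)) (at s)"
      by (simp add: has_field_derivative_def)
    moreover have "norm u \<le> l * norm (y s - x s) + norm (Z (x s) (p s) - v)"
      using norm_triangle_ineq[of "Z (closest_point K (y s)) (p s) - Z (x s) (p s)" "Z (x s) (p s) - v"] Z_diff[of s] s
      by (simp add: u_def)
    then have "norm (y s - x s) * norm u \<le> norm (y s - x s) * (l * norm (y s - x s) + norm (Z (x s) (p s) - v))"
      by (rule mult_left_mono) simp
    then have "2 * ((y s - x s) \<bullet> u) \<le> 2 * l * D s + 2 * sqrt (D s) * norm (Z (x s) (p s) - v)"
      using norm_cauchy_schwarz[of "y s - x s" u] by (simp add: D_norm power2_eq_square algebra_simps)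
    ultimately show ?thesis by blast
  qed
  \<comment> \<open>At this stage \<open>y\<close> is not known to stay in \<open>K\<close>, so the
    estimate is made for the projected field. On the window both curves have speed at most
    \<open>M\<close>; after \<open>a\<close> both follow the same field, because the projection is
    nonexpansive and fixes \<open>x s\<close>.\<close>
  have close: "norm (y s - x s) \<le> r" if s: "s \<in> {b..T}" for s
  proof -
    have early: "D s \<le> (2 * M * \<delta>)\<^sup>2" if "b \<le> s" "s \<le> a" for s
    proof -
      have "norm (y s - x s) \<le> (M + M) * (s - b)"
        using lipschitz_onD[OF yx, of s b] y(1) that ba by (simp add: dist_norm)
      also have "\<dots> \<le> (M + M) * \<delta>" using that ba nonneg by (intro mult_left_mono) auto
      finally show ?thesis unfolding D_norm by (intro power_mono) auto
    qed
    have "D s \<le> exp (2 * l * (T - b)) * (2 * M * \<delta>)\<^sup>2"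
    proof (cases "s \<le> a")
      case True
      have "1 * (2 * M * \<delta>)\<^sup>2 \<le> exp (2 * l * (T - b)) * (2 * M * \<delta>)\<^sup>2"
        using l ba by (intro mult_right_mono) auto
      then show ?thesis using early[of s] True s by auto
    next
      case False
      have "D s \<le> exp (2 * l * (s - a)) * (D a + 0 * (0 - 0))"
      proof (rule lipschitz_gronwall[OF lipschitz_on_subset[OF KD] lipschitz_on_constant negligible_empty])
        fix u assume "u \<in> {a<..<s} - {}"
        then have u: "u \<in> {b<..<T}" "u \<in> {a<..<T}" using s ba by auto
        obtain d where "(D has_real_derivative d) (at u)" "d \<le> 2 * l * D u"
          using D_deriv[OF u(1) after[OF u(2)]] by auto
        then show "\<exists>d g. (D has_real_derivative d) (at u) \<and> ((\<lambda>_. 0) has_real_derivative g) (at u) \<and>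
            0 \<le> g \<and> d \<le> 2 * l * D u + 0 * g"
          by (intro exI[of _ d] exI[of _ 0]) auto
      qed (use s ba l False in auto)
      also have "\<dots> \<le> exp (2 * l * (T - b)) * (2 * M * \<delta>)\<^sup>2"
        using early[of a] s ba l by (intro mult_mono) (auto intro!: mult_left_mono simp: D_norm)
      finally show ?thesis .
    qed
    then have "(norm (y s - x s))\<^sup>2 \<le> r\<^sup>2" using near by (simp add: D_norm)
    then show ?thesis using tube(1) by (simp add: power2_le_iff_abs_le)
  qed
  have yK: "y s \<in> K" if "s \<in> {b..T}" for s
    using close[OF that] tube(2)[OF that] by (auto simp: subset_iff dist_norm norm_minus_commute)
  have y': "(y has_vector_derivative Z (y s) (p s)) (at s within {b..T})" if "s \<in> {b..T}" for s
    using y(3)[OF that] closest_point_self[OF yK[OF that]] by simp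
  have end_le: "g T \<le> c' * D T"
    unfolding g_def D_norm
  proof (rule opt[OF y(2,1)])
    fix s assume s: "s \<in> {b<..<T}"
    then have "(y has_vector_derivative Z (y s) (p s)) (at s)"
      using y'[of s] by (simp add: at_within_Icc_at)
    then show "\<exists>v\<in>F (y s). (y has_vector_derivative v) (at s)"
      using Z_maximizes(1)[OF yK nz, of s s] s by auto
  qed (use close ba in auto)
  define n where "n = (\<lambda>s. norm (Z (x s) (p s) - vector_derivative x (at s)))"
  have "D s = 0" if "s \<in> {b..T}" for s
  proof (rule window_estimate[OF KD Kg N ba(2-4) \<open>0 < \<delta>\<close> _ _ _ \<open>0 \<le> c'\<close> _ _ _ _ _ end_le small that, where n = n])
    have "0 \<le> pmax" using p_bound(1) p_bound(2)[of b] p_bound(3)[of b] ba by auto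
    then show "0 \<le> c * pmax / 2" using nonneg by simp
    show "0 < pmin / (32 * R)" using p_bound R_pos by simp
    show "n s = 0" if "s \<in> {b<..<T} - N" "a < s" for s
      using vector_derivative_at[OF after[of s]] that by (simp add: n_def)
    fix s assume sN: "s \<in> {b<..<T} - N"
    then have s: "s \<in> {b<..<T}" "s \<in> {b..T}" by auto
    obtain v where v: "v \<in> F (x s)" "(x has_vector_derivative v) (at s)" using x_deriv[OF sN] by blast
    have n: "n s = norm (Z (x s) (p s) - v)" using vector_derivative_at[OF v(2)] by (simp add: n_def)
    obtain d where d: "(D has_real_derivative d) (at s)" "d \<le> 2 * l * D s + 2 * sqrt (D s) * n s"
      using D_deriv[OF s(1) v(2)] unfolding n by blast
    obtain w where w: "(p has_vector_derivative - w) (at s)"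
       "w \<bullet> (y s - x s) \<le> H (y s) (p s) - H (x s) (p s) + c * norm (p s) / 2 * (norm (y s - x s))\<^sup>2"
      using p_deriv[OF sN] yK[OF s(2)] by blast
    define u where "u = Z (y s) (p s) - v"
    have "(y has_vector_derivative Z (y s) (p s)) (at s)"
      using y'[of s] s by (simp add: at_within_Icc_at)
    then have "((\<lambda>s. y s - x s) has_vector_derivative u) (at s)"
      unfolding u_def using v(2) by (rule has_vector_derivative_diff)
    then have "(g has_derivative (\<lambda>h. p s \<bullet> (h *\<^sub>R u) + (h *\<^sub>R - w) \<bullet> (y s - x s))) (at s)"
      using w(1) unfolding g_def has_vector_derivative_def by (intro has_derivative_inner)
    moreover have "(\<lambda>h. p s \<bullet> (h *\<^sub>R u) + (h *\<^sub>R - w) \<bullet> (y s - x s)) = (*) (p s \<bullet> u - w \<bullet> (y s - x s))"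
      by (rule ext) (simp add: algebra_simps)
    ultimately have g': "(g has_real_derivative p s \<bullet> u - w \<bullet> (y s - x s)) (at s)"
      by (simp add: has_field_derivative_def)
    \<comment> \<open>Since \<open>Z (y s) (p s)\<close> is a maximizer,
      \<open>H (y s) (p s)\<close> appears here and cancels against the same term in the subgradient
      inequality for \<open>w\<close>. What remains is the gap
      \<open>H (x s) (p s) - v \<bullet> p s\<close>, which strong convexity bounds below by the
      squared defect.\<close>
    have "p s \<bullet> u = H (y s) (p s) - v \<bullet> p s"
      using Z_maximizes(2)[OF yK nz, of s s] s by (simp add: u_def inner_diff_right inner_commute)
    then have "H (x s) (p s) - v \<bullet> p s - c * norm (p s) / 2 * D s \<le> p s \<bullet> u - w \<bullet> (y s - x s)"
      using w(2) by (simp add: D_norm)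
    moreover have "norm (p s) * (n s)\<^sup>2 / (32 * R) \<le> H (x s) (p s) - v \<bullet> p s"
      unfolding n by (rule quadratic_gap[OF xK[OF s(2)] nz[OF s(2)] v(1) MR])
    moreover have "pmin * (n s)\<^sup>2 / (32 * R) \<le> norm (p s) * (n s)\<^sup>2 / (32 * R)"
      using p_bound(2)[OF s(2)] R_pos by (intro divide_right_mono mult_right_mono) auto
    moreover have "c * norm (p s) / 2 * D s \<le> c * pmax / 2 * D s"
      using p_bound(3)[OF s(2)] nonneg by (intro mult_right_mono divide_right_mono mult_left_mono) (auto simp: D_norm)
    ultimately have "pmin / (32 * R) * (n s)\<^sup>2 - c * pmax / 2 * D s \<le> p s \<bullet> u - w \<bullet> (y s - x s)"
      by simp
    then show "\<exists>d g'. (D has_real_derivative d) (at s) \<and> (g has_real_derivative g') (at s) \<and>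
        d \<le> 2 * l * D s + 2 * sqrt (D s) * n s \<and> pmin / (32 * R) * (n s)\<^sup>2 - c * pmax / 2 * D s \<le> g'"
      using d g' by blast
  qed (use l y(1) in \<open>auto simp: D_def g_def\<close>)
  then have eq: "y s = x s" if "s \<in> {b..T}" for s using that by (simp add: D_norm)
  show ?thesis
    using has_vector_derivative_transform[OF t _ y'[OF t], of x] eq t by auto
qed

text \<open>The step length \<open>\<delta>\<close> is chosen once, from bounds valid on all of
  \<open>{t0..T}\<close>, so finitely many steps reach \<open>t0\<close>.\<close>

lemma optimal_trajectory_derivative:
  fixes x p :: "real \<Rightarrow> 'a"
  assumes "t0 < T" and MR: "2 * M \<le> 16 * R"
    and opt: "mayer_optimal F \<phi> T t0 x0 x" and tube: "0 < r" "\<And>s. s \<in> {t0..T} \<Longrightarrow> cball (x s) r \<subseteq> K"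
    and p: "adjoint_solution F T t0 x q p" and q: "q \<noteq> 0" "q \<in> proximal_superdifferential \<phi> (x T)"
    and t: "t \<in> {t0..T}"
  shows "(x has_vector_derivative Z (x t) (p t)) (at t within {t0..T})"
proof -
  have traj: "trajectory F T t0 x0 x" using opt by (simp add: mayer_optimal_def)
  have xi: "x ` {t0..T} \<subseteq> interior K"
  proof (rule image_subsetI)
    fix s assume "s \<in> {t0..T}"
    then show "x s \<in> interior K" using tube unfolding mem_interior_cball by blast
  qed
  then have xK: "x ` {t0..T} \<subseteq> K" using interior_subset by blast
  obtain N1 where N1: "negligible N1" "M-lipschitz_on {t0..T} x"
    "\<And>s. s \<in> {t0<..<T} - N1 \<Longrightarrow> \<exists>v\<in>F (x s). (x has_vector_derivative v) (at s)"
    by (fact trajectory_lipschitz[OF traj xK])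
  obtain N2 B where N2: "negligible N2" "B-lipschitz_on {t0..T} p"
    "\<And>s. s \<in> {t0<..<T} - N2 \<Longrightarrow> \<exists>w. (p has_vector_derivative - w) (at s) \<and> norm w \<le> L * norm (p s) \<and>
       (\<forall>y\<in>K. w \<bullet> (y - x s) \<le> H y (p s) - H (x s) (p s) + c * norm (p s) / 2 * (norm (y - x s))\<^sup>2)"
    using adjoint_solution_lipschitz[OF p xi] by blast
  have nz: "p s \<noteq> 0" if "s \<in> {t0..T}" for s using adjoint_solution_zero_iff[OF p xi that] q by simp
  have cp: "continuous_on {t0..T} p" using N2(2) by (rule lipschitz_on_continuous_on)
  have ne: "{t0..T} \<noteq> {}" using \<open>t0 < T\<close> by simp
  obtain s1 where s1: "s1 \<in> {t0..T}" "\<And>s. s \<in> {t0..T} \<Longrightarrow> norm (p s1) \<le> norm (p s)"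
    using continuous_attains_inf[OF compact_Icc ne continuous_on_norm[OF cp]] by blast
  obtain s2 where s2: "s2 \<in> {t0..T}" "\<And>s. s \<in> {t0..T} \<Longrightarrow> norm (p s) \<le> norm (p s2)"
    using continuous_attains_sup[OF compact_Icc ne continuous_on_norm[OF cp]] by blast
  define pmin where "pmin = norm (p s1)"
  define pmax where "pmax = norm (p s2)"
  have pmin: "0 < pmin" using nz[OF s1(1)] by (simp add: pmin_def)
  have "compact (p ` {t0..T})" "0 \<notin> p ` {t0..T}"
    using compact_continuous_image[OF cp compact_Icc] nz by (auto simp: image_iff)
  from Z_lipschitz[OF this] obtain l where l: "\<And>s. s \<in> {t0..T} \<Longrightarrow> l-lipschitz_on K (\<lambda>y. Z y (p s))" by blast
  have "0 \<le> l" using l[OF s1(1)] by (rule lipschitz_on_nonneg)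
  obtain c1 \<rho> where c1: "\<rho> > 0" "\<And>y. y \<in> cball (x T) \<rho> \<Longrightarrow> \<phi> y - \<phi> (x T) - q \<bullet> (y - x T) \<le> c1 * (norm (y - x T))\<^sup>2"
    using q(2) unfolding proximal_superdifferential_def by blast
  define r1 where "r1 = min r \<rho>"
  have r1: "0 < r1" "r1 \<le> r" "r1 \<le> \<rho>" using tube(1) c1(1) by (auto simp: r1_def)
  \<comment> \<open>\<open>A\<close> and \<open>E\<close> are the constants of
    \<open>window_step\<close> for the longest interval, \<open>b = t0\<close>; they dominate those
    for every later \<open>b\<close>.\<close>
  define A where "A = c * pmax / 2 * (T - t0) + \<bar>c1\<bar>"
  define E where "E = exp (2 * l * (T - t0) + 1) / (pmin / (32 * R))"
  have "((\<lambda>\<delta>. exp (2 * l * (T - t0)) * (2 * M * \<delta>)\<^sup>2) \<longlongrightarrow> exp (2 * l * (T - t0)) * (2 * M * 0)\<^sup>2) (at_right 0)"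
    "((\<lambda>\<delta>. A * (E * \<delta>)) \<longlongrightarrow> A * (E * 0)) (at_right 0)"
    by (intro tendsto_intros)+
  then have "\<forall>\<^sub>F \<delta> in at_right 0. exp (2 * l * (T - t0)) * (2 * M * \<delta>)\<^sup>2 < r1\<^sup>2"
    "\<forall>\<^sub>F \<delta> in at_right 0. A * (E * \<delta>) < 1"
    using r1(1) by (auto elim!: order_tendstoD(2))
  then have "\<forall>\<^sub>F \<delta> in at_right 0. exp (2 * l * (T - t0)) * (2 * M * \<delta>)\<^sup>2 < r1\<^sup>2 \<and> A * (E * \<delta>) < 1"
    by (rule eventually_conj)
  then obtain \<delta>0 where \<delta>0: "0 < \<delta>0" "\<And>\<delta>. 0 < \<delta> \<Longrightarrow> \<delta> < \<delta>0 \<Longrightarrow>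
      exp (2 * l * (T - t0)) * (2 * M * \<delta>)\<^sup>2 < r1\<^sup>2 \<and> A * (E * \<delta>) < 1"
    unfolding eventually_at_right_field by blast
  define \<delta> where "\<delta> = \<delta>0 / 2"
  have \<delta>: "0 < \<delta>" "exp (2 * l * (T - t0)) * (2 * M * \<delta>)\<^sup>2 \<le> r1\<^sup>2" "A * (E * \<delta>) < 1"
    using \<delta>0(1) \<delta>0(2)[of \<delta>] by (auto simp: \<delta>_def)
  have step: "(x has_vector_derivative Z (x t) (p t)) (at t within {b..T})"
    if b: "t0 \<le> b" "b < T" "b \<le> a" "a \<le> T" "a \<le> b + \<delta>" and t: "t \<in> {b..T}"
      and after: "\<And>s. s \<in> {a<..<T} \<Longrightarrow> (x has_vector_derivative Z (x s) (p s)) (at s)" for a b t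
  proof (rule window_step[OF MR, where r = r1 and B = B and pmin = pmin and pmax = pmax and l = l and
        N = "N1 \<union> N2" and a = a and \<delta> = \<delta> and c' = "\<bar>c1\<bar>"])
    have sub: "{b..T} \<subseteq> {t0..T}" using b by auto
    show "M-lipschitz_on {b..T} x" "B-lipschitz_on {b..T} p"
      using N1(2) N2(2) sub by (auto intro: lipschitz_on_subset)
    show "cball (x s) r1 \<subseteq> K" if "s \<in> {b..T}" for s
      using tube(2)[of s] that sub r1(2) by (meson order_trans subsetD subset_cball)
    show "negligible (N1 \<union> N2)" using N1(1) N2(1) by (rule negligible_Un)
    show "\<exists>v\<in>F (x s). (x has_vector_derivative v) (at s)" if "s \<in> {b<..<T} - (N1 \<union> N2)" for s
      using N1(3)[of s] that b by auto
    show "\<exists>w. (p has_vector_derivative - w) (at s) \<and>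
       (\<forall>y\<in>K. w \<bullet> (y - x s) \<le> H y (p s) - H (x s) (p s) + c * norm (p s) / 2 * (norm (y - x s))\<^sup>2)"
      if "s \<in> {b<..<T} - (N1 \<union> N2)" for s
      using N2(3)[of s] that b by auto
    show "pmin \<le> norm (p s)" "norm (p s) \<le> pmax" "l-lipschitz_on K (\<lambda>y. Z y (p s))" if "s \<in> {b..T}" for s
      using s1(2)[of s] s2(2)[of s] l[of s] that sub by (auto simp: pmin_def pmax_def)
    have e: "exp (2 * l * (T - b)) \<le> exp (2 * l * (T - t0))" "exp (2 * l * (T - b) + 1) \<le> exp (2 * l * (T - t0) + 1)"
      using b \<open>0 \<le> l\<close> by (auto intro!: mult_left_mono)
    show "exp (2 * l * (T - b)) * (2 * M * \<delta>)\<^sup>2 \<le> r1\<^sup>2"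
      using mult_right_mono[OF e(1) zero_le_power2[of "2 * M * \<delta>"]] \<delta>(2) by linarith
    have k: "0 < pmin / (32 * R)" "0 \<le> pmax" using pmin R_pos by (simp_all add: pmax_def)
    have "(c * pmax / 2 * (T - b) + \<bar>c1\<bar>) * (exp (2 * l * (T - b) + 1) / (pmin / (32 * R)) * \<delta>) \<le> A * (E * \<delta>)"
      unfolding A_def E_def using e(2) b k nonneg \<delta>(1) less_imp_le[OF \<open>t0 < T\<close>] less_imp_le[OF pmin] less_imp_le[OF R_pos]
      by (intro mult_mono add_mono divide_right_mono order_refl mult_left_mono)
         (auto intro!: mult_nonneg_nonneg add_nonneg_nonneg divide_nonneg_nonneg)
    then show "(c * pmax / 2 * (T - b) + \<bar>c1\<bar>) * (exp (2 * l * (T - b) + 1) / (pmin / (32 * R)) * \<delta>) < 1"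
      using \<delta>(3) by linarith
    fix y assume y: "M-lipschitz_on {b..T} y" "y b = x b" "norm (y T - x T) \<le> r1"
      "\<And>s. s \<in> {b<..<T} \<Longrightarrow> \<exists>v\<in>F (y s). (y has_vector_derivative v) (at s)"
    have "trajectory F T t0 x0 (\<lambda>t. if t \<le> b then x t else y t)"
      by (rule trajectory_concat[OF traj N1(2) y(1,2) b(1,2) y(4)])
    with opt have "\<phi> (x T) \<le> \<phi> ((\<lambda>t. if t \<le> b then x t else y t) T)"
      unfolding mayer_optimal_def by (elim conjE allE impE)
    then have "\<phi> (x T) \<le> \<phi> (y T)" using b(2) by simp
    moreover have "\<phi> (y T) - \<phi> (x T) - q \<bullet> (y T - x T) \<le> c1 * (norm (y T - x T))\<^sup>2"
      using y(3) r1(3) by (intro c1(2)) (simp add: dist_norm norm_minus_commute)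
    moreover have "c1 * (norm (y T - x T))\<^sup>2 \<le> \<bar>c1\<bar> * (norm (y T - x T))\<^sup>2" by (intro mult_right_mono) auto
    moreover have "q = - p T" using p by (simp add: adjoint_solution_def)
    ultimately show "p T \<bullet> (y T - x T) \<le> \<bar>c1\<bar> * (norm (y T - x T))\<^sup>2" by simp
  qed (use b \<delta> r1 pmin \<open>0 \<le> l\<close> t after in auto)
  have "\<forall>s\<in>{max t0 (T - real k * \<delta>)<..<T}. (x has_vector_derivative Z (x s) (p s)) (at s)" for k
  proof (induction k)
    case (Suc k)
    let ?b = "max t0 (T - real (Suc k) * \<delta>)" and ?a = "max t0 (T - real k * \<delta>)"
    have b: "t0 \<le> ?b" "?b < T" "?b \<le> ?a" "?a \<le> T" "?a \<le> ?b + \<delta>"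
      using \<delta>(1) \<open>t0 < T\<close> by (auto simp: algebra_simps max_def add_pos_nonneg)
    show ?case
    proof
      fix s assume s: "s \<in> {?b<..<T}"
      have "(x has_vector_derivative Z (x s) (p s)) (at s within {?b..T})"
        by (rule step[OF b]) (use s Suc.IH in auto)
      then show "(x has_vector_derivative Z (x s) (p s)) (at s)"
        using s by (simp only: at_within_Icc_at greaterThanLessThan_iff)
    qed
  qed simp
  moreover obtain k where "T - t0 \<le> real k * \<delta>" using reals_Archimedean3[OF \<delta>(1)] less_imp_le by metis
  then have "max t0 (T - real k * \<delta>) = t0" by simp
  ultimately have "\<forall>s\<in>{t0<..<T}. (x has_vector_derivative Z (x s) (p s)) (at s)" by metis
  \<comment> \<open>With the empty window \<open>a = b = t0\<close> a last application turns the
    equation on the open interval into one on the closed interval, including the one-sided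
    derivatives at both ends.\<close>
  then show ?thesis using step[of t0 t0 t] t \<open>t0 < T\<close> \<delta>(1) by auto
qed

end

section \<open>Uniform constants and conclusion\<close>

lemma strongly_convex_hamiltonian_exists:
  fixes F :: "'a::euclidean_space \<Rightarrow> 'a set"
  assumes F: "\<And>x. F x \<noteq> {}" "\<And>x. compact (F x)" and F_lip: "hausdorff_locally_lipschitz F"
    and F_growth: "\<exists>\<rho>>0. \<forall>x. \<forall>v\<in>F x. norm v \<le> \<rho> * (1 + norm x)"
    and K: "K \<noteq> {}" "convex K" "compact K"
    and H_semiconvex: "\<exists>c\<ge>0. \<forall>p. semiconvex_on K (c * norm p) (\<lambda>x. hamiltonian F x p)"
    and H_gradient: "\<exists>G. (\<forall>x\<in>K. \<forall>p. p \<noteq> 0 \<longrightarrow> GDERIV (hamiltonian F x) p :> G x p) \<and>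
              (\<forall>P. compact P \<longrightarrow> 0 \<notin> P \<longrightarrow>
                 (\<forall>x\<in>K. \<exists>u>0. \<exists>L. \<forall>p\<in>P. L-lipschitz_on (cball x u \<inter> K) (\<lambda>y. G y p)))"
    and F_strongly_convex: "locally_strongly_convex F"
  obtains Z L M c R where "strongly_convex_hamiltonian F K Z L M c R" "2 * M \<le> 16 * R"
proof -
  obtain \<rho> where \<rho>: "\<rho> > 0" "\<And>x v. v \<in> F x \<Longrightarrow> norm v \<le> \<rho> * (1 + norm x)" using F_growth by blast
  obtain b where b: "\<And>y. y \<in> K \<Longrightarrow> norm y \<le> b" using compact_imp_bounded[OF K(3)] unfolding bounded_iff by blast
  define M where "M = \<rho> * (1 + \<bar>b\<bar>)"
  have "M > 0" using \<rho>(1) by (simp add: M_def add_pos_nonneg)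
  have M: "norm v \<le> M" if "y \<in> K" "v \<in> F y" for y v
  proof -
    have "\<rho> * (1 + norm y) \<le> \<rho> * (1 + \<bar>b\<bar>)" using b[OF that(1)] \<rho>(1) by (intro mult_left_mono) auto
    then show ?thesis using \<rho>(2)[OF that(2)] by (simp add: M_def)
  qed
  obtain R0 where R0: "R0 > 0" "\<And>x. x \<in> K \<Longrightarrow> R_convex R0 (F x)"
    using F_strongly_convex K(3) unfolding locally_strongly_convex_def by blast
  \<comment> \<open>\<open>R\<close>-convexity persists when \<open>R\<close> grows. Taking
    \<open>R\<close> at least \<open>M\<close> bounds the diameter \<open>2 * M\<close> of the
    values by \<open>16 * R\<close>, as the quadratic gap requires.\<close>
  define R where "R = max R0 M"
  have R: "R_convex R (F x)" if "x \<in> K" for x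
  proof -
    have "R0 * norm d \<le> R * norm d" for d :: 'a by (intro mult_right_mono) (auto simp: R_def)
    then have "s \<le> R0 * norm d \<Longrightarrow> s \<le> R * norm d" for s and d :: 'a using order_trans by blast
    then show ?thesis using R0(2)[OF that] unfolding R_convex_def by blast
  qed
  obtain c where c: "c \<ge> 0" "\<And>p. semiconvex_on K (c * norm p) (\<lambda>x. hamiltonian F x p)" using H_semiconvex by blast
  obtain Z where Z_all: "\<forall>x\<in>K. \<forall>p. p \<noteq> 0 \<longrightarrow> GDERIV (hamiltonian F x) p :> Z x p"
    "\<forall>P. compact P \<longrightarrow> 0 \<notin> P \<longrightarrow>
      (\<forall>x\<in>K. \<exists>u>0. \<exists>L. \<forall>p\<in>P. L-lipschitz_on (cball x u \<inter> K) (\<lambda>y. Z y p))"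
    using H_gradient by (elim exE conjE)
  note Z = Z_all[rule_format]
  have Z_bound: "norm (Z y p) \<le> M" if "y \<in> K" "p \<noteq> 0" for y p
  proof -
    obtain v where v: "v \<in> F y" "hamiltonian F y p = v \<bullet> p" using hamiltonian_attained[of F y p, OF F(2,1)] .
    then have "v = Z y p" using hamiltonian_maximizer_eq_gradient[of F y v p, OF F(2) _ _ Z(1)] that by blast
    then show ?thesis using M v(1) that(1) by blast
  qed
  have H_bound: "\<bar>hamiltonian F y p\<bar> \<le> M * norm p" if y: "y \<in> K" for y p
  proof -
    obtain v where v: "v \<in> F y" "hamiltonian F y p = v \<bullet> p" using hamiltonian_attained[of F y p, OF F(2,1)] .
    have "\<bar>v \<bullet> p\<bar> \<le> norm v * norm p" by (rule Cauchy_Schwarz_ineq2)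
    also have "\<dots> \<le> M * norm p" using M[OF y v(1)] by (intro mult_right_mono) auto
    finally show ?thesis using v by simp
  qed
  \<comment> \<open>Dividing by \<open>norm p\<close> gives a family bounded by \<open>M\<close>
    with local Lipschitz constants independent of \<open>p\<close>, so compactness yields one
    \<open>L\<close> for all \<open>p\<close>. For \<open>p = 0\<close> the quotient is 0 by the
    convention on division.\<close>
  obtain L where L: "L \<ge> 0" "\<And>p. p \<in> UNIV \<Longrightarrow> L-lipschitz_on K (\<lambda>y. hamiltonian F y p / norm p)"
  proof (rule uniformly_lipschitz_on_compact[OF K(3), where g = "\<lambda>p y. hamiltonian F y p / norm p" and I = UNIV and B = M])
    show "norm (hamiltonian F y p / norm p) \<le> M" if "y \<in> K" for y p
      using H_bound[OF that, of p] \<open>M > 0\<close> by (cases "p = 0") (auto simp: pos_divide_le_eq)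
    fix x assume "x \<in> K"
    obtain u l where u: "u > 0" "l \<ge> 0" "\<And>y z. y \<in> cball x u \<Longrightarrow> z \<in> cball x u \<Longrightarrow> hausdorff_dist (F y) (F z) \<le> l * dist y z"
      using F_lip unfolding hausdorff_locally_lipschitz_def by blast
    have le: "hamiltonian F y p \<le> hamiltonian F z p + l * dist y z * norm p"
      if "y \<in> cball x u" "z \<in> cball x u" for y z p
      using hamiltonian_le_add_hausdorff_dist[of F y z p, OF F(2,2,1,1)]
        mult_right_mono[OF u(3)[OF that] norm_ge_zero[of p]] by simp
    have "l-lipschitz_on (cball x u \<inter> K) (\<lambda>y. hamiltonian F y p / norm p)" for p
    proof (rule lipschitz_onI)
      fix y z assume "y \<in> cball x u \<inter> K" "z \<in> cball x u \<inter> K"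
      then have "\<bar>hamiltonian F y p - hamiltonian F z p\<bar> \<le> l * dist y z * norm p"
        using le[of y z p] le[of z y p] by (auto simp: dist_commute abs_le_iff)
      then show "dist (hamiltonian F y p / norm p) (hamiltonian F z p / norm p) \<le> l * dist y z"
        using u(2) by (cases "p = 0") (auto simp: dist_real_def diff_divide_distrib[symmetric] pos_divide_le_eq)
    qed (rule u(2))
    then show "\<exists>u>0. \<exists>L. \<forall>p\<in>UNIV. L-lipschitz_on (cball x u \<inter> K) (\<lambda>y. hamiltonian F y p / norm p)"
      using u(1) by blast
  qed blast
  have H_lip: "(L * norm p)-lipschitz_on K (\<lambda>y. hamiltonian F y p)" for p
  proof (rule lipschitz_onI)
    fix y z assume yz: "y \<in> K" "z \<in> K"
    show "dist (hamiltonian F y p) (hamiltonian F z p) \<le> L * norm p * dist y z"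
    proof (cases "p = 0")
      case True
      then show ?thesis using H_bound[OF yz(1), of p] H_bound[OF yz(2), of p] by simp
    next
      case False
      then show ?thesis using lipschitz_onD[OF L(2)[of p] yz]
        by (simp add: dist_real_def diff_divide_distrib[symmetric] pos_divide_le_eq mult_ac)
    qed
  qed (use L in simp)
  have "\<exists>l. \<forall>p\<in>P. l-lipschitz_on K (\<lambda>y. Z y p)" if P: "compact P" "0 \<notin> P" for P
  proof -
    have "norm (Z y p) \<le> M" if "p \<in> P" "y \<in> K" for p y
      using P(2) that by (intro Z_bound) auto
    then obtain l where "0 \<le> l" "\<And>p. p \<in> P \<Longrightarrow> l-lipschitz_on K (\<lambda>y. Z y p)"
      by (rule uniformly_lipschitz_on_compact[OF K(3) _ Z(2)[OF P]]) (assumption+, rule that)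
    then show ?thesis by (intro exI[of _ l] ballI)
  qed
  then have "strongly_convex_hamiltonian F K Z L M c R"
    using K F M H_lip L(1) \<open>M > 0\<close> c Z(1) R R0(1) by unfold_locales (auto simp: R_def)
  then show thesis using that[of Z L M c R] \<open>M > 0\<close> by (auto simp: R_def)
qed

theorem theorem4p1:
  fixes F :: "real ^ 'n \<Rightarrow> (real ^ 'n) set"
    and \<phi> :: "real ^ 'n \<Rightarrow> real"
    and T t0 :: real
    and x0 q :: "real ^ 'n"
    and xbar :: "real \<Rightarrow> real ^ 'n"
  assumes T_pos: "0 < T"
    and t0: "t0 \<in> {0..T}"
    and F_values: "\<And>x. F x \<noteq> {}" "\<And>x. convex (F x)" "\<And>x. compact (F x)"
    and F_lipschitz: "hausdorff_locally_lipschitz F"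
    and F_growth: "\<exists>\<rho>>0. \<forall>x. \<forall>v\<in>F x. norm v \<le> \<rho> * (1 + norm x)"
    and H_semiconvex: "\<And>K. K \<noteq> {} \<Longrightarrow> convex K \<Longrightarrow> compact K \<Longrightarrow>
          \<exists>c\<ge>0. \<forall>p. semiconvex_on K (c * norm p) (\<lambda>x. hamiltonian F x p)"
    and H_gradient: "\<And>K. K \<noteq> {} \<Longrightarrow> convex K \<Longrightarrow> compact K \<Longrightarrow>
          \<exists>G. (\<forall>x\<in>K. \<forall>p. p \<noteq> 0 \<longrightarrow> GDERIV (hamiltonian F x) p :> G x p) \<and>
              (\<forall>P. compact P \<longrightarrow> 0 \<notin> P \<longrightarrow>
                 (\<forall>x\<in>K. \<exists>u>0. \<exists>L. \<forall>p\<in>P. L-lipschitz_on (cball x u \<inter> K) (\<lambda>y. G y p)))"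
    and F_strongly_convex: "locally_strongly_convex F"
    and \<phi>_lipschitz: "locally_lipschitz \<phi>"
    and xbar_optimal: "mayer_optimal F \<phi> T t0 x0 xbar"
    and q: "q \<in> proximal_superdifferential \<phi> (xbar T)"
  shows "(\<exists>p. adjoint_solution F T t0 xbar q p) \<and>
    (\<forall>p. adjoint_solution F T t0 xbar q p \<longrightarrow>
       (AE t in lebesgue_on {t0..T}.
          \<exists>v. (xbar has_vector_derivative v) (at t within {t0..T}) \<and>
              hamiltonian F (xbar t) (p t) = v \<bullet> p t) \<and>
       (q \<noteq> 0 \<longrightarrow>
          (\<forall>t\<in>{t0..T}.
             \<exists>v. (xbar has_vector_derivative v) (at t within {t0..T}) \<and>
                 hamiltonian F (xbar t) (p t) = v \<bullet> p t)))"
proof (cases "t0 = T")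
  case True
  \<comment> \<open>The interval is a single point: almost everywhere statements hold vacuously, and
    every vector is a derivative within it, so a maximizer may serve as one.\<close>
  have null: "AE s in lebesgue_on {t0..T}. Q s" for Q
    unfolding AE_lebesgue_on_iff_negligible[OF fmeasurableD[OF lmeasurable_interval(1)]]
    by (rule exI[of _ "{T}"]) (use True in auto)
  have adj: "adjoint_solution F T t0 xbar q (\<lambda>_. - q)"
    unfolding adjoint_solution_def
    by (intro conjI null lipschitz_imp_absolutely_continuous_on[OF lipschitz_on_constant]) simp
  have max: "\<exists>v. (xbar has_vector_derivative v) (at t within {t0..T}) \<and> hamiltonian F (xbar t) (p t) = v \<bullet> p t"
    if t: "t \<in> {t0..T}" for p :: "real \<Rightarrow> real ^ 'n" and t
  proof -
    obtain v where "v \<in> F (xbar t)" "hamiltonian F (xbar t) (p t) = v \<bullet> p t"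
      by (rule hamiltonian_attained[of F "xbar t" "p t", OF F_values(3,1)])
    moreover have "{t0..T} = {t}" using t True by auto
    then have "(xbar has_vector_derivative v) (at t within {t0..T})"
      by (simp add: has_vector_derivative_def has_derivative_within_singleton_iff bounded_linear_scaleR_left)
    ultimately show ?thesis by blast
  qed
  show ?thesis
    using adj by (intro conjI allI impI ballI null max) (rule exI)
next
  case False
  then have "t0 < T" using t0 by simp
  have traj: "trajectory F T t0 x0 xbar" using xbar_optimal by (simp add: mayer_optimal_def)
  then have cont: "continuous_on {t0..T} xbar"
    by (intro absolutely_continuous_on_imp_continuous_on) (simp add: trajectory_def)
  then obtain b where b: "\<And>s. s \<in> {t0..T} \<Longrightarrow> norm (xbar s) \<le> b"
    using compact_imp_bounded[OF compact_continuous_image[OF cont compact_Icc]] unfolding bounded_iff by blast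
  \<comment> \<open>The margin 1 beyond the bound on \<open>xbar\<close> leaves room for a tube of
    radius 1 around the trajectory.\<close>
  define K where "K = cball (0 :: real ^ 'n) (b + 1)"
  have tube: "cball (xbar s) 1 \<subseteq> K" if "s \<in> {t0..T}" for s
    using b[OF that] unfolding K_def by (simp add: cball_subset_cball_iff dist_norm)
  have xi: "xbar ` {t0..T} \<subseteq> interior K"
  proof (rule image_subsetI)
    fix s assume "s \<in> {t0..T}"
    then show "xbar s \<in> interior K" using tube zero_less_one unfolding mem_interior_cball by blast
  qed
  have "K \<noteq> {}" using tube[of T] \<open>t0 < T\<close> by fastforce
  moreover have "convex K" "compact K" by (simp_all add: K_def)
  ultimately obtain Z L M c R where "strongly_convex_hamiltonian F K Z L M c R" and MR: "2 * M \<le> 16 * R"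
    using strongly_convex_hamiltonian_exists[OF F_values(1,3) F_lipschitz F_growth _ _ _ H_semiconvex H_gradient F_strongly_convex]
    by metis
  then interpret strongly_convex_hamiltonian F K Z L M c R by blast
  have max: "\<exists>v. (xbar has_vector_derivative v) (at t within {t0..T}) \<and> hamiltonian F (xbar t) (p t) = v \<bullet> p t"
    if p: "adjoint_solution F T t0 xbar q p" and "q \<noteq> 0" and t: "t \<in> {t0..T}" for p t
  proof (intro exI conjI)
    show "(xbar has_vector_derivative Z (xbar t) (p t)) (at t within {t0..T})"
      by (rule optimal_trajectory_derivative[OF \<open>t0 < T\<close> MR xbar_optimal zero_less_one tube p \<open>q \<noteq> 0\<close> q t])
    show "hamiltonian F (xbar t) (p t) = Z (xbar t) (p t) \<bullet> p t"
    proof (rule Z_maximizes(2))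
      show "xbar t \<in> K" using tube[OF t] by auto
      show "p t \<noteq> 0" using adjoint_solution_zero_iff[OF p xi t] \<open>q \<noteq> 0\<close> by simp
    qed
  qed
  have "AE t in lebesgue_on {t0..T}. \<exists>v. (xbar has_vector_derivative v) (at t within {t0..T}) \<and>
      hamiltonian F (xbar t) (p t) = v \<bullet> p t" if p: "adjoint_solution F T t0 xbar q p" for p
  proof (cases "q = 0")
    case True
    \<comment> \<open>The arc \<open>p\<close> vanishes identically here, so both sides of the
      maximum principle are 0 and only the existence of the derivative of \<open>xbar\<close>
      remains.\<close>
    have "hamiltonian F y 0 = 0" for y
      using hamiltonian_attained[of F y 0, OF F_values(3,1)] by auto
    then have zero: "hamiltonian F (xbar t) (p t) = v \<bullet> p t" if "t \<in> {t0..T}" for t v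
      using adjoint_solution_zero_iff[OF p xi that] True by simp
    have ae: "AE s in lebesgue_on {t0..T}. \<exists>v. (xbar has_vector_derivative v) (at s within {t0..T}) \<and> v \<in> F (xbar s)"
      using traj by (simp add: trajectory_def)
    show ?thesis
      by (rule AE_mp[OF ae], rule AE_I2) (use zero in auto)
  qed (rule AE_I2, simp add: max[OF p])
  then show ?thesis using adjoint_exists[OF \<open>t0 < T\<close> cont xi] max by blast
qed

end
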